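(* Let $q:G'\to G$ be an epimorphism of groups with finite kernel $\Gamma$, and let $W$ be a closed connected oriented surface of positive genus with $\pi=\pi_1(W)$ whose first Betti number $b=2-\chi(W)$ satisfies $b>\log_2(|[\Gamma,G']|-1)$ (this condition is considered vacuous if $[\Gamma,G']=1$). Let $g:\pi\to G$ be an epimorphism. Then $g$ lifts to $G'$ (i.e. there is a homomorphism $g':\pi\to G'$ with $qg'=g$) if and only if $g_*([W])\in H_2(G;\mathbb{Z})$ lies in the image of $q_*:H_2(G';\mathbb{Z})\to H_2(G;\mathbb{Z})$. Moreover, if $g$ lifts to $G'$, then $$|\mathrm{Hom}_g(\pi,G')|\ \ge\ |\Gamma|^b\,|[\Gamma,G']|^{-1}\left(1-\frac{|[\Gamma,G']|-1}{2^b}\right).$$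
   Context: $[W]\in H_2(W;\mathbb{Z})=H_2(\pi;\mathbb{Z})$ is the fundamental class. $\mathrm{Hom}_g(\pi,G')$ is the set of homomorphisms $g':\pi\to G'$ with $qg'=g$. $[\Gamma,G']$ is the subgroup of $\Gamma$ generated by commutators of elements of $\Gamma$ with elements of $G'$. *)

theory Defs
  imports "HOL-Algebra.Algebra" "HOL-Library.FuncSet"
begin

definition mixed_commutator :: "('a,'m) monoid_scheme \<Rightarrow> 'a set \<Rightarrow> 'a set \<Rightarrow> 'a set" where
  "mixed_commutator G H K =
     generate G {x \<otimes>\<^bsub>G\<^esub> y \<otimes>\<^bsub>G\<^esub> inv\<^bsub>G\<^esub> x \<otimes>\<^bsub>G\<^esub> inv\<^bsub>G\<^esub> y | x y. x \<in> H \<and> y \<in> K}"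

text \<open>Surface group of genus h: generators a_i, b_i (i<h), one relation
  prod_i [a_i,b_i] = 1. A homomorphism pi -> H is the same as a tuple satisfying it.
  The relator word, as a list of group elements:\<close>
definition surface_word :: "('a,'m) monoid_scheme \<Rightarrow> nat \<Rightarrow> (nat \<Rightarrow> 'a) \<Rightarrow> (nat \<Rightarrow> 'a) \<Rightarrow> 'a list" where
  "surface_word G h a b =
     concat (map (\<lambda>i. [a i, b i, inv\<^bsub>G\<^esub> (a i), inv\<^bsub>G\<^esub> (b i)]) [0..<h])"

definition surface_rel :: "('a,'m) monoid_scheme \<Rightarrow> nat \<Rightarrow> (nat \<Rightarrow> 'a) \<Rightarrow> (nat \<Rightarrow> 'a) \<Rightarrow> bool" where
  "surface_rel G h a b \<longleftrightarrow> foldr (\<lambda>x y. x \<otimes>\<^bsub>G\<^esub> y) (surface_word G h a b) \<one>\<^bsub>G\<^esub> = \<one>\<^bsub>G\<^esub>"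

definition surface_homs :: "('a,'m) monoid_scheme \<Rightarrow> nat \<Rightarrow> ((nat \<Rightarrow> 'a) \<times> (nat \<Rightarrow> 'a)) set" where
  "surface_homs H h = {(a,b). a \<in> {..<h} \<rightarrow>\<^sub>E carrier H \<and> b \<in> {..<h} \<rightarrow>\<^sub>E carrier H \<and> surface_rel H h a b}"

definition surface_epis :: "('a,'m) monoid_scheme \<Rightarrow> nat \<Rightarrow> ((nat \<Rightarrow> 'a) \<times> (nat \<Rightarrow> 'a)) set" where
  "surface_epis G h = {(a,b). (a,b) \<in> surface_homs G h \<and> generate G (a ` {..<h} \<union> b ` {..<h}) = carrier G}"

definition lifts :: "('b,'n) monoid_scheme \<Rightarrow> ('b \<Rightarrow> 'a) \<Rightarrow> nat \<Rightarrow> (nat \<Rightarrow> 'a) \<Rightarrow> (nat \<Rightarrow> 'a)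
    \<Rightarrow> ((nat \<Rightarrow> 'b) \<times> (nat \<Rightarrow> 'b)) set" where
  "lifts G' q h a b = {(a',b'). (a',b') \<in> surface_homs G' h \<and> (\<forall>i<h. q (a' i) = a i \<and> q (b' i) = b i)}"

definition chains1 :: "('a,'m) monoid_scheme \<Rightarrow> ('a \<Rightarrow> int) set" where
  "chains1 G = {c. finite {x. c x \<noteq> 0} \<and> {x. c x \<noteq> 0} \<subseteq> carrier G}"
definition chains2 :: "('a,'m) monoid_scheme \<Rightarrow> ('a \<times> 'a \<Rightarrow> int) set" where
  "chains2 G = {c. finite {p. c p \<noteq> 0} \<and> {p. c p \<noteq> 0} \<subseteq> carrier G \<times> carrier G}"
definition chains3 :: "('a,'m) monoid_scheme \<Rightarrow> ('a \<times> 'a \<times> 'a \<Rightarrow> int) set" where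
  "chains3 G = {c. finite {p. c p \<noteq> 0} \<and> {p. c p \<noteq> 0} \<subseteq> carrier G \<times> carrier G \<times> carrier G}"

definition ind :: "'x \<Rightarrow> 'x \<Rightarrow> int" where "ind u v = (if u = v then 1 else 0)"

definition bar_d2 :: "('a,'m) monoid_scheme \<Rightarrow> ('a \<times> 'a \<Rightarrow> int) \<Rightarrow> ('a \<Rightarrow> int)" where
  "bar_d2 G c = (\<lambda>z. \<Sum>p\<in>{p. c p \<noteq> 0}. c p *
      (ind z (snd p) - ind z (fst p \<otimes>\<^bsub>G\<^esub> snd p) + ind z (fst p)))"

definition bar_d3 :: "('a,'m) monoid_scheme \<Rightarrow> ('a \<times> 'a \<times> 'a \<Rightarrow> int) \<Rightarrow> ('a \<times> 'a \<Rightarrow> int)" where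
  "bar_d3 G c = (\<lambda>w. \<Sum>p\<in>{p. c p \<noteq> 0}. c p *
      (case p of (x,y,z) \<Rightarrow>
        ind w (y,z) - ind w (x \<otimes>\<^bsub>G\<^esub> y, z) + ind w (x, y \<otimes>\<^bsub>G\<^esub> z) - ind w (x,y)))"

definition cycles2 :: "('a,'m) monoid_scheme \<Rightarrow> ('a \<times> 'a \<Rightarrow> int) set" where
  "cycles2 G = {c \<in> chains2 G. bar_d2 G c = (\<lambda>_. 0)}"

definition boundaries2 :: "('a,'m) monoid_scheme \<Rightarrow> ('a \<times> 'a \<Rightarrow> int) set" where
  "boundaries2 G = bar_d3 G ` chains3 G"

definition push2 :: "('b \<Rightarrow> 'a) \<Rightarrow> ('b \<times> 'b \<Rightarrow> int) \<Rightarrow> ('a \<times> 'a \<Rightarrow> int)" where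
  "push2 f c = (\<lambda>(x,y). \<Sum>p\<in>{p. c p \<noteq> 0 \<and> f (fst p) = x \<and> f (snd p) = y}. c p)"

definition in_image_H2 :: "('b,'n) monoid_scheme \<Rightarrow> ('a,'m) monoid_scheme \<Rightarrow> ('b \<Rightarrow> 'a)
    \<Rightarrow> ('a \<times> 'a \<Rightarrow> int) \<Rightarrow> bool" where
  "in_image_H2 G' G f u \<longleftrightarrow> (\<exists>z \<in> cycles2 G'. (\<lambda>p. push2 f z p - u p) \<in> boundaries2 G)"

text \<open>Fan triangulation of the relator polygon: sum_k [p_{k-1} | x_k], p_k prefix products.\<close>
fun word_chain :: "('a,'m) monoid_scheme \<Rightarrow> 'a \<Rightarrow> 'a list \<Rightarrow> ('a \<times> 'a \<Rightarrow> int)" where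
  "word_chain G p [] = (\<lambda>_. 0)"
| "word_chain G p (x # xs) = (\<lambda>w. ind w (p, x) + word_chain G (p \<otimes>\<^bsub>G\<^esub> x) xs w)"

text \<open>Bar 2-cycle representing g_*([W]) for g given by the tuple (a,b):
  the fan chain, corrected by [a_i|a_i^-1], [b_i|b_i^-1] (identifying edges y^-1 with y)
  and degenerate simplices [1|1].\<close>
definition fund_cycle :: "('a,'m) monoid_scheme \<Rightarrow> nat \<Rightarrow> (nat \<Rightarrow> 'a) \<Rightarrow> (nat \<Rightarrow> 'a) \<Rightarrow> ('a \<times> 'a \<Rightarrow> int)" where
  "fund_cycle G h a b = (\<lambda>w. word_chain G \<one>\<^bsub>G\<^esub> (surface_word G h a b) w
      - (\<Sum>i<h. ind w (a i, inv\<^bsub>G\<^esub> (a i)) + ind w (b i, inv\<^bsub>G\<^esub> (b i)))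
      - 2 * int h * ind w (\<one>\<^bsub>G\<^esub>, \<one>\<^bsub>G\<^esub>))"

end

theory Submission
  imports Defs "HOL-Library.Poly_Mapping" "HOL-Computational_Algebra.Fundamental_Theorem_Algebra"
begin

text \<open>
  Counting: fix lifts \<open>s a\<^sub>i, s b\<^sub>i\<close>. After conjugation by the partial products of the commutators, replacing
  them by \<open>\<alpha> s a\<^sub>i\<close>, \<open>\<beta> s b\<^sub>i\<close> with \<open>\<alpha>, \<beta>\<close> in \<open>\<Gamma>\<close> multiplies the relator by factors
  \<open>\<alpha> \<beta> \<theta>(\<alpha>)\<^sup>-\<^sup>1 \<phi>(\<beta>)\<^sup>-\<^sup>1\<close> with automorphisms \<open>\<theta>, \<phi>\<close> of \<open>\<Gamma>\<close>, so the lifts are counted by a coefficient of a product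
  of averages \<open>Z\<close> of such elements in the complex group algebra of \<open>\<Gamma>\<close>. Modulo \<open>[\<Gamma>, \<Gamma>]\<close> this product is
  the uniform distribution on \<open>[\<Gamma>, G']\<close>. On a minimal two-sided ideal of dimension \<open>n\<close>, Schur's lemma shows that \<open>Z\<close>
  is \<open>1/n\<close> times a partial isometry, and \<open>n \<ge> 4\<close> if the ideal is not commutative. Hence each \<open>Z\<close> contracts the
  complement of the commutative part by \<open>1/4\<close>, which bounds the deviation from uniformity.

  Obstruction: \<open>G' / [\<Gamma>, G']\<close> is a central extension of \<open>G\<close>. Its factor set is a 2-cocycle whose
  value on \<open>g\<^sub>*[W]\<close> is the relator of any lifts, and which becomes a coboundary on \<open>G'\<close>; so if \<open>g\<^sub>*[W]\<close>
  lies in the image of \<open>q\<^sub>*\<close>, the relator lies in \<open>[\<Gamma>, G']\<close> and the count is positive.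
\<close>

section \<open>The group algebra of an additive group\<close>

text \<open>The group \<open>G'\<close> is felt in the algebra of \<Gamma> only through the
  automorphisms \<theta>, \<phi>, which may permute the minimal ideals. Schur's lemma is therefore
  applied to elements \<open>w\<close> with \<open>a w = w \<theta>(a)\<close> in place of central
  ones.

  Representations are replaced by central projections \<open>e\<close>: the dimension of the ideal
  of \<open>e\<close> is \<open>|\<Gamma>| tr e\<close>. The number 4 comes from four orthogonal
  elements \<open>e\<close>, \<open>x\<close>, \<open>y\<close>, \<open>[x, y]\<close> of a
  noncommutative ideal. Since \<open>nrm\<close> is a squared norm, the contraction appears below as
  1/16.

  The numerator \<open>|[\<Gamma>, G']| - 1\<close> of the bound comes from the complement
  \<open>f\<close> of the commutative part: a coefficient of the deviation is an inner product of
  two elements of the ideal of \<open>f\<close>, and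
  \<open>tr f = 1 - 1/|[\<Gamma>, \<Gamma>]|\<close> is at most
  \<open>1 - 1/|[\<Gamma>, G']|\<close>.

  Surjectivity of \<open>g\<close> enters the count because the elements by which \<theta>, \<phi>
  conjugate must, together with \<Gamma>, generate \<open>G'\<close>; only then do the twisted
  commutators fill all of \<open>[\<Gamma>, G']\<close>.\<close>

type_synonym 'g galg = "'g \<Rightarrow>\<^sub>0 complex"

abbreviation coef :: "('g \<Rightarrow>\<^sub>0 'c::zero) \<Rightarrow> 'g \<Rightarrow> 'c" where "coef \<equiv> Poly_Mapping.lookup"

definition scal :: "complex \<Rightarrow> 'g::group_add galg" where "scal c = Poly_Mapping.single 0 c"
definition elt :: "'g::group_add \<Rightarrow> 'g galg" where "elt g = Poly_Mapping.single g 1"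

lemma galg_induct [case_names zero add single]:
  fixes x :: "'g galg"
  assumes "P 0" "\<And>x y. P x \<Longrightarrow> P y \<Longrightarrow> P (x + y)" "\<And>g c. P (Poly_Mapping.single g c)"
  shows "P x"
proof (induction x rule: Poly_Mapping.update_induct)
  case (update f a b)
  have "Poly_Mapping.update a b f = f + Poly_Mapping.single a b"
    using update(1) by (intro poly_mapping_eqI)
      (auto simp: lookup_update lookup_add lookup_single in_keys_iff when_def)
  then show ?case using assms update by simp
qed (rule assms)

lemma single_conv: "Poly_Mapping.single g c = scal c * elt g"
  by (simp add: scal_def elt_def mult_single)

lemma elt_0: "elt 0 = 1" by (simp add: elt_def)
lemma elt_add: "elt (g + h) = elt g * elt h" by (simp add: elt_def mult_single)
lemma elt_minus_mult [simp]: "elt (- g) * elt g = 1" "elt g * elt (- g) = 1"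
  by (simp_all add: elt_0 flip: elt_add)
lemma elt_minus_mult' [simp]: "elt (- g) * (elt g * x) = x" "elt g * (elt (- g) * x) = x"
  by (simp_all flip: mult.assoc)
lemma scal_0 [simp]: "scal 0 = 0" by (simp add: scal_def)
lemma scal_1 [simp]: "scal 1 = 1" by (simp add: scal_def)
lemma scal_add: "scal (c + d) = scal c + scal d" by (simp add: scal_def single_add)
lemma scal_minus: "scal (- c) = - scal c" by (simp add: scal_def single_uminus)
lemma scal_mult: "scal (c * d) = scal c * scal d" by (simp add: scal_def mult_single)
lemma scal_of_nat: "scal (of_nat n) = of_nat n" by (simp add: scal_def)
lemma scal_mult_scal [simp]: "scal c * scal d = scal (c * d)"
  "scal c * (scal d * x) = scal (c * d) * x"
  by (simp_all add: scal_mult mult.assoc)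

lemma scal_commute: "x * scal c = scal c * x"
  by (induction x rule: galg_induct) (auto simp: ring_distribs scal_def mult_single mult.commute)
lemma scal_left_commute: "x * (scal c * y) = scal c * (x * y)"
  by (metis mult.assoc scal_commute)

lemma shift_eqs: "h + k = g \<longleftrightarrow> k = - h + g" "k + h = g \<longleftrightarrow> k = g - h" for g h k :: "'g::group_add"
  by (auto simp: add.assoc[symmetric])
lemma lookup_scal [simp]: "coef (scal c * x) g = c * coef x g"
  by (induction x rule: galg_induct)
    (auto simp: ring_distribs scal_def mult_single lookup_add lookup_single when_def)
lemma lookup_elt_mult [simp]: "coef (elt h * x) g = coef x (- h + g)"
  by (induction x rule: galg_induct)
    (auto simp: ring_distribs elt_def mult_single lookup_add lookup_single shift_eqs(1))
lemma lookup_mult_elt [simp]: "coef (x * elt h) g = coef x (g - h)"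
  by (induction x rule: galg_induct)
    (auto simp: ring_distribs elt_def mult_single lookup_add lookup_single shift_eqs(2))
lemma lookup_elt: "coef (elt h) g = (if g = h then 1 else 0)"
  by (simp add: elt_def lookup_single when_def)

section \<open>The involution, the trace and the inner product of the group algebra\<close>

lift_definition star :: "'g::group_add galg \<Rightarrow> 'g galg" is
  "\<lambda>f g. cnj (f (- g))"
proof -
  fix f :: "'g \<Rightarrow> complex" assume "finite {g. f g \<noteq> 0}"
  then have "finite (uminus ` {g. f g \<noteq> 0})" by (rule finite_imageI)
  moreover have "{g. cnj (f (- g)) \<noteq> 0} \<subseteq> uminus ` {g. f g \<noteq> 0}"
    by (force simp: image_iff)
  ultimately show "finite {g. cnj (f (- g)) \<noteq> 0}" by (rule rev_finite_subset)
qed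

lemma lookup_star: "coef (star x) g = cnj (coef x (- g))"
  by (simp add: star.rep_eq)
lemma star_star [simp]: "star (star x) = x"
  by (rule poly_mapping_eqI) (simp add: lookup_star)
lemma star_0 [simp]: "star 0 = 0"
  by (rule poly_mapping_eqI) (simp add: lookup_star)
lemma star_add: "star (x + y) = star x + star y"
  by (rule poly_mapping_eqI) (simp add: lookup_star lookup_add)
lemma star_diff: "star (x - y) = star x - star y"
  by (rule poly_mapping_eqI) (simp add: lookup_star lookup_minus)
lemma star_single: "star (Poly_Mapping.single g c) = Poly_Mapping.single (- g) (cnj c)"
  by (rule poly_mapping_eqI) (auto simp: lookup_star lookup_single when_def)
lemma star_elt [simp]: "star (elt g) = elt (- g)" by (simp add: elt_def star_single)
lemma star_scal [simp]: "star (scal c) = scal (cnj c)" by (simp add: scal_def star_single)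
lemma star_1 [simp]: "star 1 = 1" using star_scal[of 1] by simp
lemma star_sum: "star (\<Sum>i\<in>I. f i) = (\<Sum>i\<in>I. star (f i))"
  by (induction I rule: infinite_finite_induct) (auto simp: star_add)
lemma star_mult: "star (x * y) = star y * star x"
proof (induction x rule: galg_induct)
  case (single g c)
  show ?case
    by (induction y rule: galg_induct)
      (auto simp: ring_distribs star_add star_single mult_single minus_add mult.commute)
qed (auto simp: ring_distribs star_add)
lemma star_scal_mult: "star (scal c * x) = scal (cnj c) * star x"
  by (simp add: star_mult scal_commute)
text \<open>For a finite group this is the trace of the regular representation divided by the group
  order. Hence the order times \<open>tr e\<close> is the dimension of the ideal of a central
  projection \<open>e\<close>.\<close>

definition tr :: "'g::group_add galg \<Rightarrow> complex" where "tr x = coef x 0"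

lemma tr_simps [simp]: "tr 0 = 0" "tr 1 = 1" "tr (x + y) = tr x + tr y" "tr (x - y) = tr x - tr y"
  "tr (- x) = - tr x" "tr (scal c * x) = c * tr x"
  by (simp_all add: tr_def lookup_add lookup_minus)
lemma tr_sum: "tr (\<Sum>i\<in>I. f i) = (\<Sum>i\<in>I. tr (f i))"
  by (simp add: tr_def lookup_sum)
lemma tr_star [simp]: "tr (star x) = cnj (tr x)" by (simp add: tr_def lookup_star)
lemma add_eq_0_commute: "a + b = 0 \<longleftrightarrow> b + a = (0 :: 'g::group_add)"
  by (metis eq_neg_iff_add_eq_0 neg_eq_iff_add_eq_0)
lemma tr_commute: "tr (x * y) = tr (y * x)"
proof (induction x rule: galg_induct)
  case (single g c)
  show ?case
    by (induction y rule: galg_induct)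
      (auto simp: ring_distribs mult_single tr_def lookup_single lookup_add add_eq_0_commute[of g] mult.commute[of c])
qed (auto simp: ring_distribs)
lemma lookup_conv_tr: "coef x g = tr (x * elt (- g))" by (simp add: tr_def)

text \<open>The squared norm for the inner product \<open>tr (x * star y)\<close>, in which the
  group elements are orthonormal.\<close>

definition nrm :: "'g::group_add galg \<Rightarrow> real" where "nrm x = Re (tr (x * star x))"

lemma tr_mult_star_aux:
  "finite K \<Longrightarrow> Poly_Mapping.keys x \<subseteq> K \<Longrightarrow>
   tr (x * star y) = (\<Sum>g\<in>K. coef x g * cnj (coef y g))"
proof (induction x rule: Poly_Mapping.update_induct)
  case const then show ?case by simp
next
  case (update f a b)
  have eq: "Poly_Mapping.update a b f = f + Poly_Mapping.single a b"
    using update(1) by (intro poly_mapping_eqI)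
      (auto simp: lookup_update lookup_add lookup_single in_keys_iff when_def)
  have K: "a \<in> K" "Poly_Mapping.keys f \<subseteq> K" using update by (auto simp: keys_update)
  have "tr (Poly_Mapping.single a b * star y) = b * cnj (coef y a)"
    by (simp add: single_conv mult.assoc tr_def lookup_star)
  moreover have "(\<Sum>g\<in>K. coef (Poly_Mapping.single a b) g * cnj (coef y g))
      = b * cnj (coef y a)"
    using K update.prems(1) by (subst sum.remove[of _ a]) (auto simp: lookup_single intro!: sum.neutral)
  ultimately show ?case
    using update.IH[OF update.prems(1) K(2)] unfolding eq
    by (simp add: ring_distribs lookup_add sum.distrib)
qed

lemma nrm_eq_sum:
  assumes "finite K" "Poly_Mapping.keys x \<subseteq> K"
  shows "nrm x = (\<Sum>g\<in>K. (cmod (coef x g))\<^sup>2)"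
  unfolding nrm_def tr_mult_star_aux[OF assms] by (simp add: complex_norm_square[symmetric] flip: of_real_power)

lemma nrm_nonneg [simp]: "nrm x \<ge> 0"
  by (simp add: nrm_eq_sum[of "Poly_Mapping.keys x"] sum_nonneg)
lemma nrm_0 [simp]: "nrm 0 = 0" by (simp add: nrm_def)
lemma nrm_eq_0_iff [simp]: "nrm x = 0 \<longleftrightarrow> x = 0"
proof
  assume "nrm x = 0"
  then have "\<forall>g\<in>Poly_Mapping.keys x. coef x g = 0"
    by (simp add: nrm_eq_sum[of "Poly_Mapping.keys x"] sum_nonneg_eq_0_iff)
  then show "x = 0" by (intro poly_mapping_eqI) (auto simp: in_keys_iff)
qed simp
lemma nrm_pos_iff: "nrm x > 0 \<longleftrightarrow> x \<noteq> 0"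
  using nrm_nonneg[of x] nrm_eq_0_iff[of x] by linarith

lemma tr_mult_star_self: "tr (x * star x) = complex_of_real (nrm x)"
proof -
  have "cnj (tr (x * star x)) = tr (x * star x)" by (simp add: star_mult flip: tr_star)
  then show ?thesis unfolding nrm_def by (metis Reals_cnj_iff of_real_Re)
qed

lemma mult_star_self_eq_0: "x * star x = 0 \<Longrightarrow> x = 0"
  using nrm_eq_0_iff[of x] by (simp add: nrm_def)

lemma nrm_scal: "nrm (scal c * x) = (cmod c)\<^sup>2 * nrm x"
proof -
  have "scal c * x * star (scal c * x) = scal (c * cnj c) * (x * star x)"
    by (simp only: star_scal_mult mult.assoc scal_left_commute[of x] scal_mult_scal)
  then have "tr (scal c * x * star (scal c * x)) = of_real ((cmod c)\<^sup>2 * nrm x)"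
    by (simp add: tr_mult_star_self complex_norm_square[symmetric])
  then show ?thesis unfolding tr_mult_star_self of_real_eq_iff .
qed

lemma nrm_star [simp]: "nrm (star x) = nrm x"
  by (simp add: nrm_def tr_commute[of "star x"])
lemma nrm_mult_elt [simp]: "nrm (x * elt g) = nrm x"
  by (simp add: nrm_def star_mult mult.assoc)

lemma nrm_pythagoras: "tr (x * star y) = 0 \<Longrightarrow> nrm (x + y) = nrm x + nrm y"
proof -
  assume 0: "tr (x * star y) = 0"
  then have "cnj (tr (x * star y)) = 0" by simp
  then have "tr (y * star x) = 0" by (metis star_mult star_star tr_star)
  with 0 show ?thesis by (simp add: nrm_def star_add ring_distribs)
qed

text \<open>\<open>scal c * v\<close> is the orthogonal projection of \<xi> to the line of
  \<open>v\<close>, and Pythagoras measures the remainder.\<close>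

lemma bessel_step:
  fixes \<xi> v :: "'g::group_add galg"
  assumes "v \<noteq> 0"
  defines "c \<equiv> tr (\<xi> * star v) / of_real (nrm v)"
  shows "nrm (\<xi> - scal c * v) = nrm \<xi> - (cmod (tr (\<xi> * star v)))\<^sup>2 / nrm v"
proof -
  have pos: "nrm v > 0" using assms by (simp add: nrm_pos_iff)
  have "tr ((\<xi> - scal c * v) * star v) = 0"
    using pos by (simp add: left_diff_distrib mult.assoc tr_mult_star_self c_def)
  then have "tr ((\<xi> - scal c * v) * star (scal c * v)) = 0"
    by (simp add: star_scal_mult scal_left_commute[of "\<xi> - scal c * v"])
  then have "nrm ((\<xi> - scal c * v) + scal c * v) = nrm (\<xi> - scal c * v) + nrm (scal c * v)"
    by (rule nrm_pythagoras)
  moreover have "nrm (scal c * v) = (cmod (tr (\<xi> * star v)))\<^sup>2 / nrm v"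
    using pos by (simp add: nrm_scal c_def norm_divide power_divide power2_eq_square)
  ultimately show ?thesis by simp
qed

lemma cauchy_schwarz: "(cmod (tr (x * star y)))\<^sup>2 \<le> nrm x * nrm y"
proof (cases "y = 0")
  case False
  then have "0 \<le> nrm x - (cmod (tr (x * star y)))\<^sup>2 / nrm y"
    using bessel_step[OF False, of x] nrm_nonneg by metis
  with False show ?thesis by (simp add: field_simps nrm_pos_iff)
qed simp

text \<open>Removing from \<xi> its component along the first vector leaves its inner products with
  the others unchanged; this is why the induction is over all \<xi>.\<close>

lemma bessel:
  assumes "pairwise (\<lambda>v w. tr (v * star w) = 0) (set vs)" "distinct vs" "0 \<notin> set vs"
  shows "(\<Sum>v\<leftarrow>vs. (cmod (tr (\<xi> * star v)))\<^sup>2 / nrm v) \<le> nrm \<xi>"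
  using assms
proof (induction vs arbitrary: \<xi>)
  case (Cons v vs)
  define c where "c = tr (\<xi> * star v) / of_real (nrm v)"
  have "tr ((\<xi> - scal c * v) * star w) = tr (\<xi> * star w)" if "w \<in> set vs" for w
  proof -
    have "tr (v * star w) = 0" using Cons.prems that by (auto simp: pairwise_insert)
    then show ?thesis by (simp add: left_diff_distrib mult.assoc)
  qed
  then have "(\<Sum>w\<leftarrow>vs. (cmod (tr (\<xi> * star w)))\<^sup>2 / nrm w) \<le> nrm (\<xi> - scal c * v)"
    using Cons.IH[of "\<xi> - scal c * v"] Cons.prems
    by (simp add: pairwise_insert cong: map_cong)
  also have "\<dots> = nrm \<xi> - (cmod (tr (\<xi> * star v)))\<^sup>2 / nrm v"
    unfolding c_def using Cons.prems by (intro bessel_step) auto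
  finally show ?case by simp
qed simp

section \<open>Central idempotents of the group algebra of a finite group\<close>

definition add_subgroup :: "'g::group_add set \<Rightarrow> bool" where
  "add_subgroup T \<longleftrightarrow> 0 \<in> T \<and> (\<forall>a\<in>T. \<forall>b\<in>T. a + b \<in> T) \<and> (\<forall>a\<in>T. - a \<in> T)"

lemma add_subgroupD:
  assumes "add_subgroup T"
  shows "0 \<in> T" "a \<in> T \<Longrightarrow> b \<in> T \<Longrightarrow> a + b \<in> T" "a \<in> T \<Longrightarrow> - a \<in> T"
    "a \<in> T \<Longrightarrow> b \<in> T \<Longrightarrow> a - b \<in> T"
  using assms unfolding add_subgroup_def by (simp_all) (metis diff_conv_add_uminus)

lemma bij_betw_add_left: "add_subgroup T \<Longrightarrow> a \<in> T \<Longrightarrow> bij_betw ((+) a) T T"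
  by (rule bij_betwI[of _ _ _ "(+) (- a)"]) (auto simp: add_subgroupD add.assoc[symmetric])
lemma bij_betw_add_right: "add_subgroup T \<Longrightarrow> a \<in> T \<Longrightarrow> bij_betw (\<lambda>x. x + a) T T"
  by (rule bij_betwI[of _ _ _ "\<lambda>x. x - a"]) (auto simp: add_subgroupD)
lemma bij_betw_minus: "add_subgroup T \<Longrightarrow> bij_betw uminus T T"
  by (rule bij_betwI[of _ _ _ uminus]) (auto simp: add_subgroupD)

section \<open>Polynomials evaluated in the group algebra\<close>

definition peval :: "'g::group_add galg \<Rightarrow> complex poly \<Rightarrow> 'g galg" where
  "peval z p = fold_coeffs (\<lambda>a y. scal a + z * y) p 0"

lemma peval_0 [simp]: "peval z 0 = 0" by (simp add: peval_def)
lemma peval_pCons [simp]: "peval z (pCons a p) = scal a + z * peval z p"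
  by (cases "p = 0 \<and> a = 0") (auto simp: peval_def)
lemma peval_add: "peval z (p + q) = peval z p + peval z q"
  by (induction p q rule: poly_induct2) (auto simp: scal_add ring_distribs)
lemma peval_smult: "peval z (Polynomial.smult c p) = scal c * peval z p"
  by (induction p) (auto simp: ring_distribs scal_left_commute[of z])
lemma peval_monom: "peval z (Polynomial.monom c n) = scal c * z ^ n"
  by (induction n) (auto simp: Polynomial.monom_0 Polynomial.monom_Suc scal_left_commute[of z])
lemma peval_sum: "peval z (\<Sum>i\<in>I. f i) = (\<Sum>i\<in>I. peval z (f i))"
  by (induction I rule: infinite_finite_induct) (auto simp: peval_add)
lemma peval_linear_factor: "peval z ([:- c, 1:] * p) = (z - scal c) * peval z p"
proof -
  have "[:- c, 1:] * p = pCons 0 p + Polynomial.smult (- c) p" by simp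
  then show ?thesis by (simp only: peval_add peval_smult peval_pCons) (simp add: scal_minus ring_distribs)
qed
lemma peval_eigenvector: "z * v = scal c * v \<Longrightarrow> peval z p * v = scal (poly p c) * v"
proof (induction p)
  case (pCons a p)
  have "peval z (pCons a p) * v = scal a * v + z * (scal (poly p c) * v)"
    using pCons by (simp add: ring_distribs mult.assoc)
  also have "z * (scal (poly p c) * v) = scal (poly p c * c) * v"
    using pCons.prems by (simp add: scal_left_commute[of z])
  finally show ?case by (simp add: scal_add ring_distribs mult.commute)
qed simp

lemma hermitian_decomposition:
  fixes z :: "'g::group_add galg"
  defines "x \<equiv> scal (1/2) * (z + star z)" and "y \<equiv> scal (- \<i>/2) * (z - star z)"
  shows "z = x + scal \<i> * y" "star x = x" "star y = y"
proof -
  have "x + scal \<i> * y = scal (1/2) * (z + star z) + scal (1/2) * (z - star z)"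
    by (simp add: x_def y_def)
  also have "\<dots> = (scal (1/2) + scal (1/2)) * z" by (simp add: algebra_simps)
  also have "\<dots> = z" unfolding scal_add[symmetric] by simp
  finally show "z = x + scal \<i> * y" by simp
  show "star x = x" by (simp add: x_def star_scal_mult star_add add.commute)
  show "star y = y" by (simp add: y_def star_scal_mult star_diff scal_minus algebra_simps)
qed

text \<open>The product of \<open>poly_mapping\<close> comes from the type \<open>'g\<close>, which
  may be infinite. Finiteness is carried by the subset \<open>S\<close>, and \<open>alg\<close>
  below is the group algebra of \<open>S\<close>.\<close>

locale finite_add_subgroup =
  fixes S :: "'g::group_add set"
  assumes finite_S: "finite S" and subgroup_S: "add_subgroup S"
begin

lemmas S_closed [simp] = add_subgroupD[OF subgroup_S]

definition alg :: "'g galg set" where "alg = {x. Poly_Mapping.keys x \<subseteq> S}"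

lemma alg_iff: "x \<in> alg \<longleftrightarrow> (\<forall>g. g \<notin> S \<longrightarrow> coef x g = 0)"
  by (auto simp: alg_def in_keys_iff)

lemma alg_expand: "x \<in> alg \<Longrightarrow> x = (\<Sum>g\<in>S. scal (coef x g) * elt g)"
  by (intro poly_mapping_eqI, subst single_conv[symmetric])
    (auto simp: lookup_sum lookup_single when_def alg_iff finite_S)

lemma alg_closed [simp]:
  "0 \<in> alg" "1 \<in> alg" "scal c \<in> alg" "g \<in> S \<Longrightarrow> elt g \<in> alg"
  "x \<in> alg \<Longrightarrow> y \<in> alg \<Longrightarrow> x + y \<in> alg" "x \<in> alg \<Longrightarrow> y \<in> alg \<Longrightarrow> x - y \<in> alg"
  "x \<in> alg \<Longrightarrow> - x \<in> alg" "x \<in> alg \<Longrightarrow> star x \<in> alg"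
proof -
  show "x \<in> alg \<Longrightarrow> star x \<in> alg"
    unfolding alg_iff lookup_star by (metis S_closed(3) complex_cnj_zero minus_minus)
qed (auto simp: alg_iff lookup_add lookup_minus lookup_elt lookup_one scal_def lookup_single when_def)

lemma alg_sum: "(\<And>i. i \<in> I \<Longrightarrow> f i \<in> alg) \<Longrightarrow> (\<Sum>i\<in>I. f i) \<in> alg"
  by (induction I rule: infinite_finite_induct) auto

lemma alg_scal [simp]: "x \<in> alg \<Longrightarrow> scal c * x \<in> alg"
  by (auto simp: alg_iff)

lemma alg_induct [consumes 1, case_names zero add basis]:
  assumes "x \<in> alg" "P 0" "\<And>x y. P x \<Longrightarrow> P y \<Longrightarrow> P (x + y)" "\<And>g c. g \<in> S \<Longrightarrow> P (scal c * elt g)"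
  shows "P x"
proof -
  have "P (\<Sum>g\<in>T. scal (coef x g) * elt g)" if "T \<subseteq> S" for T
    using finite_subset[OF that finite_S] that by (induction T) (auto intro: assms)
  then show ?thesis by (metis alg_expand[OF assms(1)] order_refl)
qed

lemma alg_mult [simp]: assumes "x \<in> alg" "y \<in> alg" shows "x * y \<in> alg"
  using assms(1)
proof (induction x rule: alg_induct)
  case (basis g c)
  have "elt g * y \<in> alg"
    using basis assms(2) unfolding alg_iff
    by (metis S_closed(2) add.assoc add.left_neutral add.right_inverse lookup_elt_mult)
  then show ?case by (simp add: mult.assoc)
qed (simp_all add: ring_distribs)

lemma alg_power [simp]: "x \<in> alg \<Longrightarrow> x ^ n \<in> alg"
  by (induction n) auto

definition center :: "'g galg set" where
  "center = {z \<in> alg. \<forall>g\<in>S. elt g * z = z * elt g}"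

lemma center_alg [simp]: "z \<in> center \<Longrightarrow> z \<in> alg" by (simp add: center_def)

lemma center_commute: assumes "z \<in> center" "x \<in> alg" shows "x * z = z * x"
  using assms(2)
proof (induction x rule: alg_induct)
  case (basis g c)
  have "elt g * z = z * elt g" using assms(1) basis unfolding center_def by blast
  then show ?case by (simp only: mult.assoc scal_left_commute[of z])
qed (simp_all only: ring_distribs mult_zero_left mult_zero_right)

lemma centerI: "z \<in> alg \<Longrightarrow> (\<And>g. g \<in> S \<Longrightarrow> elt g * z = z * elt g) \<Longrightarrow> z \<in> center"
  unfolding center_def by blast
lemma centerD: "z \<in> center \<Longrightarrow> g \<in> S \<Longrightarrow> elt g * z = z * elt g"
  unfolding center_def by blast

lemma center_closed [simp]:
  "0 \<in> center" "1 \<in> center" "scal c \<in> center"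
  "x \<in> center \<Longrightarrow> y \<in> center \<Longrightarrow> x + y \<in> center" "x \<in> center \<Longrightarrow> y \<in> center \<Longrightarrow> x - y \<in> center"
  "x \<in> center \<Longrightarrow> y \<in> center \<Longrightarrow> x * y \<in> center"
  "x \<in> center \<Longrightarrow> star x \<in> center"
proof -
  show "x \<in> center \<Longrightarrow> y \<in> center \<Longrightarrow> x * y \<in> center"
  proof (rule centerI)
    fix g assume "x \<in> center" "y \<in> center" "g \<in> S"
    then show "elt g * (x * y) = x * y * elt g"
      by (simp only: centerD mult.assoc flip: mult.assoc[of "elt g"])
  qed simp
  assume x: "x \<in> center"
  show "star x \<in> center"
  proof (rule centerI)
    fix g assume "g \<in> S"
    then have "star (elt (- g) * x) = star (x * elt (- g))" using x by (simp add: centerD)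
    then show "elt g * star x = star x * elt g" by (simp add: star_mult)
  qed (use x in simp)
qed (auto intro!: centerI simp: centerD ring_distribs scal_commute[of "elt _"])

lemma center_peval: "z \<in> center \<Longrightarrow> peval z p \<in> center"
  by (induction p) auto

text \<open>Multiplication by such an \<open>e\<close> is the orthogonal projection to the two-sided
  ideal \<open>e * alg\<close>, called the ideal of \<open>e\<close> below.\<close>

definition central_proj :: "'g galg \<Rightarrow> bool" where
  "central_proj e \<longleftrightarrow> e \<in> center \<and> e * e = e \<and> star e = e"

lemma central_projI: "e \<in> center \<Longrightarrow> e * e = e \<Longrightarrow> star e = e \<Longrightarrow> central_proj e"
  unfolding central_proj_def by blast
lemma central_projD [simp]:
  assumes "central_proj e" shows "e \<in> center" "e * e = e" "star e = e"
  using assms by (auto simp: central_proj_def)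

lemma central_proj_absorb [simp]: "central_proj e \<Longrightarrow> e * (e * x) = e * x"
  by (metis central_projD(2) mult.assoc)

lemma tr_central_proj: "central_proj e \<Longrightarrow> tr e = of_real (nrm e)"
  using tr_mult_star_self[of e] by simp

text \<open>The ideal of \<open>e\<close> is then a minimal two-sided ideal, a full matrix algebra.
  The matrix structure is replaced by Schur's lemma below.\<close>

definition primitive :: "'g galg \<Rightarrow> bool" where
  "primitive e \<longleftrightarrow> central_proj e \<and> e \<noteq> 0 \<and>
     (\<forall>f. central_proj f \<longrightarrow> f * e = f \<longrightarrow> f = 0 \<or> f = e)"

text \<open>The \<open>card S + 1\<close> powers of \<open>z\<close> up to exponent
  \<open>card S\<close> lie in a space spanned by \<open>card S\<close> elements.\<close>

lemma annihilating_poly: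
  assumes z: "z \<in> alg" shows "\<exists>p. p \<noteq> 0 \<and> peval z p = 0"
proof -
  interpret vs: vector_space "\<lambda>c (x :: 'g galg). scal c * x"
    by standard (auto simp: ring_distribs scal_add mult.commute)
  define B where "B = (\<lambda>i. z ^ i) ` {..card S}"
  show ?thesis
  proof (cases "inj_on (\<lambda>i. z ^ i) {..card S}")
    \<comment> \<open>With repeated powers the set \<open>B\<close> is too small for the dimension
      count, but a difference of two monomials already annihilates \<open>z\<close>.\<close>
    case False
    then obtain i j where ij: "i \<noteq> j" "z ^ i = z ^ j" by (auto simp: inj_on_def)
    let ?p = "Polynomial.monom (1::complex) i + Polynomial.monom (-1) j"
    have "Polynomial.coeff ?p i \<noteq> 0" using ij by simp
    then have "?p \<noteq> 0" by (metis Polynomial.coeff_0)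
    moreover have "peval z ?p = 0" using ij by (simp add: peval_add peval_monom scal_minus)
    ultimately show ?thesis by blast
  next
    case True
    then have card: "card B = Suc (card S)" by (simp add: B_def card_image)
    have "x \<in> vs.span (elt ` S)" if "x \<in> alg" for x
      by (subst alg_expand[OF that]) (intro vs.span_sum vs.span_scale vs.span_base imageI)
    then have "B \<subseteq> vs.span (elt ` S)" using z by (auto simp: B_def)
    moreover have "card (elt ` S) \<le> card S" using finite_S by (rule card_image_le)
    ultimately have "vs.dependent B"
      using vs.independent_span_bound[of "elt ` S" B] finite_S card by (auto simp del: z)
    moreover have "finite B" by (simp add: B_def)
    ultimately obtain u v where uv: "v \<in> B" "u v \<noteq> 0" "(\<Sum>v\<in>B. scal (u v) * v) = 0"
      by (auto simp: vs.dependent_finite)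
    let ?p = "\<Sum>i\<le>card S. Polynomial.monom (u (z ^ i)) i"
    obtain k where k: "k \<le> card S" "v = z ^ k" using uv by (auto simp: B_def)
    have "Polynomial.coeff ?p k = u (z ^ k)" using k by (simp add: Polynomial.coeff_sum)
    then have "?p \<noteq> 0" using k uv by (metis Polynomial.coeff_0)
    moreover have "peval z ?p = (\<Sum>v\<in>B. scal (u v) * v)"
      by (simp add: peval_sum peval_monom B_def sum.reindex[OF True])
    ultimately show ?thesis using uv by metis
  qed
qed

text \<open>A root \<open>c\<close> of the minimal polynomial of \<open>z\<close> on the ideal of
  \<open>e\<close> yields a nonzero central eigenvector. Suitably normalised it becomes a nonzero
  central projection below \<open>e\<close>, which is \<open>e\<close> itself by primitivity, so
  \<open>z\<close> acts on the whole ideal as \<open>c\<close>.\<close>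

lemma primitive_scalar_hermitian:
  assumes e: "primitive e" and z: "z \<in> center" "star z = z"
  shows "\<exists>c. z * e = scal c * e"
proof -
  have e': "central_proj e" "e \<noteq> 0" using e by (auto simp: primitive_def)
  let ?P = "\<lambda>p. p \<noteq> 0 \<and> peval z p * e = 0"
  have "\<exists>p. ?P p" using annihilating_poly[of z] z by auto
  \<comment> \<open>Least degree makes \<open>p\<close> the minimal polynomial of \<open>z\<close>
    on the ideal of \<open>e\<close>; a proper factor of it does not kill \<open>e\<close>.\<close>
  then obtain p where p: "?P p" and min: "\<And>q. ?P q \<Longrightarrow> Polynomial.degree p \<le> Polynomial.degree q"
    using ex_has_least_nat[of ?P _ Polynomial.degree] by blast
  have "\<not> (\<exists>a l. a \<noteq> 0 \<and> l = 0 \<and> p = pCons a l)"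
  proof
    assume "\<exists>a l. a \<noteq> 0 \<and> l = 0 \<and> p = pCons a l"
    then obtain a where a: "a \<noteq> 0" "p = [:a:]" by auto
    then have "scal (inverse a) * (scal a * e) = 0" using p by simp
    then show False using a e' by simp
  qed
  then obtain c where "poly p c = 0" using fundamental_theorem_of_algebra_alt by blast
  then obtain q where q: "p = [:- c, 1:] * q" by (metis poly_eq_0_iff_dvd dvdE)
  with p have q0: "q \<noteq> 0" by auto
  have "Polynomial.degree p = Suc (Polynomial.degree q)"
    unfolding q using q0 by (subst Polynomial.degree_mult_eq) auto
  with min[of q] q0 have w0: "peval z q * e \<noteq> 0" by auto
  define w where "w = peval z q * e"
  have w: "w \<in> center" "w * e = w" using e' z by (auto simp: w_def center_peval mult.assoc)
  have zw: "z * w = scal c * w"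
    using p unfolding q peval_linear_factor w_def by (simp add: algebra_simps mult.assoc)
  \<comment> \<open>\<open>w\<close> need not be self-adjoint. \<open>w * star w\<close> is, and it
    is still a nonzero eigenvector, since \<open>x * star x = 0\<close> forces
    \<open>x = 0\<close>.\<close>
  define v where "v = w * star w"
  have v: "v \<in> center" "star v = v" "v \<noteq> 0" "v * v \<noteq> 0" "e * v = v" "z * v = scal c * v"
  proof -
    show "v \<in> center" "star v = v" using w by (auto simp: v_def star_mult)
    show "v \<noteq> 0" using mult_star_self_eq_0[of w] w0 by (auto simp: v_def w_def)
    with mult_star_self_eq_0[of v] \<open>star v = v\<close> show "v * v \<noteq> 0" by auto
    have "e * w = w" using w e' by (metis center_alg center_commute central_projD(1))
    then show "e * v = v" by (simp add: v_def flip: mult.assoc)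
    show "z * v = scal c * v" using zw by (simp add: v_def flip: mult.assoc)
  qed
  \<comment> \<open>On the eigenvector \<open>v\<close> the element \<open>w\<close> acts as
    \<open>poly q c\<close>. So \<open>v * v\<close> is \<open>cnj k * k\<close> times
    \<open>v\<close>, and as it is nonzero, \<open>v\<close> can be rescaled to an
    idempotent.\<close>
  define k where "k = poly q c"
  have wv: "w * v = scal k * v"
    using peval_eigenvector[OF v(6), of q] v by (simp add: w_def k_def mult.assoc)
  have "star w * v = star (v * w)" using v by (simp add: star_mult)
  also have "v * w = w * v" using v w by (intro center_commute) auto
  finally have "star w * v = scal (cnj k) * v" using v by (simp add: wv star_scal_mult)
  then have "v * v = w * (scal (cnj k) * v)" by (metis mult.assoc v_def)
  then have vv: "v * v = scal (cnj k * k) * v" by (simp add: scal_left_commute[of w] wv)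
  with v have k: "k \<noteq> 0" by auto
  define f where "f = scal (1 / (cnj k * k)) * v"
  have "f * f = scal (1 / (cnj k * k)) * (scal (1 / (cnj k * k)) * (v * v))"
    unfolding f_def by (simp only: mult.assoc scal_left_commute[of v])
  also have "\<dots> = f" using k by (simp add: vv f_def)
  finally have "f * f = f" .
  moreover have "star f = f" using v by (simp add: f_def star_scal_mult mult.commute)
  moreover have "f \<in> center" using v(1) by (simp add: f_def)
  ultimately have f: "central_proj f" by (intro central_projI)
  have "f \<noteq> 0"
  proof
    assume "f = 0"
    then have "scal (cnj k * k) * f = 0" by simp
    then show False using k v by (simp add: f_def)
  qed
  moreover have "v * e = v" using center_commute[of v e] v e' by simp
  then have "f * e = f" by (simp add: f_def mult.assoc)
  ultimately have "f = e" using e f by (auto simp: primitive_def)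
  moreover have "z * f = scal c * f"
    using v(6) by (simp add: f_def scal_left_commute[of z] mult.commute)
  ultimately show ?thesis by auto
qed

lemma primitive_scalar:
  assumes e: "primitive e" and z: "z \<in> center"
  shows "\<exists>c. z * e = scal c * e"
proof -
  define x where "x = scal (1/2) * (z + star z)"
  define y where "y = scal (- \<i>/2) * (z - star z)"
  have xy: "z = x + scal \<i> * y" "star x = x" "star y = y"
    unfolding x_def y_def by (rule hermitian_decomposition)+
  have "x \<in> center" "y \<in> center" using z by (simp_all add: x_def y_def)
  with xy obtain c d where "x * e = scal c * e" "y * e = scal d * e"
    using primitive_scalar_hermitian[OF e] by metis
  then have "z * e = scal (c + \<i> * d) * e" by (subst xy(1)) (simp add: ring_distribs mult.assoc scal_add)
  then show ?thesis ..
qed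

end

context finite_add_subgroup
begin

definition corner_herm :: "'g galg \<Rightarrow> 'g galg set" where
  "corner_herm e = {x \<in> alg. star x = x \<and> e * x = x}"

lemma tr_mult_hermitian: "star x = x \<Longrightarrow> star y = y \<Longrightarrow> cnj (tr (x * y)) = tr (x * y)"
  by (metis star_mult tr_commute tr_star)

text \<open>If the hermitian elements of the ideal of \<open>e\<close> commuted, so would their
  complex combinations, and these are the whole ideal.\<close>

lemma noncommuting_hermitian:
  assumes e: "central_proj e" and u: "u \<in> alg" "v \<in> alg" and nc: "e * u * v \<noteq> e * v * u"
  obtains x y where "x \<in> corner_herm e" "y \<in> corner_herm e" "x * y \<noteq> y * x"
proof (rule ccontr)
  assume "\<not> thesis"
  with that have comm: "x * y = y * x" if "x \<in> corner_herm e" "y \<in> corner_herm e" for x y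
    using that by blast
  have ec: "z * e = e * z" if "z \<in> alg" for z using that e by (intro center_commute) auto
  define re where "re z = scal (1/2) * (z + star z)" for z :: "'g galg"
  define im where "im z = scal (- \<i>/2) * (z - star z)" for z :: "'g galg"
  have dec: "z = re z + scal \<i> * im z" "star (re z) = re z" "star (im z) = im z" for z
    unfolding re_def im_def by (rule hermitian_decomposition)+
  have corner: "re (e * z) \<in> corner_herm e" "im (e * z) \<in> corner_herm e" if "z \<in> alg" for z
  proof -
    have "star (e * z) = e * star z" using that e ec[of "star z"] by (simp add: star_mult)
    then have "e * re (e * z) = re (e * z)" "e * im (e * z) = im (e * z)"
      using e by (simp_all add: re_def im_def ring_distribs scal_left_commute[of e])
    moreover have "re (e * z) \<in> alg" "im (e * z) \<in> alg"
      using that e by (simp_all add: re_def im_def)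
    ultimately show "re (e * z) \<in> corner_herm e" "im (e * z) \<in> corner_herm e"
      using dec by (simp_all add: corner_herm_def)
  qed
  have "(e * u) * (e * v) = (e * v) * (e * u)"
  proof -
    note c = comm[OF corner(1)[OF u(1)] corner(1)[OF u(2)]] comm[OF corner(1)[OF u(1)] corner(2)[OF u(2)]]
      comm[OF corner(2)[OF u(1)] corner(1)[OF u(2)]] comm[OF corner(2)[OF u(1)] corner(2)[OF u(2)]]
    have sc: "(a + scal \<i> * b) * (c + scal \<i> * d) =
        a * c + scal \<i> * (a * d) + scal \<i> * (b * c) + scal (\<i> * \<i>) * (b * d)" for a b c d :: "'g galg"
      by (simp add: ring_distribs mult.assoc scal_left_commute[of a] scal_left_commute[of b])
    show ?thesis
      by (subst (1 2) dec(1)[of "e * u"], subst (1 2) dec(1)[of "e * v"])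
        (simp only: sc c add_ac)
  qed
  moreover have "(e * a) * (e * b) = e * a * b" if "a \<in> alg" for a b
    using that e ec[of a] by (metis central_projD(2) mult.assoc)
  ultimately show False using nc u by simp
qed

lemma corner_hermD: assumes "x \<in> corner_herm e" shows "x \<in> alg" "star x = x" "e * x = x"
  using assms by (auto simp: corner_herm_def)

lemma corner_herm_diff:
  assumes "x \<in> corner_herm e" "y \<in> corner_herm e" "cnj c = c"
  shows "x - scal c * y \<in> corner_herm e"
  using assms by (auto simp: corner_herm_def star_diff star_scal_mult right_diff_distrib scal_left_commute[of e])

text \<open>The ideal contains four nonzero orthogonal elements: \<open>e\<close>, two hermitian
  elements of trace 0, and their commutator, which is orthogonal to the other three because the
  trace is cyclic. Bessel's inequality for the vectors \<open>e * elt g\<close>, summed over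
  \<open>g\<close>, counts these elements against the dimension
  \<open>card S * nrm e\<close>.\<close>

lemma noncommutative_dimension:
  assumes e: "central_proj e" and u: "u \<in> alg" "v \<in> alg" and nc: "e * u * v \<noteq> e * v * u"
  shows "real (card S) * nrm e \<ge> 4"
proof -
  obtain x y where xy: "x \<in> corner_herm e" "y \<in> corner_herm e" "x * y \<noteq> y * x"
    using noncommuting_hermitian[OF assms] .
  have e0: "e \<noteq> 0" using nc by auto
  have eH: "e \<in> corner_herm e" using e by (simp add: corner_herm_def)
  have ec: "z * e = z" if "z \<in> corner_herm e" for z
    using that e center_commute[of e z] by (simp add: corner_herm_def)
  have real1: "cnj (tr z) = tr z" if "z \<in> corner_herm e" for z
    using tr_star[of z] unfolding corner_hermD(2)[OF that] by (rule sym)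
  define ce where "ce z = tr z / tr e" for z :: "'g galg"
  have ce_real: "cnj (ce z) = ce z" if "z \<in> corner_herm e" for z
    using real1[OF that] real1[OF eH] by (simp add: ce_def)
  have tre: "tr e \<noteq> 0" using e0 e by (simp add: tr_central_proj)
  \<comment> \<open>Gram-Schmidt. Subtracting multiples of \<open>e\<close> and of \<open>x1\<close>
    leaves the commutator of the two elements unchanged, hence nonzero; the coefficients are real,
    so the results stay hermitian.\<close>
  define x1 where "x1 = x - scal (ce x) * e"
  define y1 where "y1 = y - scal (ce y) * e"
  define d where "d = tr (y1 * x1) / tr (x1 * x1)"
  define y2 where "y2 = y1 - scal d * x1"
  define w where "w = x1 * y2 - y2 * x1"
  have H1: "x1 \<in> corner_herm e" "y1 \<in> corner_herm e"
    unfolding x1_def y1_def using xy eH by (auto intro!: corner_herm_diff ce_real)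
  have "cnj d = d" unfolding d_def complex_cnj_divide
    by (simp only: tr_mult_hermitian[OF corner_hermD(2)[OF H1(2)] corner_hermD(2)[OF H1(1)]]
        tr_mult_hermitian[OF corner_hermD(2)[OF H1(1)] corner_hermD(2)[OF H1(1)]])
  then have H2: "y2 \<in> corner_herm e" unfolding y2_def using H1 by (intro corner_herm_diff)
  have "w = x1 * y1 - y1 * x1"
    unfolding w_def y2_def by (simp add: left_diff_distrib right_diff_distrib scal_left_commute[of x1] mult.assoc)
  also have "\<dots> = x * y - y * x"
  proof -
    have gen: "(p - scal a * e) * (q - scal b * e) = p * q - scal b * p - scal a * q + scal (a * b) * e"
      if "p \<in> corner_herm e" "q \<in> corner_herm e" for p q a b
      using ec[OF that(1)] corner_hermD(3)[OF that(2)] e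
      by (simp add: left_diff_distrib right_diff_distrib mult.assoc scal_left_commute[of p] scal_left_commute[of e])
    show ?thesis unfolding x1_def y1_def gen[OF xy(1,2)] gen[OF xy(2,1)]
      by (simp add: mult.commute[of "ce x" "ce y"])
  qed
  finally have w0: "w \<noteq> 0" using xy by simp
  then have x0: "x1 \<noteq> 0" and y0: "y2 \<noteq> 0" by (auto simp: w_def)
  have tx: "tr x1 = 0" and ty1: "tr y1 = 0" using tre by (simp_all add: x1_def y1_def ce_def)
  then have ty: "tr y2 = 0" by (simp add: y2_def)
  have "tr (x1 * x1) \<noteq> 0" using tr_mult_star_self[of x1] x0 corner_hermD(2)[OF H1(1)] by simp
  then have tyx: "tr (y2 * x1) = 0"
    by (simp add: y2_def d_def left_diff_distrib mult.assoc)
  have tw: "tr w = 0" by (simp add: w_def tr_commute[of x1])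
  have twx: "tr (w * x1) = 0"
    using tr_commute[of "x1 * y2" x1] tr_commute[of y2 "x1 * x1"] by (simp add: w_def left_diff_distrib mult.assoc)
  have twy: "tr (w * y2) = 0"
    using tr_commute[of y2 "x1 * y2"] by (simp add: w_def left_diff_distrib mult.assoc)
  have ew: "e * w = w" "w \<in> alg"
    using corner_hermD[OF H1(1)] corner_hermD[OF H2] by (simp_all add: w_def right_diff_distrib flip: mult.assoc)
  have st: "star e = e" "star x1 = x1" "star y2 = y2"
    using corner_hermD(2)[OF eH] corner_hermD(2)[OF H1(1)] corner_hermD(2)[OF H2] by auto
  have orth: "tr (x1 * star e) = 0" "tr (y2 * star e) = 0" "tr (y2 * star x1) = 0"
    "tr (w * star e) = 0" "tr (w * star x1) = 0" "tr (w * star y2) = 0"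
    using tx ty tyx tw twx twy ec[OF H1(1)] ec[OF H2] ew
    by (simp_all add: st tr_commute[of w e])
  have sym: "tr (p * star q) = 0" if "tr (q * star p) = 0" for p q :: "'g galg"
    using that by (metis complex_cnj_zero star_mult star_star tr_star)
  have neq: "p \<noteq> q" if "tr (p * star q) = 0" "p \<noteq> 0" for p q :: "'g galg"
    using that by (auto simp: tr_mult_star_self)
  define vs where "vs = [e, x1, y2, w]"
  have vs: "pairwise (\<lambda>v w. tr (v * star w) = 0) (set vs)" "distinct vs" "0 \<notin> set vs"
    using orth orth[THEN sym] e0 x0 y0 w0 orth[THEN neq]
    unfolding vs_def by (auto simp: pairwise_insert)
  have vsD: "v \<in> alg" "e * v = v" "nrm v > 0" if "v \<in> set vs" for v
    using that vs(3) H1 H2 eH ew unfolding vs_def nrm_pos_iff by (auto dest: corner_hermD)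
  \<comment> \<open>The inner product of \<open>e * elt g\<close> with an element of the ideal is
    the conjugate of its coefficient at \<open>g\<close>. Summed over \<open>g\<close>, each of the
    four terms becomes 1.\<close>
  have "(\<Sum>v\<leftarrow>vs. (cmod (coef v g))\<^sup>2 / nrm v) \<le> nrm e" for g
  proof -
    have "tr (e * elt g * star v) = cnj (coef v g)" if "v \<in> set vs" for v
    proof -
      have "tr (e * elt g * star v) = tr (elt g * star (e * v))"
        using e tr_commute[of e "elt g * star v"] by (simp add: star_mult mult.assoc)
      also have "\<dots> = cnj (coef v g)" using vsD(2)[OF that]
        by (simp add: tr_def lookup_star)
      finally show ?thesis .
    qed
    then have "(\<Sum>v\<leftarrow>vs. (cmod (coef v g))\<^sup>2 / nrm v) =
        (\<Sum>v\<leftarrow>vs. (cmod (tr (e * elt g * star v)))\<^sup>2 / nrm v)"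
      by (simp cong: map_cong)
    also have "\<dots> \<le> nrm (e * elt g)" by (rule bessel[OF vs])
    finally show ?thesis by simp
  qed
  then have "(\<Sum>g\<in>S. \<Sum>v\<leftarrow>vs. (cmod (coef v g))\<^sup>2 / nrm v) \<le> (\<Sum>g\<in>S. nrm e)"
    by (intro sum_mono)
  moreover have "(\<Sum>g\<in>S. \<Sum>v\<leftarrow>vs. (cmod (coef v g))\<^sup>2 / nrm v) =
      (\<Sum>v\<leftarrow>vs. (\<Sum>g\<in>S. (cmod (coef v g))\<^sup>2) / nrm v)"
    by (simp add: vs_def sum.distrib sum_divide_distrib)
  also have "\<dots> = (\<Sum>v\<leftarrow>vs. 1)"
  proof (intro arg_cong[of _ _ sum_list] map_cong refl)
    fix v assume "v \<in> set vs"
    then show "(\<Sum>g\<in>S. (cmod (coef v g))\<^sup>2) / nrm v = 1"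
      using vsD[of v] nrm_eq_sum[OF finite_S, of v] by (simp add: alg_def)
  qed
  finally show ?thesis by (simp add: vs_def)
qed

section \<open>Averages over subgroups and the commutative part of the algebra\<close>

definition avg :: "'g set \<Rightarrow> 'g galg" where
  "avg T = scal (1 / of_nat (card T)) * (\<Sum>t\<in>T. elt t)"

lemma finite_subset_S: "T \<subseteq> S \<Longrightarrow> finite T" using finite_S by (rule rev_finite_subset)

lemma avg_absorb_right:
  assumes "add_subgroup T" "t \<in> T" shows "avg T * elt t = avg T"
proof -
  have "(\<Sum>s\<in>T. elt s) * elt t = (\<Sum>s\<in>T. elt (s + t))"
    by (simp add: sum_distrib_right elt_add)
  also have "\<dots> = (\<Sum>s\<in>T. elt s)"
    by (rule sum.reindex_bij_betw[OF bij_betw_add_right[OF assms]])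
  finally show ?thesis by (simp add: avg_def mult.assoc)
qed

lemma avg_alg [simp]: "T \<subseteq> S \<Longrightarrow> avg T \<in> alg"
  unfolding avg_def by (intro alg_scal alg_sum alg_closed) auto

lemma star_avg [simp]: assumes "add_subgroup T" shows "star (avg T) = avg T"
proof -
  have "(\<Sum>t\<in>T. elt (- t)) = (\<Sum>t\<in>T. elt t)"
    by (rule sum.reindex_bij_betw[OF bij_betw_minus[OF assms]])
  then show ?thesis by (simp add: avg_def star_scal_mult star_sum)
qed

lemma mult_avg:
  assumes "T \<subseteq> S" "add_subgroup T" "\<And>t. t \<in> T \<Longrightarrow> x * elt t = x"
  shows "x * avg T = x"
proof -
  have "card T \<noteq> 0" using finite_subset_S[OF assms(1)] add_subgroupD(1)[OF assms(2)] by auto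
  moreover have "x * avg T = scal (1 / of_nat (card T)) * (\<Sum>t\<in>T. x * elt t)"
    by (simp add: avg_def scal_left_commute[of x] sum_distrib_left)
  moreover have "(\<Sum>t\<in>T. x * elt t) = scal (of_nat (card T)) * x"
    using assms(3) by (simp add: scal_of_nat)
  ultimately show ?thesis by simp
qed

lemma avg_idem [simp]: "T \<subseteq> S \<Longrightarrow> add_subgroup T \<Longrightarrow> avg T * avg T = avg T"
  by (intro mult_avg avg_absorb_right)

lemma lookup_avg:
  assumes "T \<subseteq> S"
  shows "coef (avg T) g = (if g \<in> T then 1 / of_nat (card T) else 0)"
  using finite_subset_S[OF assms] by (simp add: avg_def lookup_sum lookup_elt)

definition derived :: "'g set" where
  "derived = \<Inter> {T. add_subgroup T \<and> T \<subseteq> S \<and> (\<forall>a\<in>S. \<forall>b\<in>S. a + b - a - b \<in> T)}"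

lemma derived_least:
  "add_subgroup T \<Longrightarrow> T \<subseteq> S \<Longrightarrow> (\<And>a b. a \<in> S \<Longrightarrow> b \<in> S \<Longrightarrow> a + b - a - b \<in> T) \<Longrightarrow> derived \<subseteq> T"
  unfolding derived_def by blast

lemma commutator_in_derived: "a \<in> S \<Longrightarrow> b \<in> S \<Longrightarrow> a + b - a - b \<in> derived"
  unfolding derived_def by blast

lemma derived_subgroup: "add_subgroup derived" "derived \<subseteq> S"
proof -
  show "derived \<subseteq> S" using subgroup_S by (intro derived_least) auto
  show "add_subgroup derived" unfolding derived_def add_subgroup_def by blast
qed

lemma avg_derived_center: "avg derived \<in> center"
proof (rule centerI)
  fix g assume g: "g \<in> S"
  \<comment> \<open>\<open>a + d - a\<close> is the commutator of \<open>a\<close> and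
    \<open>d\<close> followed by \<open>d\<close>, which gives normality of \<open>derived\<close>
    directly.\<close>
  have conj: "a + d - a \<in> derived" if "a \<in> S" "d \<in> derived" for a d
  proof -
    have "(a + d - a - d) + d \<in> derived"
      using that derived_subgroup commutator_in_derived[of a d] by (intro add_subgroupD(2)) auto
    then show ?thesis by simp
  qed
  have bij: "bij_betw (\<lambda>d. g + d - g) derived derived"
  proof (rule bij_betwI[of _ _ _ "\<lambda>d. - g + d + g"])
    show "(\<lambda>d. - g + d + g) \<in> derived \<rightarrow> derived" using conj[of "- g"] g by simp
  qed (use conj g in \<open>auto simp: add.assoc[symmetric]\<close>, simp add: diff_conv_add_uminus add.assoc del: add_uminus_conv_diff)
  have "elt g * (\<Sum>d\<in>derived. elt d) = (\<Sum>d\<in>derived. elt (g + d - g)) * elt g"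
    unfolding sum_distrib_left sum_distrib_right by (simp flip: elt_add)
  also have "(\<Sum>d\<in>derived. elt (g + d - g)) = (\<Sum>d\<in>derived. elt d)"
    by (rule sum.reindex_bij_betw[OF bij])
  finally show "elt g * avg derived = avg derived * elt g"
    by (simp add: avg_def scal_left_commute[of "elt g"] mult.assoc)
qed (simp add: derived_subgroup)

lemma central_proj_avg_derived: "central_proj (avg derived)"
  using derived_subgroup by (intro central_projI avg_derived_center) auto

text \<open>The \<open>t\<close> with \<open>e * elt t = e\<close> form a subgroup. If the ideal of
  \<open>e\<close> is commutative, this subgroup contains all commutators.\<close>

lemma central_proj_commutative:
  assumes "\<And>a b. a \<in> S \<Longrightarrow> b \<in> S \<Longrightarrow> e * elt a * elt b = e * elt b * elt a"
  shows "e * avg derived = e"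
proof (rule mult_avg)
  define T where "T = {t \<in> S. e * elt t = e}"
  have "add_subgroup T" unfolding add_subgroup_def
  proof (intro conjI ballI)
    fix a assume "a \<in> T"
    then have "a \<in> S" "e * elt a * elt (- a) = e * elt (- a)" by (auto simp: T_def)
    then show "- a \<in> T" by (simp add: T_def mult.assoc)
  next
    fix a b assume "a \<in> T" "b \<in> T"
    then have "e * elt a * elt b = e" "a \<in> S" "b \<in> S" by (auto simp: T_def)
    then show "a + b \<in> T" by (simp add: T_def elt_add mult.assoc)
  qed (simp add: T_def elt_0)
  moreover have "a + b - a - b \<in> T" if ab: "a \<in> S" "b \<in> S" for a b
  proof -
    have "e * elt (a + b - a - b) = e * elt a * elt b * (elt (- a) * elt (- b))"
      by (simp add: diff_conv_add_uminus elt_add mult.assoc del: add_uminus_conv_diff)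
    also have "\<dots> = e" by (simp add: assms[OF ab]) (simp add: mult.assoc)
    finally show ?thesis using ab by (simp add: T_def)
  qed
  ultimately have "derived \<subseteq> T" by (intro derived_least) (auto simp: T_def)
  then show "e * elt t = e" if "t \<in> derived" for t using that by (auto simp: T_def)
qed (rule derived_subgroup)+

lemma noncommutative_primitive_dimension:
  assumes "central_proj e" "e \<noteq> 0" "e * avg derived = 0"
  shows "real (card S) * nrm e \<ge> 4"
proof -
  have "e * avg derived \<noteq> e" using assms by auto
  then obtain a b where "a \<in> S" "b \<in> S" "e * elt a * elt b \<noteq> e * elt b * elt a"
    using central_proj_commutative[of e] by blast
  with assms show ?thesis by (intro noncommutative_dimension[of e "elt a" "elt b"]) auto
qed

end

section \<open>Twisted commutator averages\<close>

lemma nrm_mult_projection_le: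
  assumes "Q * Q = Q" "star Q = Q" shows "nrm (y * Q) \<le> nrm y"
proof -
  have "(y * Q) * star (y - y * Q) = y * (Q - Q * Q) * star y"
    using assms(2) by (simp add: star_diff star_mult algebra_simps)
  then have "tr ((y * Q) * star (y - y * Q)) = 0" using assms(1) by simp
  from nrm_pythagoras[OF this] show ?thesis by simp
qed

text \<open>The squared norm of \<open>x * u\<close> involves \<open>u\<close> only through
  \<open>u * star u\<close>.\<close>

lemma nrm_mult_partial_isometry:
  assumes "u * star u = p" "p * p = p" "star p = p" shows "nrm (x * u) = nrm (x * p)"
proof -
  have "(x * u) * star (x * u) = x * (u * star u) * star x" by (simp add: star_mult mult.assoc)
  also have "\<dots> = x * (p * p) * star x" using assms by simp
  also have "\<dots> = (x * p) * star (x * p)" using assms(3) by (simp add: star_mult mult.assoc)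
  finally show ?thesis by (simp add: nrm_def)
qed

section \<open>Intertwiners and Schur's lemma\<close>

context finite_add_subgroup
begin

definition endo :: "('g \<Rightarrow> 'g) \<Rightarrow> bool" where
  "endo f \<longleftrightarrow> (\<forall>a\<in>S. f a \<in> S) \<and> (\<forall>a\<in>S. \<forall>b\<in>S. f (a + b) = f a + f b)"

lemma endoD:
  assumes "endo f"
  shows "a \<in> S \<Longrightarrow> f a \<in> S" "a \<in> S \<Longrightarrow> b \<in> S \<Longrightarrow> f (a + b) = f a + f b"
    "f 0 = 0" "a \<in> S \<Longrightarrow> f (- a) = - f a"
proof -
  show add: "f (a + b) = f a + f b" if "a \<in> S" "b \<in> S" for a b
    using assms that unfolding endo_def by blast
  show "a \<in> S \<Longrightarrow> f a \<in> S" using assms unfolding endo_def by blast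
  show z: "f 0 = 0" using add[of 0 0] by simp (metis add.right_neutral add_left_cancel)
  assume a: "a \<in> S"
  then have "f a + f (- a) = 0" using add[of a "- a"] z by simp
  then show "f (- a) = - f a" by (simp add: minus_unique)
qed

definition linext :: "('g \<Rightarrow> 'g) \<Rightarrow> 'g galg \<Rightarrow> 'g galg" where
  "linext f x = (\<Sum>g\<in>S. scal (coef x g) * elt (f g))"

lemma linext_add: "linext f (x + y) = linext f x + linext f y"
  by (simp add: linext_def lookup_add scal_add ring_distribs sum.distrib)
lemma linext_0 [simp]: "linext f 0 = 0" by (simp add: linext_def)
lemma linext_basis: "g \<in> S \<Longrightarrow> linext f (scal c * elt g) = scal c * elt (f g)"
proof -
  assume g: "g \<in> S"
  have "linext f (scal c * elt g) = (\<Sum>h\<in>S. if h = g then scal c * elt (f h) else 0)"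
    unfolding linext_def single_conv[symmetric] by (intro sum.cong) (auto simp: lookup_single when_def)
  then show ?thesis using g finite_S by simp
qed

lemma linext_mult:
  assumes f: "endo f" and xy: "x \<in> alg" "y \<in> alg"
  shows "linext f (x * y) = linext f x * linext f y"
  using xy(1)
proof (induction x rule: alg_induct)
  case (basis g c)
  show ?case using xy(2)
  proof (induction y rule: alg_induct)
    case (basis h d)
    have "scal c * elt g * (scal d * elt h) = scal (c * d) * elt (g + h)"
      by (simp add: elt_add mult.assoc scal_left_commute[of "elt g"])
    moreover have "scal c * elt (f g) * (scal d * elt (f h)) = scal (c * d) * elt (f g + f h)"
      by (simp add: elt_add mult.assoc scal_left_commute[of "elt (f g)"])
    moreover have "f (g + h) = f g + f h" using endoD[OF f] basis \<open>g \<in> S\<close> by simp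
    ultimately show ?case using basis \<open>g \<in> S\<close> by (simp only: linext_basis S_closed)
  qed (simp_all add: ring_distribs linext_add)
qed (simp_all add: ring_distribs linext_add)

lemma linext_star:
  assumes f: "endo f" and x: "x \<in> alg"
  shows "linext f (star x) = star (linext f x)"
  using x
proof (induction x rule: alg_induct)
  case (basis g c)
  then show ?case by (simp add: star_scal_mult linext_basis endoD[OF f])
qed (simp_all add: star_add linext_add)

text \<open>For the identity in place of \<theta> these are the central elements.\<close>

definition intertwiner :: "('g \<Rightarrow> 'g) \<Rightarrow> 'g galg \<Rightarrow> bool" where
  "intertwiner \<theta> w \<longleftrightarrow> w \<in> alg \<and> (\<forall>a\<in>S. elt a * w = w * elt (\<theta> a))"

lemma intertwinerD:
  assumes "intertwiner \<theta> w" shows "w \<in> alg" "a \<in> S \<Longrightarrow> elt a * w = w * elt (\<theta> a)"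
  using assms unfolding intertwiner_def by blast+

lemma intertwiner_mult_star:
  assumes \<theta>: "endo \<theta>" and u: "intertwiner \<theta> u" and v: "intertwiner \<theta> v"
  shows "u * star v \<in> center"
proof (rule centerI)
  fix a assume a: "a \<in> S"
  have "elt a * (u * star v) = u * (elt (\<theta> a) * star v)"
    using intertwinerD(2)[OF u a] by (simp flip: mult.assoc)
  also have "elt (\<theta> a) * star v = star (v * elt (\<theta> (- a)))"
    using a endoD(4)[OF \<theta> a] by (simp add: star_mult)
  also have "v * elt (\<theta> (- a)) = elt (- a) * v"
    using intertwinerD(2)[OF v, of "- a"] a by simp
  finally show "elt a * (u * star v) = u * star v * elt a" by (simp add: star_mult mult.assoc)
qed (simp add: intertwinerD(1)[OF u] intertwinerD(1)[OF v])

text \<open>The intertwining relation controls translation by the elements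
  \<open>\<theta> a\<close>; surjectivity of \<theta> makes these all of \<open>S\<close>.\<close>

lemma intertwiner_star_mult:
  assumes \<theta>: "endo \<theta>" "\<theta> ` S = S" and u: "intertwiner \<theta> u"
  shows "star u * u \<in> center"
proof (rule centerI)
  fix b assume "b \<in> S"
  then obtain a where a: "a \<in> S" "b = \<theta> a" using \<theta> by blast
  have "elt b * star u = star (u * elt (\<theta> (- a)))"
    using a endoD(4)[OF \<theta>(1) a(1)] by (simp add: star_mult)
  also have "u * elt (\<theta> (- a)) = elt (- a) * u" using intertwinerD(2)[OF u, of "- a"] a by simp
  finally have "elt b * star u = star u * elt a" by (simp add: star_mult)
  then have "elt b * (star u * u) = star u * (elt a * u)" by (simp flip: mult.assoc)
  also have "elt a * u = u * elt b" using intertwinerD(2)[OF u a(1)] a by simp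
  finally show "elt b * (star u * u) = star u * u * elt b" by (simp add: mult.assoc)
qed (simp add: intertwinerD(1)[OF u])

text \<open>Schur's lemma for the twisted action. Subtracting from \<open>v\<close> a multiple of
  \<open>u\<close> leaves \<open>v0\<close> with \<open>v0 * star u = 0\<close>. If
  \<open>v0\<close> were nonzero, \<open>v0 * star v0\<close> would be a nonzero multiple of
  \<open>e\<close>, while the central element \<open>star v0 * v0\<close> annihilates
  \<open>u\<close>; together these force \<open>u = 0\<close>.\<close>

lemma intertwiner_unique:
  assumes \<theta>: "endo \<theta>" "\<theta> ` S = S" and e: "primitive e"
    and u: "intertwiner \<theta> u" "e * u = u" "u * star u = e"
    and v: "intertwiner \<theta> v" "e * v = v"
  shows "v = scal (tr (v * star u) / tr e) * u"
proof -
  have e': "central_proj e" "e \<noteq> 0" using e by (auto simp: primitive_def)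
  then have tre: "tr e \<noteq> 0" by (simp add: tr_central_proj)
  have scalar: "\<exists>c. x * star y = scal c * e"
    if "intertwiner \<theta> x" "intertwiner \<theta> y" "e * x = x" for x y
  proof -
    have z: "x * star y \<in> center" using \<theta>(1) that by (intro intertwiner_mult_star)
    have "x * star y * e = e * (x * star y)" using z e' by (intro center_commute) auto
    also have "\<dots> = x * star y" using that by (simp flip: mult.assoc)
    finally show ?thesis using primitive_scalar[OF e z] by simp
  qed
  define m where "m = tr (v * star u) / tr e"
  have vu: "v * star u = scal m * e"
  proof -
    obtain c where c: "v * star u = scal c * e" using scalar[OF v(1) u(1) v(2)] by blast
    then show ?thesis using tre by (simp add: m_def)
  qed
  define v0 where "v0 = v - scal m * u"
  have v0: "intertwiner \<theta> v0" "e * v0 = v0" "v0 * star u = 0"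
  proof -
    show "intertwiner \<theta> v0" using intertwinerD[OF u(1)] intertwinerD[OF v(1)] unfolding intertwiner_def v0_def
      by (auto simp: left_diff_distrib right_diff_distrib mult.assoc scal_left_commute[of "elt _"])
    show "e * v0 = v0" using u v by (simp add: v0_def right_diff_distrib scal_left_commute[of e])
    show "v0 * star u = 0" using u vu by (simp add: v0_def left_diff_distrib mult.assoc)
  qed
  have "v0 = 0"
  proof (rule ccontr)
    assume nz: "v0 \<noteq> 0"
    obtain k where k: "v0 * star v0 = scal k * e" using scalar[OF v0(1) v0(1) v0(2)] by blast
    then have k0: "k \<noteq> 0" using nz mult_star_self_eq_0[of v0] by auto
    define z where "z = star v0 * v0"
    have zc: "z \<in> center" unfolding z_def by (rule intertwiner_star_mult[OF \<theta> v0(1)])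
    have "u * star v0 = star (v0 * star u)" by (simp add: star_mult)
    then have uz: "u * z = 0" using v0 by (simp add: z_def flip: mult.assoc)
    have "star v0 * e = star (e * v0)" using e' by (simp add: star_mult)
    then have "z * star v0 = scal k * star v0"
      using v0 by (simp add: z_def mult.assoc k scal_left_commute[of "star v0"])
    then have "scal k * (star v0 * u) = z * (star v0 * u)" by (simp flip: mult.assoc)
    \<comment> \<open>Centrality carries \<open>z\<close> to the other side, where it meets
      \<open>u\<close> and \<open>u * z = 0\<close> applies.\<close>
    also have "\<dots> = star v0 * u * z"
      using zc intertwinerD(1)[OF u(1)] intertwinerD(1)[OF v0(1)] by (intro center_commute[symmetric]) auto
    also have "\<dots> = 0" using uz by (simp add: mult.assoc)
    finally have "scal (1 / k) * (scal k * (star v0 * u)) = 0" by simp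
    then have "star v0 * u = 0" using k0 by simp
    then have "scal k * e * u = 0" by (simp add: mult.assoc flip: k)
    then have "scal (1 / k) * (scal k * u) = 0" using u by (simp add: mult.assoc)
    then have "u = 0" using k0 by simp
    then show False using u e' by simp
  qed
  then show ?thesis by (simp add: v0_def m_def)
qed

text \<open>The orthogonal projection of \<open>alg\<close> onto the intertwiners of
  \<theta>.\<close>

definition twavg :: "('g \<Rightarrow> 'g) \<Rightarrow> 'g galg \<Rightarrow> 'g galg" where
  "twavg \<theta> x = scal (1 / of_nat (card S)) * (\<Sum>a\<in>S. elt a * x * elt (- \<theta> a))"

text \<open>The average of the elements \<open>a + c - \<theta> a - \<phi> c\<close> over all
  \<open>a\<close>, \<open>c\<close> in \<open>S\<close>, arranged so that the inner average over
  \<open>a\<close> is an intertwiner.\<close>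

definition twcomm :: "('g \<Rightarrow> 'g) \<Rightarrow> ('g \<Rightarrow> 'g) \<Rightarrow> 'g galg" where
  "twcomm \<theta> \<phi> = scal (1 / of_nat (card S)) * (\<Sum>c\<in>S. twavg \<theta> (elt c) * elt (- \<phi> c))"

lemma twavg_alg [simp]: "endo \<theta> \<Longrightarrow> x \<in> alg \<Longrightarrow> twavg \<theta> x \<in> alg"
  unfolding twavg_def by (intro alg_scal alg_sum alg_mult alg_closed) (simp_all add: endoD)

lemma twcomm_alg [simp]: "endo \<theta> \<Longrightarrow> endo \<phi> \<Longrightarrow> twcomm \<theta> \<phi> \<in> alg"
  unfolding twcomm_def by (intro alg_scal alg_sum alg_mult twavg_alg alg_closed) (simp_all add: endoD)

lemma twavg_intertwiner:
  assumes \<theta>: "endo \<theta>" and x: "x \<in> alg" shows "intertwiner \<theta> (twavg \<theta> x)"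
  unfolding intertwiner_def
proof (intro conjI ballI)
  fix b assume b: "b \<in> S"
  let ?f = "\<lambda>a. elt a * x * elt (- \<theta> a)"
  have "elt b * ?f a = ?f (b + a) * elt (\<theta> b)" if "a \<in> S" for a
  proof -
    have "elt (- \<theta> (b + a)) * elt (\<theta> b) = elt (- \<theta> a)"
      unfolding elt_add[symmetric] endoD(2)[OF \<theta> b that] minus_add by (simp add: add.assoc)
    then show ?thesis by (simp add: elt_add[of b] mult.assoc)
  qed
  then have "elt b * (\<Sum>a\<in>S. ?f a) = (\<Sum>a\<in>S. ?f (b + a)) * elt (\<theta> b)"
    by (simp add: sum_distrib_left sum_distrib_right)
  also have "(\<Sum>a\<in>S. ?f (b + a)) = (\<Sum>a\<in>S. ?f a)"
    by (rule sum.reindex_bij_betw[OF bij_betw_add_left[OF subgroup_S b]])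
  finally show "elt b * twavg \<theta> x = twavg \<theta> x * elt (\<theta> b)"
    by (simp add: twavg_def scal_left_commute[of "elt b"] mult.assoc)
qed (use assms in simp)

lemma tr_twavg:
  assumes \<theta>: "endo \<theta>" and w: "intertwiner \<theta> w"
  shows "tr (twavg \<theta> x * star w) = tr (x * star w)"
proof -
  have "tr (elt a * x * elt (- \<theta> a) * star w) = tr (x * star w)" if a: "a \<in> S" for a
  proof -
    have "elt (- \<theta> a) * star w * elt a = star (elt (- a) * w * elt (\<theta> a))"
      by (simp add: star_mult mult.assoc)
    also have "elt (- a) * w = w * elt (- \<theta> a)"
      using intertwinerD(2)[OF w, of "- a"] a endoD(4)[OF \<theta> a] by simp
    finally have "elt (- \<theta> a) * star w * elt a = star w" by (simp add: mult.assoc)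
    moreover have "tr (elt a * x * elt (- \<theta> a) * star w) = tr (x * (elt (- \<theta> a) * star w * elt a))"
      using tr_commute[of "elt a" "x * elt (- \<theta> a) * star w"] by (simp add: mult.assoc)
    ultimately show ?thesis by simp
  qed
  moreover have "card S \<noteq> 0" using finite_S S_closed(1) by (metis card_0_eq empty_iff)
  ultimately show ?thesis
    by (simp add: twavg_def mult.assoc sum_distrib_right tr_sum)
qed

lemma twavg_center:
  assumes "z \<in> center" shows "z * twavg \<theta> x = twavg \<theta> (z * x)"
proof -
  have "z * (elt a * x * elt (- \<theta> a)) = elt a * (z * x) * elt (- \<theta> a)" if "a \<in> S" for a
    using centerD[OF assms that] by (simp flip: mult.assoc)
  then show ?thesis by (simp add: twavg_def scal_left_commute[of z] sum_distrib_left)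
qed

text \<open>For every \<open>c\<close> the element \<open>e * twavg \<theta> (elt c)\<close> is an
  intertwiner, hence a multiple of a single \<open>u\<close> with \<open>u * star u = e\<close>, and
  the multiple is the conjugate of the coefficient of \<open>u\<close> at \<open>c\<close>, divided
  by \<open>tr e\<close>. The sum over \<open>c\<close> collapses to \<open>u * U\<close> up to the
  factor \<open>1 / (card S * tr e)\<close>, with \<open>U\<close> the adjoint of the image of
  \<open>u\<close> under \<phi>. Neither \<open>u\<close> nor \<open>U\<close> increases the
  norm.\<close>

lemma nrm_mult_twcomm_primitive:
  assumes \<theta>: "endo \<theta>" "\<theta> ` S = S" and \<phi>: "endo \<phi>" and e: "primitive e"
  shows "nrm (x * (e * twcomm \<theta> \<phi>)) \<le> nrm (x * e) / (real (card S) * nrm e)\<^sup>2"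
proof -
  have e': "central_proj e" "e \<noteq> 0" using e by (auto simp: primitive_def)
  define w where "w c = e * twavg \<theta> (elt c)" for c
  have w_eq: "w c = twavg \<theta> (e * elt c)" for c
    unfolding w_def by (rule twavg_center[OF central_projD(1)[OF e'(1)]])
  have w: "intertwiner \<theta> (w c)" "e * w c = w c" if "c \<in> S" for c
  proof -
    show "intertwiner \<theta> (w c)" unfolding w_eq using e' that by (intro twavg_intertwiner \<theta>(1)) simp
    show "e * w c = w c" using e' by (simp add: w_def)
  qed
  have et: "e * twcomm \<theta> \<phi> = scal (1 / of_nat (card S)) * (\<Sum>c\<in>S. w c * elt (- \<phi> c))"
    by (simp add: twcomm_def scal_left_commute[of e] sum_distrib_left w_def mult.assoc)
  show ?thesis
  proof (cases "\<forall>c\<in>S. w c = 0")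
    \<comment> \<open>This happens, for instance, when \<theta> carries the ideal of
      \<open>e\<close> to a different one.\<close>
    case True
    then show ?thesis by (simp add: et)
  next
    case False
    then obtain c0 where c0: "c0 \<in> S" "w c0 \<noteq> 0" by blast
    have ne: "nrm e > 0" using e' by (simp add: nrm_pos_iff)
    have z: "w c0 * star (w c0) \<in> center" by (rule intertwiner_mult_star[OF \<theta>(1) w(1) w(1)]) (use c0 in auto)
    have "w c0 * star (w c0) * e = e * (w c0 * star (w c0))" using z e' by (intro center_commute) auto
    also have "\<dots> = w c0 * star (w c0)" using w(2)[OF c0(1)] by (simp flip: mult.assoc)
    finally obtain k where k: "w c0 * star (w c0) = scal k * e" using primitive_scalar[OF e z] by metis
    have "tr (w c0 * star (w c0)) = k * of_real (nrm e)" using e' by (simp add: k tr_central_proj)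
    then have kr: "k = of_real (nrm (w c0) / nrm e)" using ne e'(2) by (simp add: tr_mult_star_self field_simps)
    define r where "r = nrm (w c0) / nrm e"
    have r: "r > 0" using ne c0 by (simp add: r_def nrm_pos_iff)
    \<comment> \<open>\<open>w c0 * star (w c0)\<close> is \<open>r\<close> times \<open>e\<close>,
      so dividing by the square root of \<open>r\<close> gives
      \<open>u * star u = e\<close>.\<close>
    define u where "u = scal (of_real (1 / sqrt r)) * w c0"
    have u: "intertwiner \<theta> u" "e * u = u" "u * star u = e"
    proof -
      show "intertwiner \<theta> u" using intertwinerD[OF w(1)[OF c0(1)]] unfolding intertwiner_def u_def
        by (auto simp: scal_left_commute[of "elt _"] mult.assoc)
      show "e * u = u" using w(2)[OF c0(1)] by (simp add: u_def scal_left_commute[of e])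
      define s where "s = 1 / sqrt r"
      have "u * star u = scal (of_real s) * (scal (of_real s) * (w c0 * star (w c0)))"
        unfolding u_def s_def[symmetric] star_scal_mult
        by (simp only: complex_cnj_complex_of_real mult.assoc scal_left_commute[of "w c0"])
      also have "\<dots> = scal (of_real (s * s * r)) * e"
        unfolding k kr r_def[symmetric] by (simp add: mult.assoc)
      also have "s * s * r = 1" using r by (simp add: s_def field_simps)
      finally show "u * star u = e" by simp
    qed
    note ualg = intertwinerD(1)[OF u(1)]
    have wc: "w c = scal (cnj (coef u c) / tr e) * u" if c: "c \<in> S" for c
    proof -
      have "tr (w c * star u) = tr (e * elt c * star u)" unfolding w_eq by (rule tr_twavg[OF \<theta>(1) u(1)])
      also have "\<dots> = tr (elt c * star (e * u))"
        using e' tr_commute[of e "elt c * star u"] by (simp add: star_mult mult.assoc)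
      also have "\<dots> = cnj (coef u c)" by (simp add: u tr_def lookup_star)
      finally show ?thesis using intertwiner_unique[OF \<theta> e u w[OF c]] by simp
    qed
    define U where "U = star (linext \<phi> u)"
    have U: "U = (\<Sum>c\<in>S. scal (cnj (coef u c)) * elt (- \<phi> c))"
      by (simp add: U_def linext_def star_sum star_scal_mult)
    have "(\<Sum>c\<in>S. w c * elt (- \<phi> c)) = (\<Sum>c\<in>S. scal (1 / tr e) * (u * (scal (cnj (coef u c)) * elt (- \<phi> c))))"
      by (intro sum.cong) (simp_all add: wc mult.assoc scal_left_commute[of u])
    then have etu: "e * twcomm \<theta> \<phi> = scal (1 / (of_nat (card S) * tr e)) * (u * U)"
      by (simp add: et U flip: sum_distrib_left)
    \<comment> \<open>The linear extension of \<phi> respects products and adjoints, so it sends the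
      projection \<open>star u * u\<close> to a projection, and that is
      \<open>U * star U\<close>.\<close>
    define q where "q = star u * u"
    have q: "q * q = q" "star q = q" "q \<in> alg"
    proof -
      have "q * q = star u * (u * star u) * u" by (simp add: q_def mult.assoc)
      also have "\<dots> = star u * (e * u)" unfolding u(3) by (simp add: mult.assoc)
      finally show "q * q = q" by (simp add: u q_def)
    qed (simp_all add: q_def star_mult ualg)
    have Q: "U * star U = linext \<phi> q"
      using ualg by (simp add: U_def q_def linext_mult[OF \<phi>] linext_star[OF \<phi>])
    have "nrm (y * U) \<le> nrm y" for y
    proof -
      have QQ: "linext \<phi> q * linext \<phi> q = linext \<phi> q" using q by (simp flip: linext_mult[OF \<phi>])
      have Qs: "star (linext \<phi> q) = linext \<phi> q" using q by (simp flip: linext_star[OF \<phi>])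
      show ?thesis using nrm_mult_partial_isometry[OF Q QQ Qs, of y] nrm_mult_projection_le[OF QQ Qs, of y] by simp
    qed
    then have "nrm (x * (u * U)) \<le> nrm (x * u)" by (simp flip: mult.assoc)
    also have "\<dots> = nrm (x * e)" using e' by (intro nrm_mult_partial_isometry u) auto
    finally have "nrm (x * (u * U)) \<le> nrm (x * e)" .
    moreover have "nrm (x * (e * twcomm \<theta> \<phi>)) = nrm (x * (u * U)) / (real (card S) * nrm e)\<^sup>2"
      using ne e' unfolding etu scal_left_commute[of x] nrm_scal
      by (simp add: tr_central_proj norm_divide norm_mult power_divide)
    ultimately show ?thesis by (simp add: divide_right_mono)
  qed
qed

text \<open>A nonzero ideal has dimension at least 1. The coefficients of \<open>f\<close> are inner
  products of \<open>f\<close> with its translates, so by Cauchy-Schwarz each has modulus at most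
  \<open>nrm f\<close>; summing their squares bounds \<open>nrm f\<close> by \<open>card S\<close>
  times its square.\<close>

lemma nrm_central_proj_ge:
  assumes "central_proj f" "f \<noteq> 0" shows "real (card S) * nrm f \<ge> 1"
proof -
  have pos: "nrm f > 0" using assms by (simp add: nrm_pos_iff)
  have "(cmod (coef f g))\<^sup>2 \<le> nrm f * nrm f" for g
  proof -
    have "tr (f * star (f * elt g)) = tr (f * (f * elt (- g)))"
      using assms(1) tr_commute[of "f * elt (- g)" f] by (simp add: star_mult mult.assoc)
    also have "\<dots> = coef f g" using assms(1) by (simp add: lookup_conv_tr)
    finally show ?thesis using cauchy_schwarz[of f "f * elt g"] by simp
  qed
  then have "(\<Sum>g\<in>S. (cmod (coef f g))\<^sup>2) \<le> real (card S) * (nrm f * nrm f)"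
    by (intro sum_bounded_above)
  moreover have "nrm f = (\<Sum>g\<in>S. (cmod (coef f g))\<^sup>2)"
    using center_alg[OF central_projD(1)[OF assms(1)]] unfolding alg_def by (intro nrm_eq_sum finite_S) auto
  ultimately have "nrm f * 1 \<le> nrm f * (real (card S) * nrm f)" by (simp add: algebra_simps)
  then show ?thesis using pos by simp
qed

text \<open>A projection that is not primitive splits into two orthogonal ones, whose squared norms
  add. The induction is over an integer bound for the dimension \<open>card S * nrm e\<close>, which
  drops because each of the two parts has dimension at least 1.\<close>

lemma nrm_mult_twcomm:
  assumes \<theta>: "endo \<theta>" "\<theta> ` S = S" and \<phi>: "endo \<phi>"
    and e: "central_proj e" "e * avg derived = 0"
  shows "nrm (x * (e * twcomm \<theta> \<phi>)) \<le> nrm (x * e) / 16"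
proof -
  have "nrm (x * (e * twcomm \<theta> \<phi>)) \<le> nrm (x * e) / 16"
    if "real (card S) * nrm e < real n" "central_proj e" "e * avg derived = 0" for n e x
    using that
  proof (induction n arbitrary: e x)
    case 0
    moreover have "0 \<le> real (card S) * nrm e" by simp
    ultimately show ?case by linarith
  next
    case (Suc n)
    note e = Suc.prems(2,3)
    consider "e = 0" | "primitive e" "e \<noteq> 0"
      | f where "central_proj f" "f * e = f" "f \<noteq> 0" "f \<noteq> e" "e \<noteq> 0"
      using e unfolding primitive_def by blast
    then show ?case
    proof cases
      case 2
      have "4 \<le> real (card S) * nrm e" using e 2 by (intro noncommutative_primitive_dimension)
      \<comment> \<open>The dimension enters squared because \<open>nrm\<close> is a squared norm;
        this is the origin of 16.\<close>
      then have "4\<^sup>2 \<le> (real (card S) * nrm e)\<^sup>2" by (intro power_mono) auto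
      then have "nrm (x * e) / (real (card S) * nrm e)\<^sup>2 \<le> nrm (x * e) / 16"
        by (intro frac_le) auto
      then show ?thesis by (rule order_trans[OF nrm_mult_twcomm_primitive[OF \<theta> \<phi> 2(1)]])
    next
      case (3 f)
      define g where "g = e - f"
      have ef: "e * f = f" using 3 e center_commute[of f e] by simp
      have fg: "f * g = 0" using 3 by (simp add: g_def right_diff_distrib)
      have g: "central_proj g"
        using 3 e ef by (intro central_projI) (auto simp: g_def left_diff_distrib right_diff_distrib star_diff)
      have ge: "g * e = g" using 3 e by (simp add: g_def left_diff_distrib)
      have gd: "g * avg derived = 0" and fd: "f * avg derived = 0"
        using e ge 3(2) by (metis mult.assoc mult_zero_right)+
      have esum: "e = f + g" by (simp add: g_def)
      have ntr: "nrm e = nrm f + nrm g"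
      proof -
        have "tr e = tr f + tr g" by (simp add: esum)
        then have "of_real (nrm e) = (of_real (nrm f + nrm g) :: complex)" using e 3 g by (simp add: tr_central_proj)
        then show ?thesis unfolding of_real_eq_iff .
      qed
      have "real (card S) * nrm f \<ge> 1" using 3 by (intro nrm_central_proj_ge)
      moreover have "real (card S) * nrm g \<ge> 1" using g 3 by (intro nrm_central_proj_ge) (auto simp: g_def)
      ultimately have "real (card S) * nrm f < real n" "real (card S) * nrm g < real n"
        using Suc.prems(1) unfolding ntr by (simp_all add: ring_distribs)
      then have IH: "nrm (x * (f * twcomm \<theta> \<phi>)) \<le> nrm (x * f) / 16"
          "nrm (x * (g * twcomm \<theta> \<phi>)) \<le> nrm (x * g) / 16"
        using Suc.IH 3(1) g fd gd by blast+
      have orth: "tr (x * (f * y) * star (x * (g * y))) = 0" if y: "y \<in> alg" for y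
      proof -
        have "f * y = y * f" "g * y = y * g"
          using y 3(1) g center_commute[of f y] center_commute[of g y] by simp_all
        then have "x * (f * y) * star (x * (g * y)) = x * y * (f * g) * star y * star x"
          using g by (simp add: star_mult mult.assoc)
        then show ?thesis using fg by simp
      qed
      have "nrm (x * (e * y)) = nrm (x * (f * y)) + nrm (x * (g * y))" if "y \<in> alg" for y
        unfolding esum using nrm_pythagoras[OF orth[OF that]] by (simp add: ring_distribs)
      from this[of "twcomm \<theta> \<phi>"] this[of 1] IH \<theta> \<phi> show ?thesis by simp
    qed simp
  qed
  moreover obtain n where "real (card S) * nrm e < real n" using reals_Archimedean2 by blast
  ultimately show ?thesis using e by blast
qed

end

text \<open>Lists keep the order of the factors, which do not commute in the group algebra.\<close>

lemma prod_list_sum_distrib: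
  fixes f :: "nat \<Rightarrow> 'a \<Rightarrow> 'r::semiring_1"
  assumes "finite A"
  shows "prod_list (map (\<lambda>k. \<Sum>s\<in>A. f k s) [0..<h]) =
    (\<Sum>t\<in>PiE {..<h} (\<lambda>_. A). prod_list (map (\<lambda>k. f k (t k)) [0..<h]))"
proof (induction h)
  case (Suc h)
  let ?g = "\<lambda>t. prod_list (map (\<lambda>k. f k (t k)) [0..<h])"
  have "(\<Sum>t\<in>PiE {..<Suc h} (\<lambda>_. A). prod_list (map (\<lambda>k. f k (t k)) [0..<Suc h])) =
      (\<Sum>(s, t)\<in>A \<times> PiE {..<h} (\<lambda>_. A). ?g (t(h := s)) * f h s)"
    unfolding lessThan_Suc PiE_insert_eq
    using inj_combinator[of h "{..<h}" "\<lambda>_. A"] by (subst sum.reindex) (auto simp: case_prod_unfold)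
  also have "\<dots> = (\<Sum>s\<in>A. \<Sum>t\<in>PiE {..<h} (\<lambda>_. A). ?g t * f h s)"
  proof (subst sum.cartesian_product[symmetric], intro sum.cong refl)
    fix s t
    have "map (\<lambda>k. f k ((t(h := s)) k)) [0..<h] = map (\<lambda>k. f k (t k)) [0..<h]"
      by (intro map_cong) auto
    then show "?g (t(h := s)) * f h s = ?g t * f h s" by (simp only:)
  qed
  also have "\<dots> = (\<Sum>t\<in>PiE {..<h} (\<lambda>_. A). ?g t) * (\<Sum>s\<in>A. f h s)"
    by (simp add: sum_distrib_left sum_distrib_right)
  finally show ?case using Suc by simp
qed simp

lemma prod_list_elt: "prod_list (map (\<lambda>k. elt (f k)) l) = elt (sum_list (map f l))"
  by (induction l) (auto simp: elt_add elt_0)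

lemma prod_list_scal: "prod_list (map (\<lambda>k. scal c * f k) l) = scal (c ^ length l) * prod_list (map f l)"
proof (induction l)
  case (Cons k l)
  have "f k * (scal (c ^ length l) * prod_list (map f l)) = scal (c ^ length l) * (f k * prod_list (map f l))"
    by (rule scal_left_commute)
  then show ?case using Cons by (simp add: mult.assoc)
qed simp

section \<open>Twisted commutators modulo the derived subgroup\<close>

context finite_add_subgroup
begin

lemma avg_mult:
  assumes "T \<subseteq> S" "add_subgroup T" "\<And>t. t \<in> T \<Longrightarrow> elt t * x = x"
  shows "avg T * x = x"
proof -
  have "star x * avg T = star x"
  proof (rule mult_avg[OF assms(1,2)])
    fix t assume "t \<in> T"
    then have "elt (- t) * x = x" using assms by (simp add: add_subgroupD)
    then show "star x * elt t = star x" by (metis minus_minus star_elt star_mult)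
  qed
  then show ?thesis using star_avg[OF assms(2)] by (metis star_mult star_star)
qed

lemma avg_absorb_left: "add_subgroup T \<Longrightarrow> t \<in> T \<Longrightarrow> elt t * avg T = avg T"
  using avg_absorb_right[of T "- t"] by (metis add_subgroupD(3) minus_minus star_avg star_elt star_mult)

text \<open>\<open>g + h\<close> is a commutator followed by \<open>h + g\<close>, and
  \<open>avg derived\<close> absorbs the commutator.\<close>

lemma avg_derived_commute:
  assumes "x \<in> alg" "y \<in> alg" shows "avg derived * (x * y) = avg derived * (y * x)"
  using assms(1)
proof (induction x rule: alg_induct)
  case (basis g c)
  show ?case using assms(2)
  proof (induction y rule: alg_induct)
    case (basis h d)
    have "avg derived * elt ((g + h - g - h) + (h + g)) = avg derived * elt (h + g)"
      using commutator_in_derived[OF \<open>g \<in> S\<close> \<open>h \<in> S\<close>] derived_subgroup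
      unfolding elt_add[of "g + h - g - h"] by (simp add: avg_absorb_right flip: mult.assoc)
    moreover have "(g + h - g - h) + (h + g) = g + h"
      by (simp add: add.assoc[symmetric])
    ultimately have *: "avg derived * (elt g * elt h) = avg derived * (elt h * elt g)"
      by (simp add: elt_add)
    show ?case
      by (simp add: mult.assoc scal_left_commute[of "elt _"] scal_left_commute[of "avg derived"] * mult.commute[of c])
  qed (simp_all add: ring_distribs)
qed (simp_all add: ring_distribs)

lemma avg_derived_commute':
  assumes "p \<in> alg" "x \<in> alg" "y \<in> alg"
  shows "avg derived * (p * (x * y)) = avg derived * (p * (y * x))"
proof -
  have "avg derived * p = p * avg derived"
    using center_commute[OF avg_derived_center assms(1)] by simp
  then have "avg derived * (p * z) = p * (avg derived * z)" for z by (simp flip: mult.assoc)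
  then show ?thesis by (simp only: avg_derived_commute[OF assms(2,3)])
qed

definition coavg :: "('g \<Rightarrow> 'g) \<Rightarrow> 'g galg" where
  "coavg f = scal (1 / of_nat (card S)) * (\<Sum>a\<in>S. elt (a - f a))"

lemma coavg_alg: "endo f \<Longrightarrow> coavg f \<in> alg"
  unfolding coavg_def by (intro alg_scal alg_sum alg_closed) (simp add: endoD)

text \<open>Modulo \<open>derived\<close> the map \<open>a \<mapsto> a - f a\<close> is a
  homomorphism, and the average over it absorbs each element of its image.\<close>

lemma coavg_absorb:
  assumes f: "endo f" and b: "b \<in> S"
  shows "avg derived * (coavg f * elt (b - f b)) = avg derived * coavg f"
proof -
  have "avg derived * (elt (a - f a) * elt (b - f b)) = avg derived * elt ((a + b) - f (a + b))"
    if a: "a \<in> S" for a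
  proof -
    have "elt (a - f a) * elt (b - f b) = elt a * (elt (- f a) * (elt b * elt (- f b)))"
      by (simp add: elt_add mult.assoc flip: add_uminus_conv_diff)
    then have "avg derived * (elt (a - f a) * elt (b - f b)) = avg derived * (elt a * ((elt b * elt (- f b)) * elt (- f a)))"
      using avg_derived_commute'[of "elt a" "elt (- f a)" "elt b * elt (- f b)"] endoD(1)[OF f] a b by simp
    also have "(elt a * ((elt b * elt (- f b)) * elt (- f a))) = elt (a + b + - (f a + f b))"
      by (simp only: elt_add minus_add mult.assoc)
    finally show ?thesis using endoD(2)[OF f a b] by (simp only: add_uminus_conv_diff)
  qed
  then have "avg derived * ((\<Sum>a\<in>S. elt (a - f a)) * elt (b - f b)) = avg derived * (\<Sum>a\<in>S. elt ((a + b) - f (a + b)))"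
    by (simp add: sum_distrib_left sum_distrib_right)
  also have "(\<Sum>a\<in>S. elt ((a + b) - f (a + b))) = (\<Sum>a\<in>S. elt (a - f a))"
    by (rule sum.reindex_bij_betw[OF bij_betw_add_right[OF subgroup_S b]])
  finally show ?thesis by (simp add: coavg_def mult.assoc scal_left_commute[of "avg derived"])
qed

lemma twcomm_double_sum:
  "twcomm \<theta> \<phi> = scal (1 / (of_nat (card S))\<^sup>2) * (\<Sum>(a, c)\<in>S \<times> S. elt (a + c - \<theta> a - \<phi> c))"
proof -
  have "twcomm \<theta> \<phi> = scal (1 / of_nat (card S)) * (\<Sum>c\<in>S. scal (1 / of_nat (card S)) * (\<Sum>a\<in>S. elt (a + c - \<theta> a - \<phi> c)))"
    by (simp add: twcomm_def twavg_def elt_add mult.assoc sum_distrib_right flip: add_uminus_conv_diff)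
  also have "\<dots> = scal (1 / (of_nat (card S))\<^sup>2) * (\<Sum>c\<in>S. \<Sum>a\<in>S. elt (a + c - \<theta> a - \<phi> c))"
    by (simp add: power2_eq_square flip: sum_distrib_left)
  also have "(\<Sum>c\<in>S. \<Sum>a\<in>S. elt (a + c - \<theta> a - \<phi> c)) = (\<Sum>a\<in>S. \<Sum>c\<in>S. elt (a + c - \<theta> a - \<phi> c))"
    by (rule sum.swap)
  finally show ?thesis by (simp add: sum.cartesian_product)
qed

text \<open>Exchanging \<open>c\<close> and \<open>- \<theta> a\<close>, which is allowed modulo
  \<open>derived\<close>, turns \<open>a + c - \<theta> a - \<phi> c\<close> into
  \<open>(a - \<theta> a) + (c - \<phi> c)\<close>, and the double average factors.\<close>

lemma avg_derived_twcomm: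
  assumes \<theta>: "endo \<theta>" and \<phi>: "endo \<phi>"
  shows "avg derived * twcomm \<theta> \<phi> = avg derived * (coavg \<theta> * coavg \<phi>)"
proof -
  have "avg derived * elt (a + c - \<theta> a - \<phi> c) = avg derived * (elt (a - \<theta> a) * elt (c - \<phi> c))"
    if "a \<in> S" "c \<in> S" for a c
  proof -
    have "elt (a + c - \<theta> a - \<phi> c) = elt a * ((elt c * elt (- \<theta> a)) * elt (- \<phi> c))"
      by (simp add: elt_add mult.assoc flip: add_uminus_conv_diff)
    moreover have "avg derived * (elt a * ((elt c * elt (- \<theta> a)) * elt (- \<phi> c)))
        = avg derived * (elt a * ((elt (- \<theta> a) * elt c) * elt (- \<phi> c)))"
      using avg_derived_commute'[of "elt a" "elt c" "elt (- \<theta> a)"] endoD(1)[OF \<theta>] that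
      by (simp flip: mult.assoc)
    moreover have "elt a * ((elt (- \<theta> a) * elt c) * elt (- \<phi> c)) = elt (a - \<theta> a) * elt (c - \<phi> c)"
      by (simp add: elt_add mult.assoc flip: add_uminus_conv_diff)
    ultimately show ?thesis by simp
  qed
  then have "avg derived * (\<Sum>(a, c)\<in>S \<times> S. elt (a + c - \<theta> a - \<phi> c)) =
      avg derived * ((\<Sum>a\<in>S. elt (a - \<theta> a)) * (\<Sum>c\<in>S. elt (c - \<phi> c)))"
    unfolding sum_product[of "\<lambda>a. elt (a - \<theta> a)"] sum.cartesian_product unfolding sum_distrib_left
    by (intro sum.cong) auto
  then show ?thesis
    by (simp add: twcomm_double_sum coavg_def mult.assoc power2_eq_square
        scal_left_commute[of "avg derived"] scal_left_commute[of "sum _ _"])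
qed

lemma twcomm_absorb:
  assumes \<theta>: "endo \<theta>" and \<phi>: "endo \<phi>" and b: "b \<in> S"
  shows "avg derived * (twcomm \<theta> \<phi> * elt (b - \<theta> b)) = avg derived * twcomm \<theta> \<phi>"
    "avg derived * (twcomm \<theta> \<phi> * elt (b - \<phi> b)) = avg derived * twcomm \<theta> \<phi>"
proof -
  note tw = avg_derived_twcomm[OF \<theta> \<phi>]
  have "avg derived * coavg \<theta> = coavg \<theta> * avg derived"
    using center_commute[OF avg_derived_center coavg_alg[OF \<theta>]] by simp
  then have dc: "avg derived * (coavg \<theta> * z) = coavg \<theta> * (avg derived * z)" for z
    by (simp flip: mult.assoc)
  have push: "avg derived * (twcomm \<theta> \<phi> * z) = avg derived * (coavg \<theta> * (coavg \<phi> * z))" for z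
    using arg_cong[OF tw, of "\<lambda>y. y * z"] by (simp add: mult.assoc)
  show "avg derived * (twcomm \<theta> \<phi> * elt (b - \<phi> b)) = avg derived * twcomm \<theta> \<phi>"
    unfolding push tw dc coavg_absorb[OF \<phi> b] by (rule refl)
  have bt: "elt (b - \<theta> b) \<in> alg" using b endoD(1)[OF \<theta>] by simp
  have "avg derived * (twcomm \<theta> \<phi> * elt (b - \<theta> b)) = avg derived * (coavg \<theta> * (elt (b - \<theta> b) * coavg \<phi>))"
    unfolding push by (rule avg_derived_commute'[OF coavg_alg[OF \<theta>] coavg_alg[OF \<phi>] bt])
  also have "\<dots> = avg derived * (coavg \<theta> * elt (b - \<theta> b)) * coavg \<phi>" by (simp only: mult.assoc)
  also have "\<dots> = avg derived * twcomm \<theta> \<phi>" by (simp only: coavg_absorb[OF \<theta> b] tw mult.assoc)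
  finally show "avg derived * (twcomm \<theta> \<phi> * elt (b - \<theta> b)) = avg derived * twcomm \<theta> \<phi>" .
qed

lemma prod_list_alg: "(\<And>x. x \<in> set xs \<Longrightarrow> x \<in> alg) \<Longrightarrow> prod_list xs \<in> alg"
  by (induction xs) auto

text \<open>Modulo \<open>derived\<close> the element \<open>y\<close> can be moved through the
  product until it stands next to the factor \<open>x\<close> that absorbs it.\<close>

lemma prod_list_absorb:
  assumes "set xs \<subseteq> alg" "x \<in> set xs" "y \<in> alg" "avg derived * (x * y) = avg derived * x"
  shows "avg derived * (prod_list xs * y) = avg derived * prod_list xs"
  using assms
proof (induction xs)
  case (Cons z xs)
  have P: "prod_list xs \<in> alg" and z: "z \<in> alg" using Cons.prems by (auto intro: prod_list_alg)
  show ?case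
  proof (cases "x = z")
    case True
    have "avg derived * (z * (prod_list xs * y)) = avg derived * (z * (y * prod_list xs))"
      by (rule avg_derived_commute'[OF z P Cons.prems(3)])
    also have "\<dots> = avg derived * (z * y) * prod_list xs" by (simp add: mult.assoc)
    also have "\<dots> = avg derived * z * prod_list xs" using Cons.prems(4) True by simp
    finally show ?thesis by (simp add: mult.assoc)
  next
    case False
    have dz: "avg derived * z = z * avg derived"
      using center_commute[OF avg_derived_center z] by simp
    have IH: "avg derived * (prod_list xs * y) = avg derived * prod_list xs"
      using Cons False by auto
    from dz have "avg derived * (z * w) = z * (avg derived * w)" for w by (simp flip: mult.assoc)
    then show ?thesis by (simp only: prod_list.Cons mult.assoc IH)
  qed
qed simp

end

text \<open>\<open>K\<close> is characterised as the least subgroup containing three kinds of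
  elements, all expressed inside \<open>S\<close>. In the application it is
  \<open>[\<Gamma>, G']\<close>, whose definition refers to elements outside \<Gamma>.\<close>

locale twisted_commutators = finite_add_subgroup S for S :: "'g::group_add set" +
  fixes h :: nat and \<theta> \<phi> :: "nat \<Rightarrow> 'g \<Rightarrow> 'g" and K :: "'g set"
  assumes \<theta>: "k < h \<Longrightarrow> endo (\<theta> k)" "k < h \<Longrightarrow> \<theta> k ` S = S"
    and \<phi>: "k < h \<Longrightarrow> endo (\<phi> k)"
    and K: "add_subgroup K" "K \<subseteq> S"
    and K_comm: "a \<in> S \<Longrightarrow> b \<in> S \<Longrightarrow> a + b - a - b \<in> K"
    and K_\<theta>: "k < h \<Longrightarrow> a \<in> S \<Longrightarrow> a - \<theta> k a \<in> K"
    and K_\<phi>: "k < h \<Longrightarrow> a \<in> S \<Longrightarrow> a - \<phi> k a \<in> K"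
    and K_least: "\<lbrakk>add_subgroup T; T \<subseteq> S; \<And>a b. \<lbrakk>a \<in> S; b \<in> S\<rbrakk> \<Longrightarrow> a + b - a - b \<in> T;
      \<And>k a. \<lbrakk>k < h; a \<in> S\<rbrakk> \<Longrightarrow> a - \<theta> k a \<in> T; \<And>k a. \<lbrakk>k < h; a \<in> S\<rbrakk> \<Longrightarrow> a - \<phi> k a \<in> T\<rbrakk> \<Longrightarrow> K \<subseteq> T"
begin

definition twprod :: "nat \<Rightarrow> 'g galg" where
  "twprod n = prod_list (map (\<lambda>k. twcomm (\<theta> k) (\<phi> k)) [0..<n])"

lemma twprod_alg: "n \<le> h \<Longrightarrow> twprod n \<in> alg"
  unfolding twprod_def by (intro prod_list_alg) (auto simp: \<theta> \<phi>)

lemma derived_subset_K: "derived \<subseteq> K"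
  by (rule derived_least) (use K K_comm in auto)

lemma twcomm_avg_K: assumes "k < h" shows "twcomm (\<theta> k) (\<phi> k) * avg K = avg K"
proof -
  have "elt (a + c - \<theta> k a - \<phi> k c) * avg K = avg K" if "a \<in> S" "c \<in> S" for a c
  proof -
    \<comment> \<open>A twisted commutator is composed of one element of each of the three kinds
      that lie in \<open>K\<close>.\<close>
    have "(a - \<theta> k a) + ((\<theta> k a + c - \<theta> k a - c) + (c - \<phi> k c)) \<in> K"
      using that assms K(1) endoD(1)[OF \<theta>(1)] by (intro add_subgroupD(2) K_comm K_\<theta> K_\<phi>) auto
    also have "(a - \<theta> k a) + ((\<theta> k a + c - \<theta> k a - c) + (c - \<phi> k c)) = a + c - \<theta> k a - \<phi> k c"
      by (simp add: add.assoc flip: add_uminus_conv_diff)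
    finally show ?thesis using K(1) by (intro avg_absorb_left)
  qed
  then have "(\<Sum>(a, c)\<in>S \<times> S. elt (a + c - \<theta> k a - \<phi> k c)) * avg K = (\<Sum>(a, c)\<in>S \<times> S. avg K)"
    unfolding sum_distrib_right by (intro sum.cong) auto
  moreover have "(\<Sum>(a, c)\<in>S \<times> S. avg K) = scal (of_nat (card S) ^ 2) * avg K"
    by (simp add: case_prod_unfold card_cartesian_product scal_of_nat power2_eq_square flip: of_nat_mult scal_of_nat)
  moreover have "card S \<noteq> 0" using finite_S S_closed(1) by (metis card_0_eq empty_iff)
  ultimately show ?thesis by (simp add: twcomm_double_sum mult.assoc)
qed

text \<open>The product \<open>B\<close> is fixed by right translation by the generators of
  \<open>K\<close>, hence \<open>B * avg K = B\<close>. Conversely its factors only involve elements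
  of \<open>K\<close>, so they disappear in front of \<open>avg K\<close>, and
  \<open>B * avg K = avg K\<close>.\<close>

lemma avg_derived_twprod: "avg derived * twprod h = avg K"
proof -
  define B where "B = avg derived * twprod h"
  define T where "T = {t \<in> S. B * elt t = B}"
  have T: "add_subgroup T" unfolding add_subgroup_def
  proof (intro conjI ballI)
    fix a assume "a \<in> T"
    then have "a \<in> S" "B * elt a * elt (- a) = B * elt (- a)" by (auto simp: T_def)
    then show "- a \<in> T" by (simp add: T_def mult.assoc)
  next
    fix a b assume "a \<in> T" "b \<in> T"
    then have "B * elt a * elt b = B" "a \<in> S" "b \<in> S" by (auto simp: T_def)
    then show "a + b \<in> T" by (simp add: T_def elt_add mult.assoc)
  qed (simp add: T_def elt_0)
  have gen: "b - \<theta> k b \<in> T" "b - \<phi> k b \<in> T" if k: "k < h" and b: "b \<in> S" for k b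
  proof -
    have xs: "set (map (\<lambda>k. twcomm (\<theta> k) (\<phi> k)) [0..<h]) \<subseteq> alg"
      "twcomm (\<theta> k) (\<phi> k) \<in> set (map (\<lambda>k. twcomm (\<theta> k) (\<phi> k)) [0..<h])"
      using k by (auto simp: \<theta> \<phi>)
    have "elt (b - \<theta> k b) \<in> alg" "elt (b - \<phi> k b) \<in> alg"
      using b k by (simp_all add: endoD(1)[OF \<theta>(1)] endoD(1)[OF \<phi>])
    with prod_list_absorb[OF xs] twcomm_absorb[OF \<theta>(1)[OF k] \<phi>[OF k] b]
    have "B * elt (b - \<theta> k b) = B" "B * elt (b - \<phi> k b) = B"
      by (simp_all add: B_def twprod_def mult.assoc)
    then show "b - \<theta> k b \<in> T" "b - \<phi> k b \<in> T"
      using b k by (simp_all add: T_def endoD(1)[OF \<theta>(1)] endoD(1)[OF \<phi>])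
  qed
  have comm: "a + b - a - b \<in> T" if "a \<in> S" "b \<in> S" for a b
  proof -
    have d: "avg derived * elt (a + b - a - b) = avg derived"
      using commutator_in_derived[OF that] derived_subgroup by (intro avg_absorb_right)
    have "B = twprod h * avg derived" unfolding B_def
      by (rule center_commute[OF avg_derived_center twprod_alg, symmetric]) simp
    then have "B * elt (a + b - a - b) = B" using d by (simp only: mult.assoc)
    then show ?thesis using that by (simp add: T_def)
  qed
  have "K \<subseteq> T" by (rule K_least[OF T]) (use comm gen in \<open>auto simp: T_def\<close>)
  then have "B * avg K = B" using K by (intro mult_avg) (auto simp: T_def)
  moreover have "prod_list (map (\<lambda>k. twcomm (\<theta> k) (\<phi> k)) l) * avg K = avg K" if "set l \<subseteq> {..<h}" for l
    using that by (induction l) (auto simp: mult.assoc twcomm_avg_K)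
  then have "twprod h * avg K = avg K" unfolding twprod_def by (auto simp: atLeast0LessThan)
  moreover have "avg derived * avg K = avg K"
    using derived_subgroup derived_subset_K K by (intro avg_mult avg_absorb_left) auto
  ultimately show ?thesis by (simp add: B_def mult.assoc)
qed

text \<open>The complementary projection is central and idempotent, so a copy of it can be placed
  before each factor, and each factor then contributes 1/16.\<close>

lemma nrm_compl_twprod:
  assumes "n \<le> h" shows "nrm ((1 - avg derived) * twprod n) \<le> nrm (1 - avg derived :: 'g galg) / 16 ^ n"
  using assms
proof (induction n)
  case 0
  then show ?case by (simp add: twprod_def)
next
  case (Suc n)
  define f where "f = (1 - avg derived :: 'g galg)"
  have f: "central_proj f" using central_proj_avg_derived
    by (intro central_projI) (auto simp: f_def ring_distribs star_diff)
  have fd: "f * avg derived = 0" using central_proj_avg_derived by (simp add: f_def ring_distribs)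
  have "f * twprod n * f = f * twprod n"
    using f center_commute[of f "f * twprod n"] twprod_alg[of n] Suc.prems by simp
  moreover have "f * twprod n * (f * twcomm (\<theta> n) (\<phi> n)) = (f * twprod n * f) * twcomm (\<theta> n) (\<phi> n)"
    by (simp only: mult.assoc)
  moreover have "nrm (f * twprod n * (f * twcomm (\<theta> n) (\<phi> n))) \<le> nrm (f * twprod n * f) / 16"
    using Suc.prems by (intro nrm_mult_twcomm \<theta> \<phi> f fd) auto
  ultimately have "nrm (f * twprod (Suc n)) \<le> nrm (f * twprod n) / 16"
    by (simp add: twprod_def mult.assoc)
  also have "\<dots> \<le> (nrm f / 16 ^ n) / 16" using Suc unfolding f_def by (intro divide_right_mono) auto
  finally show ?case by (simp add: f_def)
qed

text \<open>After the uniform part \<open>avg K\<close> is removed, the coefficient at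
  \<open>x\<close> is the inner product of \<open>f * twprod h\<close> with
  \<open>elt x * f\<close>. Keeping \<open>f\<close> in the second argument improves its squared
  norm from 1 to \<open>nrm f\<close>, and Cauchy-Schwarz then gives \<open>nrm f / 4 ^ h\<close>
  without a square root.\<close>

lemma lookup_twprod:
  assumes x: "x \<in> K"
  shows "cmod (coef (twprod h) x - 1 / of_nat (card K)) \<le> (1 - 1 / real (card K)) / 4 ^ h"
proof -
  define f where "f = (1 - avg derived :: 'g galg)"
  have f: "central_proj f" using central_proj_avg_derived
    by (intro central_projI) (auto simp: f_def ring_distribs star_diff)
  have finK: "finite K" "card K > 0" "finite derived" "card derived > 0"
    using finite_subset_S[OF K(2)] finite_subset_S[OF derived_subgroup(2)]
      add_subgroupD(1)[OF K(1)] add_subgroupD(1)[OF derived_subgroup(1)] by (auto simp: card_gt_0_iff)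
  have nf: "nrm f \<le> 1 - 1 / real (card K)"
  proof -
    have "tr f = 1 - 1 / of_nat (card derived)"
      using add_subgroupD(1)[OF derived_subgroup(1)] by (simp add: f_def tr_def lookup_minus lookup_avg derived_subgroup)
    then have "of_real (nrm f) = complex_of_real (1 - 1 / real (card derived))"
      using f by (simp add: tr_central_proj)
    then have "nrm f = 1 - 1 / real (card derived)" unfolding of_real_eq_iff .
    moreover have "card derived \<le> card K" using derived_subset_K finK by (intro card_mono)
    ultimately show ?thesis using finK by (simp add: frac_le)
  qed
  have "twprod h = avg K + f * twprod h"
    using avg_derived_twprod by (simp add: f_def left_diff_distrib)
  then have "coef (twprod h) x - 1 / of_nat (card K) = coef (f * twprod h) x"
    using x lookup_add[of "avg K" "f * twprod h" x] lookup_avg[OF K(2), of x] by simp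
  moreover have "coef (f * twprod h) x = tr (f * twprod h * star (elt x * f))"
  proof -
    have "f * twprod h * f = f * twprod h"
      using f center_commute[of f "f * twprod h"] twprod_alg[of h] by simp
    then show ?thesis using f by (simp add: star_mult lookup_conv_tr flip: mult.assoc)
  qed
  moreover have "nrm (elt x * f) = nrm f"
    using nrm_mult_elt[of f "- x"] nrm_star[of "elt x * f"] f by (simp add: star_mult)
  ultimately have "(cmod (coef (twprod h) x - 1 / of_nat (card K)))\<^sup>2 \<le> nrm (f * twprod h) * nrm f"
    using cauchy_schwarz[of "f * twprod h" "elt x * f"] by simp
  also have "\<dots> \<le> (nrm f / 16 ^ h) * nrm f"
    using nrm_compl_twprod[of h] by (intro mult_right_mono) (auto simp: f_def)
  also have "\<dots> = (nrm f / 4 ^ h)\<^sup>2"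
    by (simp add: power2_eq_square flip: power_mult_distrib)
  finally have "cmod (coef (twprod h) x - 1 / of_nat (card K)) \<le> nrm f / 4 ^ h"
    by (rule power2_le_imp_le) simp
  also have "\<dots> \<le> (1 - 1 / real (card K)) / 4 ^ h" using nf by (intro divide_right_mono) auto
  finally show ?thesis .
qed

definition solutions :: "'g \<Rightarrow> (nat \<Rightarrow> 'g \<times> 'g) set" where
  "solutions x = {t \<in> PiE {..<h} (\<lambda>_. S \<times> S).
     sum_list (map (\<lambda>k. fst (t k) + snd (t k) - \<theta> k (fst (t k)) - \<phi> k (snd (t k))) [0..<h]) = x}"

text \<open>\<open>twprod h\<close> is the distribution of a sum of \<open>h\<close> independent
  uniform twisted commutators. Its coefficient at \<open>x\<close> is therefore the number of
  solutions divided by \<open>card S ^ (2 * h)\<close>.\<close>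

theorem card_solutions:
  assumes x: "x \<in> K"
  shows "real (card (solutions x)) \<ge>
    real (card S) ^ (2 * h) / real (card K) * (1 - (real (card K) - 1) / 2 ^ (2 * h))"
proof -
  let ?N = "of_nat (card S) :: complex"
  define F where "F t = sum_list (map (\<lambda>k. fst (t k) + snd (t k) - \<theta> k (fst (t k)) - \<phi> k (snd (t k))) [0..<h])"
    for t :: "nat \<Rightarrow> 'g \<times> 'g"
  have "finite (S \<times> S)" using finite_S by simp
  then have fin: "finite (PiE {..<h} (\<lambda>_. S \<times> S))" by (intro finite_PiE) auto
  have "twprod h = scal ((1 / ?N\<^sup>2) ^ h) * prod_list (map (\<lambda>k. \<Sum>p\<in>S \<times> S. elt (fst p + snd p - \<theta> k (fst p) - \<phi> k (snd p))) [0..<h])"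
    by (simp add: twprod_def twcomm_double_sum prod_list_scal case_prod_unfold)
  also have "\<dots> = scal ((1 / ?N\<^sup>2) ^ h) * (\<Sum>t\<in>PiE {..<h} (\<lambda>_. S \<times> S). elt (F t))"
    by (subst prod_list_sum_distrib[OF \<open>finite (S \<times> S)\<close>]) (simp add: prod_list_elt F_def)
  finally have "coef (twprod h) x = (1 / ?N\<^sup>2) ^ h * (\<Sum>t\<in>PiE {..<h} (\<lambda>_. S \<times> S). if F t = x then 1 else 0)"
    by (simp add: lookup_sum lookup_elt eq_commute)
  also have "(\<Sum>t\<in>PiE {..<h} (\<lambda>_. S \<times> S). if F t = x then 1 else 0 :: complex) = of_nat (card (solutions x))"
    using fin by (simp add: solutions_def F_def sum.If_cases Int_def conj_commute)
  finally have L: "coef (twprod h) x = of_real (real (card (solutions x)) / real (card S) ^ (2 * h))"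
    by (simp add: power_one_over power_mult)
  have K0: "real (card K) > 0"
    using finite_subset_S[OF K(2)] add_subgroupD(1)[OF K(1)] by (auto simp: card_gt_0_iff)
  have S0: "real (card S) > 0" using finite_S S_closed(1) by (metis card_gt_0_iff empty_iff of_nat_0_less_iff)
  have "cmod (of_real (real (card (solutions x)) / real (card S) ^ (2 * h) - 1 / real (card K))) \<le>
      (1 - 1 / real (card K)) / 4 ^ h"
    using lookup_twprod[OF x] unfolding L by simp
  then have "1 / real (card K) - (1 - 1 / real (card K)) / 4 ^ h \<le> real (card (solutions x)) / real (card S) ^ (2 * h)"
    unfolding norm_of_real by linarith
  moreover have "1 / real (card K) - (1 - 1 / real (card K)) / 4 ^ h =
      1 / real (card K) * (1 - (real (card K) - 1) / 2 ^ (2 * h))"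
  proof -
    have "(2::real) ^ (2 * h) = 4 ^ h" unfolding power_mult by simp
    then show ?thesis using K0 by (simp add: field_simps)
  qed
  ultimately have "1 / real (card K) * (1 - (real (card K) - 1) / 2 ^ (2 * h)) * real (card S) ^ (2 * h) \<le> real (card (solutions x))"
    using S0 by (simp add: pos_le_divide_eq)
  then show ?thesis by (simp add: mult_ac)
qed

end

section \<open>Counting in finite groups\<close>

text \<open>\<open>poly_mapping\<close> is a ring only over a type-class monoid; every finite group embeds into the following one.\<close>
typedef 'a bijection = "{f :: 'a \<Rightarrow> 'a. bij f}" morphisms bij_apply Bijection
  using bij_id by blast

instantiation bijection :: (type) group_add
begin
definition "0 = Bijection (\<lambda>x. x)"
definition "f + g = Bijection (bij_apply f \<circ> bij_apply g)"
definition "- f = Bijection (inv_into UNIV (bij_apply f))"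
definition minus_bijection :: "'a bijection \<Rightarrow> 'a bijection \<Rightarrow> 'a bijection" where "minus_bijection f g = f + - g"

lemma bij_bij_apply: "bij (bij_apply f)" for f :: "'a bijection"
  using bij_apply[of f] by simp
lemma bij_apply_zero: "bij_apply (0 :: 'a bijection) = (\<lambda>x. x)"
  unfolding zero_bijection_def by (rule Bijection_inverse) (simp add: bij_id[unfolded id_def])
lemma bij_apply_plus: "bij_apply (f + g) = bij_apply f \<circ> bij_apply g" for f g :: "'a bijection"
  unfolding plus_bijection_def by (rule Bijection_inverse) (simp add: bij_comp bij_bij_apply)
lemma bij_apply_uminus: "bij_apply (- f) = inv_into UNIV (bij_apply f)" for f :: "'a bijection"
  unfolding uminus_bijection_def by (rule Bijection_inverse) (simp add: bij_imp_bij_inv bij_bij_apply)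

instance
proof
  fix f g h :: "'a bijection"
  show "f + g + h = f + (g + h)" "0 + f = f" "f + 0 = f" "- f + f = 0"
    by (simp_all add: bij_apply_inject[symmetric] bij_apply_zero bij_apply_plus bij_apply_uminus
        fun_eq_iff bij_is_inj[OF bij_bij_apply])
  show "f + - g = f - g" by (simp add: minus_bijection_def)
qed
end

context group
begin

lemma inv_mult_cancel [simp]: "x \<in> carrier G \<Longrightarrow> y \<in> carrier G \<Longrightarrow> inv x \<otimes> (x \<otimes> y) = y"
  "x \<in> carrier G \<Longrightarrow> y \<in> carrier G \<Longrightarrow> x \<otimes> (inv x \<otimes> y) = y"
  by (simp_all flip: m_assoc)

text \<open>Left translation, extended by the identity outside the carrier so as to be a bijection
  of the whole type.\<close>

definition cayley :: "'a \<Rightarrow> 'a bijection" where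
  "cayley g = Bijection (\<lambda>x. if x \<in> carrier G then g \<otimes> x else x)"

lemma bij_apply_cayley:
  assumes "g \<in> carrier G"
  shows "bij_apply (cayley g) = (\<lambda>x. if x \<in> carrier G then g \<otimes> x else x)"
proof -
  let ?f = "\<lambda>g x. if x \<in> carrier G then g \<otimes> x else x"
  have "?f (inv g) \<circ> ?f g = id" "?f g \<circ> ?f (inv g) = id" using assms by auto
  then have "bij (?f g)" by (rule o_bij)
  then show ?thesis by (simp add: cayley_def Bijection_inverse)
qed

lemma cayley_mult:
  assumes "g \<in> carrier G" "h \<in> carrier G" shows "cayley (g \<otimes> h) = cayley g + cayley h"
proof -
  have "bij_apply (cayley (g \<otimes> h)) = bij_apply (cayley g + cayley h)"
    unfolding bij_apply_plus using assms by (auto simp: bij_apply_cayley m_assoc)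
  then show ?thesis by (simp add: bij_apply_inject)
qed

lemma inj_on_cayley: "inj_on cayley (carrier G)"
proof (rule inj_onI)
  fix g h assume gh: "g \<in> carrier G" "h \<in> carrier G" "cayley g = cayley h"
  have "bij_apply (cayley g) \<one> = g" "bij_apply (cayley h) \<one> = h"
    using gh(1,2) by (simp_all add: bij_apply_cayley)
  with gh(3) show "g = h" by metis
qed

lemma cayley_one: "cayley \<one> = 0"
  using cayley_mult[of \<one> \<one>] by (metis add.right_neutral add_left_cancel one_closed r_one)

lemma cayley_inv: assumes "g \<in> carrier G" shows "cayley (inv g) = - cayley g"
  using cayley_mult[of g "inv g"] assms by (simp add: cayley_one minus_unique)

lemma add_subgroup_cayley:
  assumes "subgroup T G" shows "add_subgroup (cayley ` T)"
  unfolding add_subgroup_def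
proof (intro conjI ballI)
  show "0 \<in> cayley ` T" using subgroup.one_closed[OF assms] cayley_one by (metis imageI)
  show "x + y \<in> cayley ` T" if xy: "x \<in> cayley ` T" "y \<in> cayley ` T" for x y
  proof -
    obtain g h where "x = cayley g" "y = cayley h" "g \<in> T" "h \<in> T" using xy by blast
    then show ?thesis using subgroup.m_closed[OF assms, of g h] subgroup.mem_carrier[OF assms]
      by (metis cayley_mult imageI)
  qed
  show "- x \<in> cayley ` T" if x: "x \<in> cayley ` T" for x
  proof -
    obtain g where "x = cayley g" "g \<in> T" using x by blast
    then show ?thesis using subgroup.m_inv_closed[OF assms, of g] subgroup.mem_carrier[OF assms]
      by (metis cayley_inv imageI)
  qed
qed

text \<open>\<open>card_solutions\<close>, transported along the Cayley embedding. As the claim is a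
  lower bound, an injection from the additive solutions into the multiplicative ones
  suffices.\<close>

theorem card_twisted_commutator_solutions:
  fixes h :: nat and \<theta> \<phi> :: "nat \<Rightarrow> 'a \<Rightarrow> 'a"
  assumes fin: "finite (carrier G)"
    and \<theta>: "\<And>k. k < h \<Longrightarrow> \<theta> k \<in> hom G G" "\<And>k. k < h \<Longrightarrow> \<theta> k ` carrier G = carrier G"
    and \<phi>: "\<And>k. k < h \<Longrightarrow> \<phi> k \<in> hom G G"
    and K: "subgroup K G"
    and K_comm: "\<And>a b. a \<in> carrier G \<Longrightarrow> b \<in> carrier G \<Longrightarrow> a \<otimes> b \<otimes> inv a \<otimes> inv b \<in> K"
    and K_\<theta>: "\<And>k a. k < h \<Longrightarrow> a \<in> carrier G \<Longrightarrow> a \<otimes> inv (\<theta> k a) \<in> K"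
    and K_\<phi>: "\<And>k a. k < h \<Longrightarrow> a \<in> carrier G \<Longrightarrow> a \<otimes> inv (\<phi> k a) \<in> K"
    and K_least: "\<And>T. \<lbrakk>subgroup T G;
      \<And>a b. \<lbrakk>a \<in> carrier G; b \<in> carrier G\<rbrakk> \<Longrightarrow> a \<otimes> b \<otimes> inv a \<otimes> inv b \<in> T;
      \<And>k a. \<lbrakk>k < h; a \<in> carrier G\<rbrakk> \<Longrightarrow> a \<otimes> inv (\<theta> k a) \<in> T;
      \<And>k a. \<lbrakk>k < h; a \<in> carrier G\<rbrakk> \<Longrightarrow> a \<otimes> inv (\<phi> k a) \<in> T\<rbrakk> \<Longrightarrow> K \<subseteq> T"
    and x: "x \<in> K"
  shows "real (card {t \<in> PiE {..<h} (\<lambda>_. carrier G \<times> carrier G).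
      foldr (\<otimes>) (map (\<lambda>k. fst (t k) \<otimes> snd (t k) \<otimes> inv (\<theta> k (fst (t k))) \<otimes> inv (\<phi> k (snd (t k)))) [0..<h]) \<one> = x})
    \<ge> real (card (carrier G)) ^ (2 * h) / real (card K) * (1 - (real (card K) - 1) / 2 ^ (2 * h))"
    (is "real (card ?sol) \<ge> _")
proof -
  define \<kappa> where "\<kappa> = inv_into (carrier G) cayley"
  have \<kappa>: "\<kappa> (cayley g) = g" if "g \<in> carrier G" for g
    using that by (simp add: \<kappa>_def inv_into_f_f[OF inj_on_cayley])
  define S where "S = cayley ` carrier G"
  have \<kappa>S: "\<kappa> s \<in> carrier G" "cayley (\<kappa> s) = s" if "s \<in> S" for s
    using that by (auto simp: S_def \<kappa>)
  interpret S: finite_add_subgroup S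
    by unfold_locales (auto simp: S_def fin intro: add_subgroup_cayley[OF subgroup_self])
  have Ksub: "K \<subseteq> carrier G" by (rule subgroup.subset[OF K])
  have conv: "cayley (f (\<kappa> s)) \<in> S" "\<And>r. r \<in> S \<Longrightarrow> cayley (f (\<kappa> (s + r))) = cayley (f (\<kappa> s)) + cayley (f (\<kappa> r))"
    if f: "f \<in> hom G G" and s: "s \<in> S" for f s
  proof -
    note fc = hom_in_carrier[OF f]
    show "cayley (f (\<kappa> s)) \<in> S" using \<kappa>S(1)[OF s] by (auto simp: S_def intro: fc)
    fix r assume r: "r \<in> S"
    have "\<kappa> (s + r) = \<kappa> s \<otimes> \<kappa> r"
      using \<kappa>S[OF s] \<kappa>S[OF r] by (metis \<kappa> cayley_mult m_closed)
    then show "cayley (f (\<kappa> (s + r))) = cayley (f (\<kappa> s)) + cayley (f (\<kappa> r))"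
      using \<kappa>S(1)[OF s] \<kappa>S(1)[OF r] f by (simp add: hom_mult cayley_mult fc)
  qed
  have endo: "S.endo (\<lambda>s. cayley (f (\<kappa> s)))" if "f \<in> hom G G" for f
    unfolding S.endo_def using conv[OF that] by blast
  have diffK: "cayley g - cayley h = cayley (g \<otimes> inv h)" if "g \<in> carrier G" "h \<in> carrier G" for g h
    using that by (simp add: cayley_mult cayley_inv)
  interpret tc: twisted_commutators S h "\<lambda>k s. cayley (\<theta> k (\<kappa> s))" "\<lambda>k s. cayley (\<phi> k (\<kappa> s))" "cayley ` K"
  proof unfold_locales
    show "S.endo (\<lambda>s. cayley (\<theta> k (\<kappa> s)))" "S.endo (\<lambda>s. cayley (\<phi> k (\<kappa> s)))" if "k < h" for k
      using endo \<theta> \<phi> that by blast+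
    show "(\<lambda>s. cayley (\<theta> k (\<kappa> s))) ` S = S" if "k < h" for k
    proof -
      have "(\<lambda>s. cayley (\<theta> k (\<kappa> s))) ` S = cayley ` \<theta> k ` carrier G"
        unfolding S_def image_image by (intro image_cong) (auto simp: \<kappa>)
      then show ?thesis using \<theta>(2)[OF that] by (simp add: S_def)
    qed
    show "add_subgroup (cayley ` K)" by (rule add_subgroup_cayley[OF K])
    show "cayley ` K \<subseteq> S" using Ksub by (auto simp: S_def)
    show "a + b - a - b \<in> cayley ` K" if "a \<in> S" "b \<in> S" for a b
      using that K_comm by (auto simp: S_def diffK simp flip: cayley_mult)
    show "a - cayley (\<theta> k (\<kappa> a)) \<in> cayley ` K" "a - cayley (\<phi> k (\<kappa> a)) \<in> cayley ` K" if "k < h" "a \<in> S" for k a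
      using that K_\<theta> K_\<phi> hom_in_carrier[OF \<theta>(1)] hom_in_carrier[OF \<phi>] by (auto simp: S_def diffK \<kappa>)
    fix T assume T: "add_subgroup T" "T \<subseteq> S" "\<And>a b. \<lbrakk>a \<in> S; b \<in> S\<rbrakk> \<Longrightarrow> a + b - a - b \<in> T"
      "\<And>k a. \<lbrakk>k < h; a \<in> S\<rbrakk> \<Longrightarrow> a - cayley (\<theta> k (\<kappa> a)) \<in> T" "\<And>k a. \<lbrakk>k < h; a \<in> S\<rbrakk> \<Longrightarrow> a - cayley (\<phi> k (\<kappa> a)) \<in> T"
    \<comment> \<open>The minimality of \<open>K\<close> is known among subgroups of
      \<open>G\<close>, so it is applied to the preimage of \<open>T\<close>.\<close>
    define T' where "T' = {g \<in> carrier G. cayley g \<in> T}"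
    have "K \<subseteq> T'"
    proof (rule K_least)
      show "subgroup T' G"
        by (rule subgroupI)
          (use add_subgroupD[OF T(1)] in \<open>auto simp: T'_def cayley_mult cayley_inv cayley_one intro: exI[of _ \<one>]\<close>)
      show "a \<otimes> b \<otimes> inv a \<otimes> inv b \<in> T'" if "a \<in> carrier G" "b \<in> carrier G" for a b
        using that T(3)[of "cayley a" "cayley b"] by (simp add: T'_def S_def cayley_mult cayley_inv)
      show "a \<otimes> inv (\<theta> k a) \<in> T'" "a \<otimes> inv (\<phi> k a) \<in> T'" if "k < h" "a \<in> carrier G" for k a
        using that T(4,5)[of k "cayley a"] hom_in_carrier[OF \<theta>(1)[OF that(1)] that(2)] hom_in_carrier[OF \<phi>[OF that(1)] that(2)]
        by (simp_all add: T'_def S_def cayley_mult cayley_inv \<kappa>)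
    qed
    then show "cayley ` K \<subseteq> T" by (auto simp: T'_def)
  qed
  have foldr_cayley: "cayley (foldr (\<otimes>) l \<one>) = sum_list (map cayley l)" "foldr (\<otimes>) l \<one> \<in> carrier G"
    if "set l \<subseteq> carrier G" for l
    using that by (induction l) (auto simp: cayley_one cayley_mult)
  define \<Psi> where "\<Psi> t = (\<lambda>k\<in>{..<h}. map_prod \<kappa> \<kappa> (t k))" for t :: "nat \<Rightarrow> 'a bijection \<times> 'a bijection"
  have le: "card (tc.solutions (cayley x)) \<le> card ?sol"
  proof (rule card_inj_on_le[of \<Psi>])
    show "inj_on \<Psi> (tc.solutions (cayley x))"
    proof (rule inj_onI)
      fix t t' assume t: "t \<in> tc.solutions (cayley x)" "t' \<in> tc.solutions (cayley x)" "\<Psi> t = \<Psi> t'"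
      show "t = t'"
      proof (rule PiE_ext[of _ "{..<h}" "\<lambda>_. S \<times> S"])
        fix k assume k: "k \<in> {..<h}"
        then have "map_prod \<kappa> \<kappa> (t k) = map_prod \<kappa> \<kappa> (t' k)"
          using fun_cong[OF t(3), of k] by (simp add: \<Psi>_def)
        moreover have "t k \<in> S \<times> S" "t' k \<in> S \<times> S" using t k by (auto simp: tc.solutions_def)
        ultimately show "t k = t' k" using \<kappa>S(2) by (auto simp: mem_Times_iff prod_eq_iff) (metis)+
      qed (use t in \<open>auto simp: tc.solutions_def\<close>)
    qed
    show "\<Psi> ` tc.solutions (cayley x) \<subseteq> ?sol"
    proof (rule image_subsetI)
      fix t assume t: "t \<in> tc.solutions (cayley x)"
      let ?w = "\<lambda>k. fst (\<Psi> t k) \<otimes> snd (\<Psi> t k) \<otimes> inv (\<theta> k (fst (\<Psi> t k))) \<otimes> inv (\<phi> k (snd (\<Psi> t k)))"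
      have tk: "fst (t k) \<in> S" "snd (t k) \<in> S" if "k < h" for k
        using t that by (auto simp: tc.solutions_def PiE_iff mem_Times_iff)
      have \<Psi>: "fst (\<Psi> t k) = \<kappa> (fst (t k))" "snd (\<Psi> t k) = \<kappa> (snd (t k))" if "k < h" for k
        using that by (simp_all add: \<Psi>_def)
      have w: "?w k \<in> carrier G" "cayley (?w k) = fst (t k) + snd (t k) - cayley (\<theta> k (\<kappa> (fst (t k)))) - cayley (\<phi> k (\<kappa> (snd (t k))))"
        if k: "k < h" for k
        using tk[OF k] \<kappa>S hom_in_carrier[OF \<theta>(1)[OF k]] hom_in_carrier[OF \<phi>[OF k]]
        by (simp_all add: \<Psi>[OF k] cayley_mult cayley_inv)
      have "cayley (foldr (\<otimes>) (map ?w [0..<h]) \<one>) = sum_list (map (cayley \<circ> ?w) [0..<h])"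
        using w(1) by (subst foldr_cayley) auto
      also have "map (cayley \<circ> ?w) [0..<h] = map (\<lambda>k. fst (t k) + snd (t k) - cayley (\<theta> k (\<kappa> (fst (t k)))) - cayley (\<phi> k (\<kappa> (snd (t k))))) [0..<h]"
        using w(2) by (intro map_cong) auto
      also have "sum_list \<dots> = cayley x" using t by (simp add: tc.solutions_def)
      finally have "cayley (foldr (\<otimes>) (map ?w [0..<h]) \<one>) = cayley x" .
      moreover have "foldr (\<otimes>) (map ?w [0..<h]) \<one> \<in> carrier G" using w(1) by (intro foldr_cayley) auto
      ultimately have "foldr (\<otimes>) (map ?w [0..<h]) \<one> = x"
        using x Ksub by (auto dest: inj_onD[OF inj_on_cayley])
      moreover have "\<Psi> t \<in> PiE {..<h} (\<lambda>_. carrier G \<times> carrier G)"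
        using tk \<kappa>S(1) by (auto simp: \<Psi>_def PiE_iff mem_Times_iff)
      ultimately show "\<Psi> t \<in> ?sol" by simp
    qed
    have "finite (PiE {..<h} (\<lambda>_. carrier G \<times> carrier G))" using fin by (intro finite_PiE) auto
    then show "finite ?sol" by simp
  qed
  have cards: "card S = card (carrier G)" "card (cayley ` K) = card K"
    using inj_on_cayley inj_on_subset[OF inj_on_cayley Ksub] by (simp_all add: S_def card_image)
  have "real (card S) ^ (2 * h) / real (card (cayley ` K)) * (1 - (real (card (cayley ` K)) - 1) / 2 ^ (2 * h))
      \<le> real (card (tc.solutions (cayley x)))"
    using x by (intro tc.card_solutions) auto
  also have "\<dots> \<le> real (card ?sol)" using le by simp
  finally show ?thesis unfolding cards .
qed

end

section \<open>Tuples congruent to a given one\<close>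

definition surface_prod :: "('a,'m) monoid_scheme \<Rightarrow> nat \<Rightarrow> (nat \<Rightarrow> 'a) \<Rightarrow> (nat \<Rightarrow> 'a) \<Rightarrow> 'a" where
  "surface_prod G h a b = foldr (\<lambda>x y. x \<otimes>\<^bsub>G\<^esub> y) (surface_word G h a b) \<one>\<^bsub>G\<^esub>"

context group
begin

lemma foldr_mult_closed: "set xs \<subseteq> carrier G \<Longrightarrow> foldr (\<otimes>) xs \<one> \<in> carrier G"
  by (induction xs) auto

lemma foldr_mult_append:
  "set xs \<subseteq> carrier G \<Longrightarrow> set ys \<subseteq> carrier G \<Longrightarrow>
   foldr (\<otimes>) (xs @ ys) \<one> = foldr (\<otimes>) xs \<one> \<otimes> foldr (\<otimes>) ys \<one>"
  by (induction xs) (auto simp: foldr_mult_closed m_assoc)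

lemma set_surface_word:
  "(\<And>i. i < h \<Longrightarrow> a i \<in> carrier G \<and> b i \<in> carrier G) \<Longrightarrow> set (surface_word G h a b) \<subseteq> carrier G"
  by (auto simp: surface_word_def)

lemma surface_prod_closed:
  "(\<And>i. i < h \<Longrightarrow> a i \<in> carrier G \<and> b i \<in> carrier G) \<Longrightarrow> surface_prod G h a b \<in> carrier G"
  unfolding surface_prod_def by (intro foldr_mult_closed set_surface_word)

lemma surface_prod_0: "surface_prod G 0 a b = \<one>"
  by (simp add: surface_prod_def surface_word_def)

lemma surface_prod_Suc:
  assumes "\<And>i. i < Suc k \<Longrightarrow> a i \<in> carrier G \<and> b i \<in> carrier G"
  shows "surface_prod G (Suc k) a b = surface_prod G k a b \<otimes> (a k \<otimes> b k \<otimes> inv (a k) \<otimes> inv (b k))"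
proof -
  have "surface_word G (Suc k) a b = surface_word G k a b @ [a k, b k, inv (a k), inv (b k)]"
    by (simp add: surface_word_def)
  then show ?thesis using assms set_surface_word[of k a b] unfolding surface_prod_def
    by (simp add: foldr_mult_append m_assoc del: foldr_append)
qed

lemma mixed_commutator_conj:
  assumes "N \<lhd> G"
  shows "subgroup (mixed_commutator G N (carrier G)) G" "mixed_commutator G N (carrier G) \<subseteq> N"
    "\<And>x y. x \<in> N \<Longrightarrow> y \<in> carrier G \<Longrightarrow> x \<otimes> y \<otimes> inv x \<otimes> inv y \<in> mixed_commutator G N (carrier G)"
proof -
  interpret N: normal N G by fact
  show "subgroup (mixed_commutator G N (carrier G)) G"
    unfolding mixed_commutator_def by (rule generate_is_subgroup) (auto intro: N.mem_carrier)
  have "x \<otimes> y \<otimes> inv x \<otimes> inv y \<in> N" if "x \<in> N" "y \<in> carrier G" for x y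
  proof -
    have "x \<otimes> (y \<otimes> inv x \<otimes> inv y) \<in> N" using that by (intro N.m_closed N.inv_op_closed2) auto
    then show ?thesis using that N.mem_carrier by (simp add: m_assoc)
  qed
  then show "mixed_commutator G N (carrier G) \<subseteq> N"
    unfolding mixed_commutator_def by (intro generate_subgroup_incl N.subgroup_axioms) auto
  show "x \<otimes> y \<otimes> inv x \<otimes> inv y \<in> mixed_commutator G N (carrier G)" if "x \<in> N" "y \<in> carrier G" for x y
    unfolding mixed_commutator_def using that by (intro generate.incl) auto
qed

text \<open>\<open>T\<close> need not be normal in \<open>G\<close>: a conjugate \<open>y t y\<^sup>-\<^sup>1\<close> lies in \<open>T\<close> because \<open>[t, y]\<close> does.\<close>
lemma subgroup_trivially_acting:
  assumes "N \<lhd> G" and T: "subgroup T G" "T \<subseteq> N"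
    and comm: "\<And>x y. x \<in> N \<Longrightarrow> y \<in> N \<Longrightarrow> x \<otimes> y \<otimes> inv x \<otimes> inv y \<in> T"
  shows "subgroup {y \<in> carrier G. \<forall>x\<in>N. x \<otimes> y \<otimes> inv x \<otimes> inv y \<in> T} G" (is "subgroup ?M G")
proof -
  interpret N: normal N G by fact
  note [simp] = N.mem_carrier
  show ?thesis
  proof (rule subgroupI)
    have "\<one> \<in> ?M" using subgroup.one_closed[OF T(1)] by simp
    then show "?M \<noteq> {}" by blast
  next
    fix y assume y: "y \<in> ?M"
    have "x \<otimes> inv y \<otimes> inv x \<otimes> inv (inv y) \<in> T" if x: "x \<in> N" for x
    proof -
      \<comment> \<open>With this choice the inverse of \<open>[x', y]\<close> is
        \<open>[x, inv y]\<close>.\<close>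
      define x' where "x' = inv y \<otimes> x \<otimes> y"
      have x': "x' \<in> N" unfolding x'_def using x y by (intro N.inv_op_closed1) auto
      have "inv (x' \<otimes> y \<otimes> inv x' \<otimes> inv y) \<in> T" using x' y by (intro subgroup.m_inv_closed[OF T(1)]) auto
      also have "inv (x' \<otimes> y \<otimes> inv x' \<otimes> inv y) = x \<otimes> inv y \<otimes> inv x \<otimes> inv (inv y)"
        using x y by (simp add: x'_def m_assoc inv_mult_group)
      finally show ?thesis .
    qed
    then show "inv y \<in> ?M" using y by simp
  next
    fix y z assume yz: "y \<in> ?M" "z \<in> ?M"
    have "x \<otimes> (y \<otimes> z) \<otimes> inv x \<otimes> inv (y \<otimes> z) \<in> T" if x: "x \<in> N" for x
    proof -
      \<comment> \<open>The identity behind this is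
        \<open>[x, y z] = [x, y] (y [x, z] y^-1)\<close>.\<close>
      define t where "t = x \<otimes> z \<otimes> inv x \<otimes> inv z"
      have t: "t \<in> T" "t \<in> N" using x yz T(2) by (auto simp: t_def)
      have "x \<otimes> y \<otimes> inv x \<otimes> inv y \<in> T" "t \<otimes> y \<otimes> inv t \<otimes> inv y \<in> T" using x yz t by auto
      then have "(x \<otimes> y \<otimes> inv x \<otimes> inv y) \<otimes> (inv (t \<otimes> y \<otimes> inv t \<otimes> inv y) \<otimes> t) \<in> T"
        using t(1) by (simp only: subgroup.m_closed[OF T(1)] subgroup.m_inv_closed[OF T(1)])
      also have "inv (t \<otimes> y \<otimes> inv t \<otimes> inv y) \<otimes> t = y \<otimes> t \<otimes> inv y"
        using t yz by (simp add: m_assoc inv_mult_group)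
      also have "(x \<otimes> y \<otimes> inv x \<otimes> inv y) \<otimes> (y \<otimes> t \<otimes> inv y) = x \<otimes> (y \<otimes> z) \<otimes> inv x \<otimes> inv (y \<otimes> z)"
        using x yz by (simp add: t_def m_assoc inv_mult_group)
      finally show ?thesis .
    qed
    then show "y \<otimes> z \<in> ?M" using yz by simp
  qed auto
qed

lemma conj_hom:
  assumes "N \<lhd> G" "g \<in> carrier G"
  shows "(\<lambda>x. g \<otimes> x \<otimes> inv g) \<in> hom (G\<lparr>carrier := N\<rparr>) (G\<lparr>carrier := N\<rparr>)"
    "(\<lambda>x. g \<otimes> x \<otimes> inv g) ` N = N"
proof -
  interpret N: normal N G by fact
  note [simp] = N.mem_carrier
  show "(\<lambda>x. g \<otimes> x \<otimes> inv g) \<in> hom (G\<lparr>carrier := N\<rparr>) (G\<lparr>carrier := N\<rparr>)"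
  proof -
    have "g \<otimes> (x \<otimes> inv g) \<in> N" if "x \<in> N" for x
      using N.inv_op_closed2[OF assms(2) that] that assms(2) by (simp add: m_assoc)
    then show ?thesis using assms(2) by (auto simp: hom_def m_assoc)
  qed
  show "(\<lambda>x. g \<otimes> x \<otimes> inv g) ` N = N"
  proof
    show "(\<lambda>x. g \<otimes> x \<otimes> inv g) ` N \<subseteq> N" using assms(2) by (auto simp: N.inv_op_closed2)
    show "N \<subseteq> (\<lambda>x. g \<otimes> x \<otimes> inv g) ` N"
    proof
      fix x assume x: "x \<in> N"
      then have "x = g \<otimes> (inv g \<otimes> x \<otimes> g) \<otimes> inv g" using assms(2) by (simp add: m_assoc)
      moreover have "inv g \<otimes> x \<otimes> g \<in> N" using x assms(2) by (intro N.inv_op_closed1)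
      ultimately show "x \<in> (\<lambda>x. g \<otimes> x \<otimes> inv g) ` N" by (rule image_eqI)
    qed
  qed
qed

text \<open>Let \<open>P\<close> be the partial product before a commutator \<open>[a, b]\<close>.
  Put \<open>a' = P^-1 \<alpha> P a\<close> and \<open>b' = a^-1 P^-1 \<beta> P a b\<close>. Then
  \<open>P [a', b']\<close> equals
  \<open>\<alpha> \<beta> \<theta>(\<alpha>)^-1 \<phi>(\<beta>)^-1\<close> times
  \<open>P [a, b]\<close>, with \<theta>, \<phi> conjugations by elements built from
  \<open>P\<close>, \<open>a\<close>, \<open>b\<close>. The perturbed tuple satisfies the relation
  exactly when these factors multiply to the inverse of the original relator.\<close>

theorem card_surface_homs_congruent:
  assumes N: "N \<lhd> G" "finite N"
    and ab: "\<And>k. k < h \<Longrightarrow> a k \<in> carrier G \<and> b k \<in> carrier G"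
    and gen: "\<And>T. \<lbrakk>subgroup T G; N \<subseteq> T; \<And>k. k < h \<Longrightarrow> a k \<in> T \<and> b k \<in> T\<rbrakk> \<Longrightarrow> carrier G \<subseteq> T"
    and prod: "surface_prod G h a b \<in> mixed_commutator G N (carrier G)"
  defines "C \<equiv> mixed_commutator G N (carrier G)"
  shows "real (card {(a', b'). (a', b') \<in> surface_homs G h \<and>
        (\<forall>k<h. a' k \<otimes> inv (a k) \<in> N \<and> b' k \<otimes> inv (b k) \<in> N)})
    \<ge> real (card N) ^ (2 * h) / real (card C) * (1 - (real (card C) - 1) / 2 ^ (2 * h))"
    (is "real (card ?L) \<ge> _")
proof -
  interpret N: normal N G by fact
  note [simp] = N.mem_carrier
  note C = mixed_commutator_conj[OF N(1), folded C_def]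
  define H where "H = G\<lparr>carrier := N\<rparr>"
  interpret H: group H unfolding H_def by (rule N.subgroup_is_group) (rule group_axioms)
  have H: "carrier H = N" "(\<otimes>\<^bsub>H\<^esub>) = (\<otimes>)" "\<one>\<^bsub>H\<^esub> = \<one>" by (simp_all add: H_def)
  have H_inv: "inv\<^bsub>H\<^esub> x = inv x" if "x \<in> N" for x
    unfolding H_def using m_inv_consistent[OF N.subgroup_axioms that] .
  define P where "P k = surface_prod G k a b" for k
  have P: "P k \<in> carrier G" if "k \<le> h" for k
    unfolding P_def using ab that by (intro surface_prod_closed) auto
  have P_Suc: "P (Suc k) = P k \<otimes> (a k \<otimes> b k \<otimes> inv (a k) \<otimes> inv (b k))" if "k < h" for k
    unfolding P_def using ab that by (intro surface_prod_Suc) auto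
  \<comment> \<open>\<open>u k\<close> and \<open>v k\<close> are what stands, in unperturbed
    letters, before the inverses of the two perturbations when the \<open>k\<close>-th commutator is
    perturbed as in \<open>A\<close>, \<open>B\<close> below.\<close>
  define u where "u k = P k \<otimes> (a k \<otimes> b k \<otimes> inv (a k)) \<otimes> inv (P k)" for k
  define v where "v k = P k \<otimes> (a k \<otimes> b k \<otimes> inv (a k) \<otimes> inv (b k) \<otimes> inv (a k)) \<otimes> inv (P k)" for k
  have uv: "u k \<in> carrier G" "v k \<in> carrier G" if "k < h" for k
    using ab[OF that] P[of k] that by (simp_all add: u_def v_def)
  define \<theta> where "\<theta> k x = u k \<otimes> x \<otimes> inv (u k)" for k x
  define \<phi> where "\<phi> k x = v k \<otimes> x \<otimes> inv (v k)" for k x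
  have conjN: "\<theta> k x \<in> N" "\<phi> k x \<in> N" if "k < h" "x \<in> N" for k x
    unfolding \<theta>_def \<phi>_def using uv that by (simp_all add: N.inv_op_closed2)
  have twist: "x \<otimes> inv (\<theta> k x) = x \<otimes> u k \<otimes> inv x \<otimes> inv (u k)"
    "x \<otimes> inv (\<phi> k x) = x \<otimes> v k \<otimes> inv x \<otimes> inv (v k)" if "k < h" "x \<in> N" for k x
    using uv[OF that(1)] that(2) by (simp_all add: \<theta>_def \<phi>_def m_assoc inv_mult_group)
  \<comment> \<open>The \<open>y\<close> that commute with \<open>N\<close> modulo \<open>T\<close>
    form a subgroup \<open>M\<close>. It contains \<open>N\<close> and all \<open>u k\<close>,
    \<open>v k\<close>; the conjugation by \<open>P k\<close> in these can be undone inductively,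
    which puts all \<open>a k\<close>, \<open>b k\<close> and so the whole group into
    \<open>M\<close>.\<close>
  have C_least: "C \<subseteq> T" if T: "subgroup T H"
      "\<And>x y. \<lbrakk>x \<in> N; y \<in> N\<rbrakk> \<Longrightarrow> x \<otimes> y \<otimes> inv x \<otimes> inv y \<in> T"
      "\<And>k x. \<lbrakk>k < h; x \<in> N\<rbrakk> \<Longrightarrow> x \<otimes> inv (\<theta> k x) \<in> T" "\<And>k x. \<lbrakk>k < h; x \<in> N\<rbrakk> \<Longrightarrow> x \<otimes> inv (\<phi> k x) \<in> T" for T
  proof -
    have TG: "subgroup T G" using incl_subgroup[OF N.subgroup_axioms] T(1) by (simp add: H_def)
    have TN: "T \<subseteq> N" using subgroup.subset[OF T(1)] by (simp add: H)
    define M where "M = {y \<in> carrier G. \<forall>x\<in>N. x \<otimes> y \<otimes> inv x \<otimes> inv y \<in> T}"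
    have M: "subgroup M G" unfolding M_def by (rule subgroup_trivially_acting[OF N(1) TG TN T(2)])
    have uvM: "u k \<in> M" "v k \<in> M" if "k < h" for k
      using T(3,4)[OF that] uv[OF that] unfolding M_def by (simp_all add: twist[OF that])
    have abM: "a k \<in> M \<and> b k \<in> M" if k: "k < h" and Pk: "P k \<in> M" for k
    proof -
      note cl = subgroup.m_closed[OF M] subgroup.m_inv_closed[OF M]
      note car = ab[OF k] P[of k]
      have "inv (P k) \<otimes> u k \<otimes> P k \<in> M" using uvM k Pk by (intro cl)
      then have c: "a k \<otimes> b k \<otimes> inv (a k) \<in> M" using car k by (simp add: u_def m_assoc)
      have "inv (P k) \<otimes> v k \<otimes> P k \<in> M" using uvM k Pk by (intro cl)
      then have d: "a k \<otimes> b k \<otimes> inv (a k) \<otimes> inv (b k) \<otimes> inv (a k) \<in> M" using car k by (simp add: v_def m_assoc)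
      \<comment> \<open>The quotient of the elements in \<open>c\<close> and \<open>d\<close> is the
        inverse of \<open>a k \<otimes> b k\<close>; together with \<open>c\<close> this yields
        \<open>a k\<close>, and then \<open>b k\<close>.\<close>
      have "inv (inv (a k \<otimes> b k \<otimes> inv (a k)) \<otimes> (a k \<otimes> b k \<otimes> inv (a k) \<otimes> inv (b k) \<otimes> inv (a k))) \<in> M"
        by (intro subgroup.m_inv_closed[OF M] subgroup.m_closed[OF M] c d)
      then have ab': "a k \<otimes> b k \<in> M" using car k by (simp add: m_assoc inv_mult_group)
      have "inv (a k \<otimes> b k \<otimes> inv (a k)) \<otimes> (a k \<otimes> b k) \<in> M"
        by (intro subgroup.m_inv_closed[OF M] subgroup.m_closed[OF M] c ab')
      then have aM: "a k \<in> M" using car k by (simp add: m_assoc inv_mult_group)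
      have "inv (a k) \<otimes> (a k \<otimes> b k) \<in> M"
        by (intro subgroup.m_inv_closed[OF M] subgroup.m_closed[OF M] aM ab')
      then show ?thesis using aM car k by simp
    qed
    have PM: "P k \<in> M" if "k \<le> h" for k
      using that
    proof (induction k)
      case 0
      then show ?case using subgroup.one_closed[OF M] by (simp add: P_def surface_prod_0)
    next
      case (Suc k)
      then show ?case using abM[of k] P_Suc[of k]
        by (simp add: subgroup.m_closed[OF M] subgroup.m_inv_closed[OF M])
    qed
    have "carrier G \<subseteq> M"
    proof (rule gen[OF M])
      show "N \<subseteq> M" using T(2) by (auto simp: M_def)
      show "a k \<in> M \<and> b k \<in> M" if "k < h" for k using abM PM that by simp
    qed
    then show "C \<subseteq> T"
      unfolding C_def mixed_commutator_def by (intro generate_subgroup_incl TG) (auto simp: M_def)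
  qed
  define sol where "sol = {t \<in> PiE {..<h} (\<lambda>_. carrier H \<times> carrier H).
      foldr (\<otimes>\<^bsub>H\<^esub>) (map (\<lambda>k. fst (t k) \<otimes>\<^bsub>H\<^esub> snd (t k) \<otimes>\<^bsub>H\<^esub> inv\<^bsub>H\<^esub> (\<theta> k (fst (t k))) \<otimes>\<^bsub>H\<^esub> inv\<^bsub>H\<^esub> (\<phi> k (snd (t k)))) [0..<h]) \<one>\<^bsub>H\<^esub> = inv (P h)}"
  have "real (card sol) \<ge> real (card (carrier H)) ^ (2 * h) / real (card C) * (1 - (real (card C) - 1) / 2 ^ (2 * h))"
    unfolding sol_def
  proof (rule H.card_twisted_commutator_solutions)
    show "finite (carrier H)" using N by (simp add: H)
    show "\<theta> k \<in> hom H H" "\<theta> k ` carrier H = carrier H" "\<phi> k \<in> hom H H" if "k < h" for k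
      unfolding H_def \<theta>_def \<phi>_def using conj_hom[OF N(1)] uv[OF that] by simp_all
    show "subgroup C H" unfolding H_def by (rule subgroup_incl[OF C(1) N.subgroup_axioms C(2)])
    show "x \<otimes>\<^bsub>H\<^esub> y \<otimes>\<^bsub>H\<^esub> inv\<^bsub>H\<^esub> x \<otimes>\<^bsub>H\<^esub> inv\<^bsub>H\<^esub> y \<in> C" if "x \<in> carrier H" "y \<in> carrier H" for x y
      using that C(3) by (simp add: H H_inv)
    show "x \<otimes>\<^bsub>H\<^esub> inv\<^bsub>H\<^esub> (\<theta> k x) \<in> C" "x \<otimes>\<^bsub>H\<^esub> inv\<^bsub>H\<^esub> (\<phi> k x) \<in> C" if "k < h" "x \<in> carrier H" for k x
      using that uv[OF that(1)] C(3) by (simp_all add: H H_inv conjN twist)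
    show "inv (P h) \<in> C" unfolding P_def using subgroup.m_inv_closed[OF C(1)] prod by (simp add: C_def)
    fix T assume T: "subgroup T H"
      "\<And>x y. \<lbrakk>x \<in> carrier H; y \<in> carrier H\<rbrakk> \<Longrightarrow> x \<otimes>\<^bsub>H\<^esub> y \<otimes>\<^bsub>H\<^esub> inv\<^bsub>H\<^esub> x \<otimes>\<^bsub>H\<^esub> inv\<^bsub>H\<^esub> y \<in> T"
      "\<And>k x. \<lbrakk>k < h; x \<in> carrier H\<rbrakk> \<Longrightarrow> x \<otimes>\<^bsub>H\<^esub> inv\<^bsub>H\<^esub> (\<theta> k x) \<in> T"
      "\<And>k x. \<lbrakk>k < h; x \<in> carrier H\<rbrakk> \<Longrightarrow> x \<otimes>\<^bsub>H\<^esub> inv\<^bsub>H\<^esub> (\<phi> k x) \<in> T"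
    show "C \<subseteq> T"
    proof (rule C_least[OF T(1)])
      show "x \<otimes> y \<otimes> inv x \<otimes> inv y \<in> T" if "x \<in> N" "y \<in> N" for x y
        using T(2)[of x y] that by (simp add: H H_inv)
      show "x \<otimes> inv (\<theta> k x) \<in> T" "x \<otimes> inv (\<phi> k x) \<in> T" if "k < h" "x \<in> N" for k x
        using T(3,4)[of k x] that by (simp_all add: H H_inv conjN)
    qed
  qed
  also have "card (carrier H) = card N" by (simp add: H)
  also have "real (card sol) \<le> real (card ?L)"
  proof -
    \<comment> \<open>Conjugating by \<open>P k\<close> and by \<open>P k \<otimes> a k\<close>
      respectively lets both perturbations appear unconjugated at the far left of the perturbed
      product.\<close>
    define A where "A t k = inv (P k) \<otimes> fst (t k) \<otimes> P k \<otimes> a k" for t :: "nat \<Rightarrow> 'a \<times> 'a" and k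
    define B where "B t k = inv (a k) \<otimes> inv (P k) \<otimes> snd (t k) \<otimes> P k \<otimes> a k \<otimes> b k" for t :: "nat \<Rightarrow> 'a \<times> 'a" and k
    define \<Psi> where "\<Psi> t = (restrict (A t) {..<h}, restrict (B t) {..<h})" for t
    have tN: "fst (t k) \<in> N" "snd (t k) \<in> N" if "t \<in> sol" "k < h" for t k
      using that by (auto simp: sol_def H PiE_iff mem_Times_iff)
    have AB: "A t k \<in> carrier G" "B t k \<in> carrier G" if "t \<in> sol" "k < h" for t k
      using tN[OF that] ab[OF that(2)] P[of k] that(2) by (simp_all add: A_def B_def)
    have "card sol \<le> card ?L"
    proof (rule card_inj_on_le[of \<Psi>])
      show "inj_on \<Psi> sol"
      proof (rule inj_onI)
        fix t s assume ts: "t \<in> sol" "s \<in> sol" "\<Psi> t = \<Psi> s"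
        show "t = s"
        proof (rule PiE_ext[of _ "{..<h}" "\<lambda>_. carrier H \<times> carrier H"])
          show "t \<in> PiE {..<h} (\<lambda>_. carrier H \<times> carrier H)" "s \<in> PiE {..<h} (\<lambda>_. carrier H \<times> carrier H)"
            using ts by (simp_all add: sol_def)
          fix k assume "k \<in> {..<h}"
          then have k: "k < h" by simp
          note car = ab[OF k] P[of k] tN[OF ts(1) k] tN[OF ts(2) k]
          have "fst (\<Psi> t) k = fst (\<Psi> s) k" "snd (\<Psi> t) k = snd (\<Psi> s) k" using ts(3) by simp_all
          then have "A t k = A s k" "B t k = B s k" using k by (simp_all add: \<Psi>_def)
          then have "fst (t k) = fst (s k)" "snd (t k) = snd (s k)"
            using car k by (simp_all add: A_def B_def m_assoc)
          then show "t k = s k" by (rule prod_eqI)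
        qed
      qed
      show "\<Psi> ` sol \<subseteq> ?L"
      proof (rule image_subsetI)
        fix t assume t: "t \<in> sol"
        define w where "w k = fst (t k) \<otimes> snd (t k) \<otimes> inv (\<theta> k (fst (t k))) \<otimes> inv (\<phi> k (snd (t k)))" for k
        have wN: "w k \<in> N" if "k < h" for k
          unfolding w_def using that tN[OF t that] conjN by auto
        have foldw: "foldr (\<otimes>) (map w [0..<k]) \<one> \<in> carrier G" if "k \<le> h" for k
          using that wN by (intro foldr_mult_closed) auto
        have step: "w k \<otimes> P (Suc k) = P k \<otimes> (A t k \<otimes> B t k \<otimes> inv (A t k) \<otimes> inv (B t k))" if k: "k < h" for k
          using ab[OF k] P[of k] tN[OF t k] k unfolding P_Suc[OF k] w_def \<theta>_def \<phi>_def u_def v_def A_def B_def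
          by (simp add: m_assoc inv_mult_group)
        \<comment> \<open>The twisting factors gather to the left of the unperturbed partial
          product, whatever the perturbations of the earlier letters were.\<close>
        have "surface_prod G k (fst (\<Psi> t)) (snd (\<Psi> t)) = foldr (\<otimes>) (map w [0..<k]) \<one> \<otimes> P k" if "k \<le> h" for k
          using that
        proof (induction k)
          case 0
          then show ?case by (simp add: surface_prod_0 P_def)
        next
          case (Suc k)
          then have k: "k < h" by simp
          have \<Psi>k: "fst (\<Psi> t) k = A t k" "snd (\<Psi> t) k = B t k" using k by (simp_all add: \<Psi>_def)
          have "surface_prod G (Suc k) (fst (\<Psi> t)) (snd (\<Psi> t)) =
              foldr (\<otimes>) (map w [0..<k]) \<one> \<otimes> P k \<otimes> (A t k \<otimes> B t k \<otimes> inv (A t k) \<otimes> inv (B t k))"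
          proof -
            have "fst (\<Psi> t) i \<in> carrier G \<and> snd (\<Psi> t) i \<in> carrier G" if "i < h" for i
              using AB[OF t that] that by (simp add: \<Psi>_def)
            moreover have "surface_prod G k (fst (\<Psi> t)) (snd (\<Psi> t)) = foldr (\<otimes>) (map w [0..<k]) \<one> \<otimes> P k"
              using Suc by simp
            ultimately show ?thesis using Suc.prems by (subst surface_prod_Suc) (auto simp: \<Psi>k)
          qed
          also have "\<dots> = foldr (\<otimes>) (map w [0..<k]) \<one> \<otimes> (w k \<otimes> P (Suc k))"
            using foldw[of k] P[of k] AB[OF t k] k by (simp add: step m_assoc)
          also have "\<dots> = foldr (\<otimes>) (map w [0..<Suc k]) \<one> \<otimes> P (Suc k)"
          proof -
            have "set (map w [0..<k]) \<subseteq> carrier G" "w k \<in> carrier G" using wN k by auto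
            then have "foldr (\<otimes>) (map w [0..<k] @ [w k]) \<one> = foldr (\<otimes>) (map w [0..<k]) \<one> \<otimes> w k"
              by (subst foldr_mult_append) auto
            then show ?thesis using foldw[of k] P[of "Suc k"] wN[OF k] k by (simp add: m_assoc)
          qed
          finally show ?case .
        qed
        from this[of h] have "surface_prod G h (fst (\<Psi> t)) (snd (\<Psi> t)) = foldr (\<otimes>) (map w [0..<h]) \<one> \<otimes> P h"
          by simp
        also have "foldr (\<otimes>) (map w [0..<h]) \<one> = inv (P h)"
        proof -
          have "map w [0..<h] = map (\<lambda>k. fst (t k) \<otimes>\<^bsub>H\<^esub> snd (t k) \<otimes>\<^bsub>H\<^esub> inv\<^bsub>H\<^esub> (\<theta> k (fst (t k))) \<otimes>\<^bsub>H\<^esub> inv\<^bsub>H\<^esub> (\<phi> k (snd (t k)))) [0..<h]"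
            by (intro map_cong) (auto simp: w_def H H_inv conjN tN[OF t])
          moreover have "foldr (\<otimes>\<^bsub>H\<^esub>) (map (\<lambda>k. fst (t k) \<otimes>\<^bsub>H\<^esub> snd (t k) \<otimes>\<^bsub>H\<^esub> inv\<^bsub>H\<^esub> (\<theta> k (fst (t k))) \<otimes>\<^bsub>H\<^esub> inv\<^bsub>H\<^esub> (\<phi> k (snd (t k)))) [0..<h]) \<one>\<^bsub>H\<^esub> = inv (P h)"
            using t unfolding sol_def by blast
          ultimately show ?thesis by (simp only: H(2,3))
        qed
        finally have "surface_prod G h (fst (\<Psi> t)) (snd (\<Psi> t)) = \<one>" using P[of h] by simp
        then have "surface_rel G h (fst (\<Psi> t)) (snd (\<Psi> t))" by (simp add: surface_rel_def surface_prod_def)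
        moreover have "A t k \<otimes> inv (a k) \<in> N" "B t k \<otimes> inv (b k) \<in> N" if k: "k < h" for k
        proof -
          note car = ab[OF k] P[of k] tN[OF t k]
          have "inv (P k) \<otimes> fst (t k) \<otimes> P k \<in> N" using car k by (intro N.inv_op_closed1) auto
          then show "A t k \<otimes> inv (a k) \<in> N" using car k by (simp add: A_def m_assoc)
          have "inv (P k \<otimes> a k) \<otimes> snd (t k) \<otimes> (P k \<otimes> a k) \<in> N" using car k by (intro N.inv_op_closed1) auto
          then show "B t k \<otimes> inv (b k) \<in> N" using car k by (simp add: B_def m_assoc inv_mult_group)
        qed
        ultimately show "\<Psi> t \<in> ?L" using AB[OF t] by (auto simp: \<Psi>_def surface_homs_def)
      qed
      \<comment> \<open>\<open>G\<close> may be infinite, but each entry of a tuple in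
        \<open>?L\<close> lies in a finite coset of \<open>N\<close>.\<close>
      define coset where "coset c = {x \<in> carrier G. x \<otimes> inv c \<in> N}" for c
      have fin_coset: "finite (coset c)" if "c \<in> carrier G" for c
      proof (rule finite_subset)
        show "coset c \<subseteq> (\<lambda>n. n \<otimes> c) ` N"
        proof
          fix x assume "x \<in> coset c"
          then show "x \<in> (\<lambda>n. n \<otimes> c) ` N"
            using that by (intro image_eqI[of _ _ "x \<otimes> inv c"]) (auto simp: coset_def m_assoc)
        qed
      qed (use N in simp)
      show "finite ?L"
      proof (rule finite_subset)
        show "?L \<subseteq> PiE {..<h} (\<lambda>k. coset (a k)) \<times> PiE {..<h} (\<lambda>k. coset (b k))"
          by (auto simp: surface_homs_def coset_def PiE_iff extensional_def)
        show "finite (PiE {..<h} (\<lambda>k. coset (a k)) \<times> PiE {..<h} (\<lambda>k. coset (b k)))"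
          using ab fin_coset by (intro finite_cartesian_product finite_PiE) auto
      qed
    qed
    then show ?thesis by simp
  qed
  finally show ?thesis .
qed

end

section \<open>Fundamental cycles\<close>

text \<open>The pairing of an integral chain \<open>c\<close> with a cochain \<open>f\<close> whose
  values lie in a multiplicatively written abelian group.\<close>

definition eval_chain :: "('c,'d) monoid_scheme \<Rightarrow> ('x \<Rightarrow> 'c) \<Rightarrow> ('x \<Rightarrow> int) \<Rightarrow> 'c" where
  "eval_chain A f c = finprod A (\<lambda>p. f p [^]\<^bsub>A\<^esub> c p) {p. c p \<noteq> 0}"

context comm_group
begin

context
  fixes f :: "'x \<Rightarrow> 'a"
  assumes f: "\<And>p. f p \<in> carrier G"
begin

lemma eval_chain_superset:
  assumes "finite B" "{p. c p \<noteq> 0} \<subseteq> B"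
  shows "eval_chain G f c = finprod G (\<lambda>p. f p [^] c p) B"
  unfolding eval_chain_def
  by (rule finprod_mono_neutral_cong_left[OF assms]) (use f in auto)

lemma eval_chain_closed: "eval_chain G f c \<in> carrier G"
  unfolding eval_chain_def using f by (intro finprod_closed) auto

lemma eval_chain_0: "eval_chain G f (\<lambda>_. 0) = \<one>"
  by (simp add: eval_chain_def)

lemma eval_chain_ind: "eval_chain G f (\<lambda>p. ind p u) = f u"
  using f by (subst eval_chain_superset[of "{u}"]) (auto simp: ind_def split: if_splits)

lemma eval_chain_add:
  assumes "finite {p. c p \<noteq> 0}" "finite {p. d p \<noteq> 0}"
  shows "eval_chain G f (\<lambda>p. c p + d p) = eval_chain G f c \<otimes> eval_chain G f d"
proof -
  let ?B = "{p. c p \<noteq> 0} \<union> {p. d p \<noteq> 0}"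
  have "finite ?B" using assms by simp
  then have eq: "eval_chain G f e = finprod G (\<lambda>p. f p [^] e p) ?B" if "{p. e p \<noteq> 0} \<subseteq> ?B" for e
    using that by (rule eval_chain_superset)
  have "eval_chain G f (\<lambda>p. c p + d p) = finprod G (\<lambda>p. f p [^] (c p + d p)) ?B"
    by (rule eq) auto
  also have "\<dots> = finprod G (\<lambda>p. f p [^] c p \<otimes> f p [^] d p) ?B"
    using f by (intro finprod_cong') (auto simp: int_pow_mult)
  also have "\<dots> = eval_chain G f c \<otimes> eval_chain G f d"
    using f eq[of c] eq[of d] by (subst finprod_multf) auto
  finally show ?thesis .
qed

lemma eval_chain_scale:
  assumes "finite {p. c p \<noteq> 0}"
  shows "eval_chain G f (\<lambda>p. n * c p) = eval_chain G f c [^] n"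
proof -
  have "finprod G (\<lambda>p. f p [^] (n * c p)) B = finprod G (\<lambda>p. f p [^] c p) B [^] n" if "finite B" for B
    using that
  proof (induction B)
    case (insert p B)
    then show ?case using f by (simp add: int_pow_distrib int_pow_pow mult.commute)
  qed simp
  then show ?thesis using assms
    by (subst (1 2) eval_chain_superset[of "{p. c p \<noteq> 0}"]) auto
qed

lemma eval_chain_minus:
  assumes "finite {p. c p \<noteq> 0}"
  shows "eval_chain G f (\<lambda>p. - c p) = inv (eval_chain G f c)"
  using eval_chain_scale[OF assms, of "-1"] eval_chain_closed by (simp add: int_pow_neg)

lemma eval_chain_diff:
  assumes "finite {p. c p \<noteq> 0}" "finite {p. d p \<noteq> 0}"
  shows "eval_chain G f (\<lambda>p. c p - d p) = eval_chain G f c \<otimes> inv (eval_chain G f d)"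
  using eval_chain_add[of c "\<lambda>p. - d p"] eval_chain_minus[OF assms(2)] assms by simp

lemma eval_chain_sum:
  assumes "finite I" "\<And>i. i \<in> I \<Longrightarrow> finite {p. c i p \<noteq> 0}"
  shows "eval_chain G f (\<lambda>p. \<Sum>i\<in>I. n i * c i p) = finprod G (\<lambda>i. eval_chain G f (c i) [^] (n i :: int)) I"
  using assms
proof (induction I)
  case (insert i I)
  have "finite {p. (\<Sum>i\<in>I. n i * c i p) \<noteq> 0}"
  proof (rule finite_subset)
    show "{p. (\<Sum>i\<in>I. n i * c i p) \<noteq> 0} \<subseteq> (\<Union>i\<in>I. {p. c i p \<noteq> 0})"
      by (auto elim!: sum.not_neutral_contains_not_neutral)
  qed (use insert in auto)
  moreover have "finite {p. n i * c i p \<noteq> 0}"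
    by (rule finite_subset[of _ "{p. c i p \<noteq> 0}"]) (use insert in auto)
  ultimately show ?case using insert eval_chain_closed
    by (simp add: eval_chain_add eval_chain_scale)
qed (simp add: eval_chain_0)

end

end

lemma finite_ind_support [simp]: "finite {p. ind p u \<noteq> 0}"
  by (rule finite_subset[of _ "{u}"]) (auto simp: ind_def split: if_splits)

lemma chains2_0: "(\<lambda>_. 0) \<in> chains2 G"
  by (simp add: chains2_def)
lemma chains2_ind: "x \<in> carrier G \<Longrightarrow> y \<in> carrier G \<Longrightarrow> (\<lambda>w. ind w (x, y)) \<in> chains2 G"
  by (auto simp: chains2_def ind_def split: if_splits)
lemma chains2_add: assumes "c \<in> chains2 G" "d \<in> chains2 G" shows "(\<lambda>w. c w + d w) \<in> chains2 G"
proof -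
  have "{w. c w + d w \<noteq> 0} \<subseteq> {w. c w \<noteq> 0} \<union> {w. d w \<noteq> 0}" by auto
  then show ?thesis using assms unfolding chains2_def by (auto intro: finite_subset)
qed
lemma chains2_scale: assumes "c \<in> chains2 G" shows "(\<lambda>w. n * c w) \<in> chains2 G"
proof -
  have "{w. n * c w \<noteq> 0} \<subseteq> {w. c w \<noteq> 0}" by auto
  then show ?thesis using assms unfolding chains2_def by (auto intro: finite_subset)
qed
lemma chains2_diff: "c \<in> chains2 G \<Longrightarrow> d \<in> chains2 G \<Longrightarrow> (\<lambda>w. c w - d w) \<in> chains2 G"
  using chains2_add[OF _ chains2_scale[of d G "-1"], of c] by simp
lemma chains2_sum: "(\<And>i. i \<in> I \<Longrightarrow> c i \<in> chains2 G) \<Longrightarrow> (\<lambda>w. \<Sum>i\<in>I. c i w) \<in> chains2 G"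
  by (induction I rule: infinite_finite_induct) (auto simp: chains2_0 chains2_add)
lemma chains2_finite: "c \<in> chains2 G \<Longrightarrow> finite {w. c w \<noteq> 0}"
  by (simp add: chains2_def)

lemma (in group) chains2_word_chain:
  "p \<in> carrier G \<Longrightarrow> set xs \<subseteq> carrier G \<Longrightarrow> word_chain G p xs \<in> chains2 G"
  by (induction xs arbitrary: p) (auto intro!: chains2_0 chains2_add chains2_ind)

text \<open>Split off from \<open>fund_cycle\<close> because a factor set takes on it the value that
  compares \<open>\<sigma> (inv x)\<close> with \<open>inv (\<sigma> x)\<close> over all
  generators.\<close>

definition edge_chain :: "('a,'m) monoid_scheme \<Rightarrow> nat \<Rightarrow> (nat \<Rightarrow> 'a) \<Rightarrow> (nat \<Rightarrow> 'a) \<Rightarrow> 'a \<times> 'a \<Rightarrow> int" where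
  "edge_chain G h a b = (\<lambda>w. \<Sum>i<h. ind w (a i, inv\<^bsub>G\<^esub> (a i)) + ind w (b i, inv\<^bsub>G\<^esub> (b i)))"

lemma fund_cycle_eq:
  "fund_cycle G h a b = (\<lambda>w. word_chain G \<one>\<^bsub>G\<^esub> (surface_word G h a b) w - edge_chain G h a b w
     - 2 * int h * ind w (\<one>\<^bsub>G\<^esub>, \<one>\<^bsub>G\<^esub>))"
  by (simp add: fund_cycle_def edge_chain_def)

context group
begin

context
  fixes h :: nat and a b :: "nat \<Rightarrow> 'a"
  assumes ab: "\<And>i. i < h \<Longrightarrow> a i \<in> carrier G \<and> b i \<in> carrier G"
begin

lemma chains2_edge_chain: "edge_chain G h a b \<in> chains2 G"
  unfolding edge_chain_def using ab by (intro chains2_sum chains2_add chains2_ind) auto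

lemma chains2_surface_word: "word_chain G \<one> (surface_word G h a b) \<in> chains2 G"
  using ab by (intro chains2_word_chain set_surface_word) auto

lemma chains2_fund_cycle: "fund_cycle G h a b \<in> chains2 G"
  unfolding fund_cycle_eq
  by (intro chains2_diff chains2_scale chains2_edge_chain chains2_surface_word chains2_ind) auto

end

end

text \<open>The integer-valued counterpart of \<open>eval_chain\<close>. A boundary or a
  push-forward, evaluated at one point, has this form.\<close>

definition lin_chain :: "('x \<Rightarrow> int) \<Rightarrow> ('x \<Rightarrow> int) \<Rightarrow> int" where
  "lin_chain f c = (\<Sum>p\<in>{p. c p \<noteq> 0}. c p * f p)"

lemma lin_chain_superset:
  "finite B \<Longrightarrow> {p. c p \<noteq> 0} \<subseteq> B \<Longrightarrow> lin_chain f c = (\<Sum>p\<in>B. c p * f p)"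
  unfolding lin_chain_def by (rule sum.mono_neutral_left) auto
lemma lin_chain_0 [simp]: "lin_chain f (\<lambda>_. 0) = 0" by (simp add: lin_chain_def)
lemma lin_chain_ind [simp]: "lin_chain f (\<lambda>p. ind p u) = f u"
  by (subst lin_chain_superset[of "{u}"]) (auto simp: ind_def split: if_splits)
lemma lin_chain_add:
  assumes "finite {p. c p \<noteq> 0}" "finite {p. d p \<noteq> 0}"
  shows "lin_chain f (\<lambda>p. c p + d p) = lin_chain f c + lin_chain f d"
proof -
  let ?B = "{p. c p \<noteq> 0} \<union> {p. d p \<noteq> 0}"
  have "finite ?B" using assms by simp
  then have eq: "lin_chain f e = (\<Sum>p\<in>?B. e p * f p)" if "{p. e p \<noteq> 0} \<subseteq> ?B" for e
    using that by (rule lin_chain_superset)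
  have "lin_chain f (\<lambda>p. c p + d p) = (\<Sum>p\<in>?B. (c p + d p) * f p)" by (rule eq) auto
  also have "\<dots> = lin_chain f c + lin_chain f d"
    using eq[of c] eq[of d] by (simp add: ring_distribs sum.distrib)
  finally show ?thesis .
qed
lemma lin_chain_scale:
  assumes "finite {p. c p \<noteq> 0}" shows "lin_chain f (\<lambda>p. n * c p) = n * lin_chain f c"
  using assms by (subst (1 2) lin_chain_superset[of "{p. c p \<noteq> 0}"]) (auto simp: sum_distrib_left mult.assoc)
lemma lin_chain_diff:
  assumes "finite {p. c p \<noteq> 0}" "finite {p. d p \<noteq> 0}"
  shows "lin_chain f (\<lambda>p. c p - d p) = lin_chain f c - lin_chain f d"
  using lin_chain_add[of c "\<lambda>p. - 1 * d p" f] lin_chain_scale[OF assms(2), of f "-1"] assms by simp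
lemma lin_chain_sum:
  assumes "\<And>i. i \<in> I \<Longrightarrow> c i \<in> chains2 G"
  shows "lin_chain f (\<lambda>p. \<Sum>i\<in>I. c i p) = (\<Sum>i\<in>I. lin_chain f (c i))"
  using assms
proof (induction I rule: infinite_finite_induct)
  case (insert i I)
  then have "(\<lambda>p. \<Sum>i\<in>I. c i p) \<in> chains2 G" by (intro chains2_sum) auto
  then have "finite {p. (\<Sum>i\<in>I. c i p) \<noteq> 0}" "finite {p. c i p \<noteq> 0}"
    using insert.prems[of i] chains2_finite by auto
  with insert show ?case by (simp add: lin_chain_add)
qed simp_all

lemma bar_d2_lin: "bar_d2 G c z = lin_chain (\<lambda>p. ind z (snd p) - ind z (fst p \<otimes>\<^bsub>G\<^esub> snd p) + ind z (fst p)) c"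
  by (simp add: bar_d2_def lin_chain_def)

lemma push2_lin: assumes "finite {p. c p \<noteq> 0}" shows "push2 f c w = lin_chain (\<lambda>p. ind w (f (fst p), f (snd p))) c"
proof -
  have "lin_chain (\<lambda>p. ind w (f (fst p), f (snd p))) c = (\<Sum>p\<in>{p. c p \<noteq> 0}. if f (fst p) = fst w \<and> f (snd p) = snd w then c p else 0)"
    unfolding lin_chain_def by (intro sum.cong) (auto simp: ind_def prod_eq_iff)
  also have "\<dots> = (\<Sum>p\<in>{p \<in> {p. c p \<noteq> 0}. f (fst p) = fst w \<and> f (snd p) = snd w}. c p)"
    by (rule sum.inter_filter[symmetric]) (rule assms)
  finally show ?thesis by (simp add: push2_def case_prod_unfold)
qed

context group
begin

lemma lin_chain_fund_cycle:
  assumes ab: "\<And>i. i < h \<Longrightarrow> a i \<in> carrier G \<and> b i \<in> carrier G"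
  shows "lin_chain f (fund_cycle G h a b) = lin_chain f (word_chain G \<one> (surface_word G h a b))
    - (\<Sum>i<h. f (a i, inv (a i)) + f (b i, inv (b i))) - 2 * int h * f (\<one>, \<one>)"
proof -
  have fin: "finite {w. edge_chain G h a b w \<noteq> 0}" "finite {w. word_chain G \<one> (surface_word G h a b) w \<noteq> 0}"
    "finite {w. word_chain G \<one> (surface_word G h a b) w - edge_chain G h a b w \<noteq> 0}"
    "finite {w. 2 * int h * ind w (\<one>, \<one>) \<noteq> 0}"
  proof -
    have c: "edge_chain G h a b \<in> chains2 G" "word_chain G \<one> (surface_word G h a b) \<in> chains2 G"
      "(\<lambda>w. ind w (\<one>, \<one>)) \<in> chains2 G"
      using ab by (intro chains2_edge_chain chains2_surface_word chains2_ind; simp)+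
    show "finite {w. edge_chain G h a b w \<noteq> 0}" "finite {w. word_chain G \<one> (surface_word G h a b) w \<noteq> 0}"
      using c(1,2)[THEN chains2_finite] .
    show "finite {w. word_chain G \<one> (surface_word G h a b) w - edge_chain G h a b w \<noteq> 0}"
      using chains2_diff[OF c(2,1)] by (rule chains2_finite)
    show "finite {w. 2 * int h * ind w (\<one>, \<one>) \<noteq> 0}"
      using chains2_scale[OF c(3)] by (rule chains2_finite)
  qed
  have "lin_chain f (edge_chain G h a b) = (\<Sum>i<h. f (a i, inv (a i)) + f (b i, inv (b i)))"
    unfolding edge_chain_def using ab
    by (subst lin_chain_sum[where G = G]) (auto intro!: chains2_add chains2_ind sum.cong simp: lin_chain_add)
  then show ?thesis unfolding fund_cycle_eq using fin by (simp add: lin_chain_diff lin_chain_scale)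
qed

text \<open>The boundary of the fan telescopes: its inner edges cancel, leaving the letters, the
  initial prefix and the final product.\<close>

lemma lin_chain_word_chain_boundary:
  assumes "p \<in> carrier G" "set xs \<subseteq> carrier G"
  shows "bar_d2 G (word_chain G p xs) z = (\<Sum>x\<leftarrow>xs. ind z x) + ind z p - ind z (p \<otimes> foldr (\<otimes>) xs \<one>)"
  using assms
proof (induction xs arbitrary: p)
  case (Cons x xs)
  have "finite {w. word_chain G (p \<otimes> x) xs w \<noteq> 0}"
    using Cons.prems by (intro chains2_finite[where G = G] chains2_word_chain) auto
  then have "bar_d2 G (word_chain G p (x # xs)) z = ind z x - ind z (p \<otimes> x) + ind z p + bar_d2 G (word_chain G (p \<otimes> x) xs) z"
    unfolding bar_d2_lin by (simp add: lin_chain_add)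
  also have "bar_d2 G (word_chain G (p \<otimes> x) xs) z = (\<Sum>x\<leftarrow>xs. ind z x) + ind z (p \<otimes> x) - ind z (p \<otimes> x \<otimes> foldr (\<otimes>) xs \<one>)"
    using Cons by (intro Cons.IH) auto
  finally show ?case using Cons.prems by (simp add: m_assoc foldr_mult_closed)
qed (simp add: bar_d2_lin)

lemma sum_surface_word:
  "(\<Sum>x\<leftarrow>surface_word G h a b. f x :: int) = (\<Sum>i<h. f (a i) + f (b i) + f (inv (a i)) + f (inv (b i)))"
  by (induction h) (simp_all add: surface_word_def)

text \<open>The relation closes the fan, leaving the letters. Each of the \<open>2 * h\<close> edge
  corrections removes a pair \<open>x\<close>, \<open>inv x\<close> and leaves one copy of the unit;
  since the boundary of \<open>[1|1]\<close> is the unit, its multiple removes these copies.\<close>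

lemma fund_cycle_cycle:
  assumes "(a, b) \<in> surface_homs G h"
  shows "fund_cycle G h a b \<in> cycles2 G"
proof -
  have ab: "a i \<in> carrier G \<and> b i \<in> carrier G" if "i < h" for i
    using assms that by (auto simp: surface_homs_def)
  have rel: "foldr (\<otimes>) (surface_word G h a b) \<one> = \<one>"
    using assms by (auto simp: surface_homs_def surface_rel_def)
  have "bar_d2 G (fund_cycle G h a b) z = 0" for z
  proof -
    have "bar_d2 G (word_chain G \<one> (surface_word G h a b)) z =
        (\<Sum>i<h. ind z (a i) + ind z (b i) + ind z (inv (a i)) + ind z (inv (b i)))"
      using rel set_surface_word[of h a b] ab by (simp add: lin_chain_word_chain_boundary sum_surface_word)
    then have "bar_d2 G (fund_cycle G h a b) z =
        (\<Sum>i<h. ind z (a i) + ind z (b i) + ind z (inv (a i)) + ind z (inv (b i)))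
        - (\<Sum>i<h. (ind z (inv (a i)) - ind z \<one> + ind z (a i)) + (ind z (inv (b i)) - ind z \<one> + ind z (b i)))
        - 2 * int h * ind z \<one>"
      unfolding bar_d2_lin using ab by (subst lin_chain_fund_cycle) auto
    also have "\<dots> = 0" by (simp add: sum.distrib sum_subtractf algebra_simps)
    finally show ?thesis .
  qed
  then show ?thesis using chains2_fund_cycle[OF ab] by (auto simp: cycles2_def)
qed

end

lemma push2_fund_cycle:
  assumes "group G" "group G'" and q: "q \<in> hom G' G"
    and ab: "\<And>i. i < h \<Longrightarrow> a' i \<in> carrier G' \<and> b' i \<in> carrier G'"
    and lift: "\<And>i. i < h \<Longrightarrow> q (a' i) = a i \<and> q (b' i) = b i"
  shows "push2 q (fund_cycle G' h a' b') = fund_cycle G h a b"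
proof
  interpret G: group G by fact
  interpret G': group G' by fact
  interpret q: group_hom G' G q by unfold_locales (rule q)
  fix w
  have word: "lin_chain (\<lambda>p. ind w (q (fst p), q (snd p))) (word_chain G' p xs) = word_chain G (q p) (map q xs) w"
    if "p \<in> carrier G'" "set xs \<subseteq> carrier G'" for p xs
    using that
  proof (induction xs arbitrary: p)
    case (Cons x xs)
    have "finite {w. word_chain G' (p \<otimes>\<^bsub>G'\<^esub> x) xs w \<noteq> 0}"
      using Cons.prems by (intro chains2_finite[where G = G'] G'.chains2_word_chain) auto
    then show ?case using Cons by (simp add: lin_chain_add)
  qed simp
  have "map q (surface_word G' h a' b') = surface_word G h a b"
    using ab lift by (auto simp: surface_word_def map_concat intro!: arg_cong[of _ _ concat] map_cong)
  then have "lin_chain (\<lambda>p. ind w (q (fst p), q (snd p))) (word_chain G' \<one>\<^bsub>G'\<^esub> (surface_word G' h a' b')) =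
      word_chain G \<one>\<^bsub>G\<^esub> (surface_word G h a b) w"
    using ab by (subst word) (auto intro!: G'.set_surface_word)
  moreover have "push2 q (fund_cycle G' h a' b') w = lin_chain (\<lambda>p. ind w (q (fst p), q (snd p))) (fund_cycle G' h a' b')"
  proof (rule push2_lin, rule chains2_finite)
    show "fund_cycle G' h a' b' \<in> chains2 G'" by (rule G'.chains2_fund_cycle) (rule ab)
  qed
  moreover have "lin_chain (\<lambda>p. ind w (q (fst p), q (snd p))) (fund_cycle G' h a' b') =
      lin_chain (\<lambda>p. ind w (q (fst p), q (snd p))) (word_chain G' \<one>\<^bsub>G'\<^esub> (surface_word G' h a' b'))
      - (\<Sum>i<h. ind w (a i, inv\<^bsub>G\<^esub> (a i)) + ind w (b i, inv\<^bsub>G\<^esub> (b i))) - 2 * int h * ind w (\<one>\<^bsub>G\<^esub>, \<one>\<^bsub>G\<^esub>)"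
    using ab lift by (subst G'.lin_chain_fund_cycle) auto
  ultimately show "push2 q (fund_cycle G' h a' b') w = fund_cycle G h a b w"
    by (simp add: fund_cycle_def)
qed

text \<open>The fundamental cycle of the lift maps to that of \<open>(a, b)\<close> already as a
  chain, so the zero boundary suffices.\<close>

lemma in_image_H2_of_lift:
  assumes "group G" "group G'" and q: "q \<in> hom G' G" and lift: "(a', b') \<in> lifts G' q h a b"
  shows "in_image_H2 G' G q (fund_cycle G h a b)"
  unfolding in_image_H2_def
proof (rule bexI)
  have ab: "(a', b') \<in> surface_homs G' h" and eq: "\<And>i. i < h \<Longrightarrow> q (a' i) = a i \<and> q (b' i) = b i"
    using lift by (auto simp: lifts_def)
  then show "fund_cycle G' h a' b' \<in> cycles2 G'" by (intro group.fund_cycle_cycle assms)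
  have "push2 q (fund_cycle G' h a' b') = fund_cycle G h a b"
    using ab eq by (intro push2_fund_cycle assms) (auto simp: surface_homs_def)
  moreover have "(\<lambda>_. 0) \<in> boundaries2 G"
    unfolding boundaries2_def by (rule image_eqI[of _ _ "\<lambda>_. 0"]) (auto simp: bar_d3_def chains3_def)
  ultimately show "(\<lambda>p. push2 q (fund_cycle G' h a' b') p - fund_cycle G h a b p) \<in> boundaries2 G" by simp
qed

section \<open>The obstruction class\<close>

lemma (in comm_group) mult_inv_mult_cancel:
  assumes "x \<in> carrier G" "y \<in> carrier G" "z \<in> carrier G"
  shows "y \<otimes> inv (x \<otimes> y \<otimes> z) \<otimes> x = inv z"
proof -
  have "y \<otimes> inv (x \<otimes> y \<otimes> z) \<otimes> x = y \<otimes> inv z \<otimes> inv y"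
    using assms by (simp add: inv_mult_group m_assoc)
  also have "\<dots> = inv z \<otimes> y \<otimes> inv y" using assms by (simp add: m_comm)
  finally show ?thesis using assms by (simp add: m_assoc)
qed

text \<open>A section \<open>\<sigma>\<close> of a central extension with \<open>\<sigma> 1 = 1\<close> determines the
  factor set \<open>\<sigma> x \<sigma> y (\<sigma> (x y))\<^sup>-\<^sup>1\<close>, a 2-cocycle. Its value on \<open>g\<^sub>*[W]\<close> is the product of the commutators
  \<open>[\<sigma> a\<^sub>i, \<sigma> b\<^sub>i]\<close>, and its pullback to \<open>G'\<close> is the coboundary of \<open>x \<mapsto> \<pi> x (\<sigma> (q x))\<^sup>-\<^sup>1\<close>.\<close>
locale central_section =
  G: group G + G': group G' + Q: group Q
  for G :: "('a,'m) monoid_scheme" and G' :: "('b,'n) monoid_scheme" and Q :: "('c,'k) monoid_scheme" (structure) +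
  fixes q :: "'b \<Rightarrow> 'a" and \<pi> :: "'b \<Rightarrow> 'c" and \<sigma> :: "'a \<Rightarrow> 'c" and A :: "'c set"
  assumes q: "q \<in> hom G' G" and \<pi>: "\<pi> \<in> hom G' Q"
    and \<sigma>: "x \<in> carrier G \<Longrightarrow> \<sigma> x \<in> carrier Q" and \<sigma>_one: "\<sigma> \<one>\<^bsub>G\<^esub> = \<one>"
    and A: "subgroup A Q"
    and A_central: "z \<in> A \<Longrightarrow> u \<in> carrier Q \<Longrightarrow> z \<otimes> u = u \<otimes> z"
    and factor: "x \<in> carrier G \<Longrightarrow> y \<in> carrier G \<Longrightarrow>
      \<sigma> x \<otimes> \<sigma> y \<otimes> inv (\<sigma> (x \<otimes>\<^bsub>G\<^esub> y)) \<in> A"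
    and defect: "v \<in> carrier G' \<Longrightarrow> \<pi> v \<otimes> inv (\<sigma> (q v)) \<in> A"
begin

text \<open>The coefficient group for evaluating chains; \<open>Q\<close> itself is in general not
  commutative.\<close>

definition AG where "AG = Q\<lparr>carrier := A\<rparr>"

lemma AG_simps: "carrier AG = A" "(\<otimes>\<^bsub>AG\<^esub>) = (\<otimes>)" "\<one>\<^bsub>AG\<^esub> = \<one>"
  by (simp_all add: AG_def)

lemma A_carrier [simp]: "z \<in> A \<Longrightarrow> z \<in> carrier Q" by (rule subgroup.mem_carrier[OF A])

sublocale AG: comm_group AG
proof -
  have "group AG" unfolding AG_def by (rule subgroup.subgroup_is_group[OF A Q.group_axioms])
  then show "comm_group AG" by (rule group.group_comm_groupI) (simp add: AG_simps A_central)
qed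

text \<open>Here and in \<tau> the value \<open>\<one>\<close> outside the carriers makes the
  function total with values in \<open>A\<close>, as the lemmas on \<open>eval_chain\<close>
  require.\<close>

definition \<kappa> where "\<kappa> p = (if fst p \<in> carrier G \<and> snd p \<in> carrier G
  then \<sigma> (fst p) \<otimes> \<sigma> (snd p) \<otimes> inv (\<sigma> (fst p \<otimes>\<^bsub>G\<^esub> snd p)) else \<one>)"

definition \<tau> where "\<tau> x = (if x \<in> carrier G' then \<pi> x \<otimes> inv (\<sigma> (q x)) else \<one>)"

lemma \<kappa>_A: "\<kappa> p \<in> A"
  using factor subgroup.one_closed[OF A] by (simp add: \<kappa>_def)
lemma \<tau>_A: "\<tau> x \<in> A"
  using defect subgroup.one_closed[OF A] by (simp add: \<tau>_def)
lemma \<kappa>_closed: "\<kappa> p \<in> carrier AG" and \<tau>_closed: "\<tau> x \<in> carrier AG"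
  by (simp_all add: AG_simps \<kappa>_A \<tau>_A)

lemma \<sigma>_mult:
  assumes "x \<in> carrier G" "y \<in> carrier G"
  shows "\<sigma> x \<otimes> \<sigma> y = \<kappa> (x, y) \<otimes> \<sigma> (x \<otimes>\<^bsub>G\<^esub> y)"
  using assms by (simp add: \<kappa>_def \<sigma> Q.m_assoc)

lemma \<pi>_eq:
  assumes "x \<in> carrier G'" shows "\<pi> x = \<tau> x \<otimes> \<sigma> (q x)"
  using assms hom_in_carrier[OF \<pi> assms] hom_in_carrier[OF q assms] by (simp add: \<tau>_def \<sigma> Q.m_assoc)

text \<open>Both sides arise from
  \<open>\<sigma> x \<otimes> \<sigma> y \<otimes> \<sigma> z\<close>, multiplied out in the two
  possible orders; centrality moves \<open>\<kappa> (y, z)\<close> past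
  \<open>\<sigma> x\<close>.\<close>

lemma cocycle:
  assumes "x \<in> carrier G" "y \<in> carrier G" "z \<in> carrier G"
  shows "\<kappa> (x, y) \<otimes> \<kappa> (x \<otimes>\<^bsub>G\<^esub> y, z) = \<kappa> (y, z) \<otimes> \<kappa> (x, y \<otimes>\<^bsub>G\<^esub> z)"
proof -
  note [simp] = assms \<sigma> \<kappa>_A A_carrier
  have "\<kappa> (x, y) \<otimes> \<kappa> (x \<otimes>\<^bsub>G\<^esub> y, z) \<otimes> \<sigma> (x \<otimes>\<^bsub>G\<^esub> y \<otimes>\<^bsub>G\<^esub> z)
      = \<kappa> (x, y) \<otimes> (\<sigma> (x \<otimes>\<^bsub>G\<^esub> y) \<otimes> \<sigma> z)"
    by (simp add: Q.m_assoc \<sigma>_mult[of "x \<otimes>\<^bsub>G\<^esub> y" z])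
  also have "\<dots> = (\<kappa> (x, y) \<otimes> \<sigma> (x \<otimes>\<^bsub>G\<^esub> y)) \<otimes> \<sigma> z" by (simp add: Q.m_assoc)
  also have "\<dots> = \<sigma> x \<otimes> \<sigma> y \<otimes> \<sigma> z" by (simp add: \<sigma>_mult[of x y])
  also have "\<dots> = \<sigma> x \<otimes> (\<kappa> (y, z) \<otimes> \<sigma> (y \<otimes>\<^bsub>G\<^esub> z))"
    by (simp add: Q.m_assoc \<sigma>_mult[of y z, symmetric])
  also have "\<dots> = \<kappa> (y, z) \<otimes> (\<sigma> x \<otimes> \<sigma> (y \<otimes>\<^bsub>G\<^esub> z))"
    using A_central[OF \<kappa>_A[of "(y, z)"] \<sigma>[of x]] by (simp flip: Q.m_assoc)
  also have "\<dots> = \<kappa> (y, z) \<otimes> \<kappa> (x, y \<otimes>\<^bsub>G\<^esub> z) \<otimes> \<sigma> (x \<otimes>\<^bsub>G\<^esub> y \<otimes>\<^bsub>G\<^esub> z)"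
    by (simp add: \<sigma>_mult Q.m_assoc G.m_assoc)
  finally show ?thesis by simp
qed

lemma pullback:
  assumes "x \<in> carrier G'" "y \<in> carrier G'"
  shows "\<tau> (x \<otimes>\<^bsub>G'\<^esub> y) = \<tau> x \<otimes> \<tau> y \<otimes> \<kappa> (q x, q y)"
proof -
  note qc = hom_in_carrier[OF q]
  note [simp] = assms qc \<sigma> \<kappa>_A \<tau>_A A_carrier
  have "\<tau> (x \<otimes>\<^bsub>G'\<^esub> y) \<otimes> \<sigma> (q x \<otimes>\<^bsub>G\<^esub> q y) = \<pi> x \<otimes> \<pi> y"
    using \<pi>_eq[of "x \<otimes>\<^bsub>G'\<^esub> y"] hom_mult[OF \<pi>, of x y] hom_mult[OF q, of x y] by simp
  also have "\<dots> = \<tau> x \<otimes> (\<sigma> (q x) \<otimes> \<tau> y) \<otimes> \<sigma> (q y)"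
    by (simp add: \<pi>_eq Q.m_assoc)
  also have "\<sigma> (q x) \<otimes> \<tau> y = \<tau> y \<otimes> \<sigma> (q x)" by (rule A_central[symmetric]) simp_all
  also have "\<tau> x \<otimes> (\<tau> y \<otimes> \<sigma> (q x)) \<otimes> \<sigma> (q y) = \<tau> x \<otimes> \<tau> y \<otimes> \<kappa> (q x, q y) \<otimes> \<sigma> (q x \<otimes>\<^bsub>G\<^esub> q y)"
    by (simp add: Q.m_assoc \<sigma>_mult)
  finally show ?thesis by simp
qed

text \<open>The cocycle identity says that the boundary of each generating 3-chain evaluates to the
  unit.\<close>

lemma eval_boundary:
  assumes "c \<in> boundaries2 G" shows "eval_chain AG \<kappa> c = \<one>"
proof -
  obtain d where d: "d \<in> chains3 G" "c = bar_d3 G d" using assms by (auto simp: boundaries2_def)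
  define e where "e p = (case p of (x, y, z) \<Rightarrow> (\<lambda>w. ind w (y, z) - ind w (x \<otimes>\<^bsub>G\<^esub> y, z) + ind w (x, y \<otimes>\<^bsub>G\<^esub> z) - ind w (x, y)))"
    for p
  have c: "c = (\<lambda>w. \<Sum>p\<in>{p. d p \<noteq> 0}. d p * e p w)"
    by (simp add: d bar_d3_def e_def case_prod_unfold)
  have fin_e: "finite {w. e p w \<noteq> 0}" for p
  proof (cases p)
    case (fields x y z)
    have "e p w = 0" if "w \<notin> {(y, z), (x \<otimes>\<^bsub>G\<^esub> y, z), (x, y \<otimes>\<^bsub>G\<^esub> z), (x, y)}" for w
      using that by (auto simp: e_def fields ind_def)
    then have "{w. e p w \<noteq> 0} \<subseteq> {(y, z), (x \<otimes>\<^bsub>G\<^esub> y, z), (x, y \<otimes>\<^bsub>G\<^esub> z), (x, y)}" by blast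
    then show ?thesis by (rule finite_subset) simp
  qed
  have e1: "eval_chain AG \<kappa> (e p) = \<one>\<^bsub>AG\<^esub>" if "d p \<noteq> 0" for p
  proof -
    obtain x y z where p: "p = (x, y, z)" by (cases p)
    have xyz: "x \<in> carrier G" "y \<in> carrier G" "z \<in> carrier G" using d(1) that by (auto simp: chains3_def p)
    have fin: "finite {w. ind w u - ind w v \<noteq> 0}" "finite {w. ind w u - ind w v + ind w r \<noteq> 0}" for u v r :: "'a \<times> 'a"
      by (rule finite_subset[of _ "{u, v, r}"]; auto simp: ind_def split: if_splits)+
    have "eval_chain AG \<kappa> (e p) = \<kappa> (y, z) \<otimes>\<^bsub>AG\<^esub> inv\<^bsub>AG\<^esub> \<kappa> (x \<otimes>\<^bsub>G\<^esub> y, z) \<otimes>\<^bsub>AG\<^esub> \<kappa> (x, y \<otimes>\<^bsub>G\<^esub> z) \<otimes>\<^bsub>AG\<^esub> inv\<^bsub>AG\<^esub> \<kappa> (x, y)"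
      unfolding p e_def by (simp add: AG.eval_chain_diff[where f = \<kappa>, OF \<kappa>_closed] AG.eval_chain_add[where f = \<kappa>, OF \<kappa>_closed] AG.eval_chain_ind[where f = \<kappa>, OF \<kappa>_closed] fin fin[simplified])
    also have "\<dots> = (\<kappa> (y, z) \<otimes>\<^bsub>AG\<^esub> \<kappa> (x, y \<otimes>\<^bsub>G\<^esub> z)) \<otimes>\<^bsub>AG\<^esub> inv\<^bsub>AG\<^esub> (\<kappa> (x, y) \<otimes>\<^bsub>AG\<^esub> \<kappa> (x \<otimes>\<^bsub>G\<^esub> y, z))"
      using \<kappa>_closed by (simp add: AG.inv_mult AG.m_ac)
    also have "\<kappa> (y, z) \<otimes>\<^bsub>AG\<^esub> \<kappa> (x, y \<otimes>\<^bsub>G\<^esub> z) = \<kappa> (x, y) \<otimes>\<^bsub>AG\<^esub> \<kappa> (x \<otimes>\<^bsub>G\<^esub> y, z)"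
      using cocycle[OF xyz] by (simp add: AG_simps)
    finally show ?thesis using \<kappa>_closed by simp
  qed
  have "eval_chain AG \<kappa> c = finprod AG (\<lambda>p. eval_chain AG \<kappa> (e p) [^]\<^bsub>AG\<^esub> d p) {p. d p \<noteq> 0}"
    unfolding c using d(1) fin_e by (intro AG.eval_chain_sum \<kappa>_closed) (auto simp: chains3_def)
  also have "\<dots> = finprod AG (\<lambda>p. \<one>\<^bsub>AG\<^esub>) {p. d p \<noteq> 0}"
    using e1 by (intro AG.finprod_cong') auto
  also have "\<dots> = \<one>\<^bsub>AG\<^esub>" by (rule AG.finprod_one_eqI) (rule refl)
  finally show ?thesis by (simp only: AG_simps(3))
qed

text \<open>By \<open>pullback\<close>, \<tau> evaluated on a boundary \<open>bar_d2 G' z\<close> is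
  the inverse of \<kappa> evaluated on the push-forward of \<open>z\<close>, and the boundary of a
  cycle is zero.\<close>

lemma eval_push_cycle:
  assumes "z \<in> cycles2 G'" shows "eval_chain AG \<kappa> (push2 q z) = \<one>"
proof -
  have fin: "finite {p. z p \<noteq> 0}" and zc: "\<And>x y. z (x, y) \<noteq> 0 \<Longrightarrow> x \<in> carrier G' \<and> y \<in> carrier G'"
    and dz: "bar_d2 G' z = (\<lambda>_. 0)"
    using assms by (auto simp: cycles2_def chains2_def)
  define e where "e p = (\<lambda>v. ind v (snd p) - ind v (fst p \<otimes>\<^bsub>G'\<^esub> snd p) + ind v (fst p))" for p
  have fin1: "finite {w. ind w u - ind w v \<noteq> 0}" "finite {w. ind w u - ind w v + ind w r \<noteq> 0}" for u v r :: 'b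
    by (rule finite_subset[of _ "{u, v, r}"]; auto simp: ind_def split: if_splits)+
  have e: "eval_chain AG \<tau> (e p) = inv\<^bsub>AG\<^esub> \<kappa> (q (fst p), q (snd p))" if "z p \<noteq> 0" for p
  proof -
    obtain x y where p: "p = (x, y)" by (cases p)
    have xy: "x \<in> carrier G'" "y \<in> carrier G'" using zc that by (auto simp: p)
    have "eval_chain AG \<tau> (e p) = \<tau> y \<otimes>\<^bsub>AG\<^esub> inv\<^bsub>AG\<^esub> \<tau> (x \<otimes>\<^bsub>G'\<^esub> y) \<otimes>\<^bsub>AG\<^esub> \<tau> x"
      unfolding p e_def by (simp add: AG.eval_chain_diff[where f = \<tau>, OF \<tau>_closed] AG.eval_chain_add[where f = \<tau>, OF \<tau>_closed] AG.eval_chain_ind[where f = \<tau>, OF \<tau>_closed] fin1 fin1[simplified])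
    also have "\<tau> (x \<otimes>\<^bsub>G'\<^esub> y) = \<tau> x \<otimes>\<^bsub>AG\<^esub> \<tau> y \<otimes>\<^bsub>AG\<^esub> \<kappa> (q x, q y)"
      using pullback[OF xy] by (simp add: AG_simps)
    also have "\<tau> y \<otimes>\<^bsub>AG\<^esub> inv\<^bsub>AG\<^esub> (\<tau> x \<otimes>\<^bsub>AG\<^esub> \<tau> y \<otimes>\<^bsub>AG\<^esub> \<kappa> (q x, q y)) \<otimes>\<^bsub>AG\<^esub> \<tau> x
        = inv\<^bsub>AG\<^esub> \<kappa> (q x, q y)"
      by (rule AG.mult_inv_mult_cancel) (rule \<tau>_closed \<kappa>_closed)+
    finally show ?thesis by (simp add: p)
  qed
  have "eval_chain AG \<tau> (bar_d2 G' z) = finprod AG (\<lambda>p. eval_chain AG \<tau> (e p) [^]\<^bsub>AG\<^esub> z p) {p. z p \<noteq> 0}"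
    unfolding bar_d2_def e_def by (rule AG.eval_chain_sum[where f = \<tau>, OF \<tau>_closed fin]) (rule fin1)
  also have "\<dots> = eval_chain AG (\<lambda>p. \<kappa> (q (fst p), q (snd p))) (\<lambda>p. - z p)"
    unfolding eval_chain_def[of AG _ "\<lambda>p. - z p"] using e \<kappa>_closed
    by (intro AG.finprod_cong') (auto simp: AG.int_pow_inv AG.int_pow_neg)
  also have "\<dots> = inv\<^bsub>AG\<^esub> (eval_chain AG (\<lambda>p. \<kappa> (q (fst p), q (snd p))) z)"
    by (rule AG.eval_chain_minus[OF \<kappa>_closed fin])
  also have "eval_chain AG (\<lambda>p. \<kappa> (q (fst p), q (snd p))) z = eval_chain AG \<kappa> (push2 q z)"
  proof -
    have "push2 q z = (\<lambda>w. \<Sum>p\<in>{p. z p \<noteq> 0}. z p * ind w (q (fst p), q (snd p)))"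
      by (rule ext) (simp add: push2_lin[OF fin] lin_chain_def)
    then have "eval_chain AG \<kappa> (push2 q z) = finprod AG (\<lambda>p. eval_chain AG \<kappa> (\<lambda>w. ind w (q (fst p), q (snd p))) [^]\<^bsub>AG\<^esub> z p) {p. z p \<noteq> 0}"
      using AG.eval_chain_sum[where f = \<kappa>, OF \<kappa>_closed fin, of "\<lambda>p w. ind w (q (fst p), q (snd p))"] by simp
    then show ?thesis by (simp add: AG.eval_chain_ind[where f = \<kappa>, OF \<kappa>_closed] eval_chain_def[of AG _ z])
  qed
  finally have "inv\<^bsub>AG\<^esub> (eval_chain AG \<kappa> (push2 q z)) = \<one>\<^bsub>AG\<^esub>"
    using dz by (simp add: AG.eval_chain_0[where f = \<tau>, OF \<tau>_closed])
  then have "eval_chain AG \<kappa> (push2 q z) = \<one>\<^bsub>AG\<^esub>"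
    using AG.eval_chain_closed[where f = \<kappa>, OF \<kappa>_closed] by (metis AG.inv_inv AG.inv_one)
  then show ?thesis by (simp add: AG_simps)
qed

text \<open>Each triangle of the fan records the failure of \<sigma> to be multiplicative at one
  step from a prefix to the next. The prefix \<open>p\<close> is arbitrary because it grows along
  the induction.\<close>

lemma eval_word_chain:
  assumes "p \<in> carrier G" "set xs \<subseteq> carrier G"
  shows "eval_chain AG \<kappa> (word_chain G p xs) \<otimes> \<sigma> (p \<otimes>\<^bsub>G\<^esub> foldr (\<otimes>\<^bsub>G\<^esub>) xs \<one>\<^bsub>G\<^esub>)
    = \<sigma> p \<otimes> foldr (\<otimes>) (map \<sigma> xs) \<one>"
  using assms
proof (induction xs arbitrary: p)
  case Nil
  then show ?case by (simp add: AG.eval_chain_0[where f = \<kappa>, OF \<kappa>_closed] AG_simps(3) \<sigma>)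
next
  case (Cons x xs)
  then have px: "p \<in> carrier G" "x \<in> carrier G" "set xs \<subseteq> carrier G" "p \<otimes>\<^bsub>G\<^esub> x \<in> carrier G" by auto
  have ev: "eval_chain AG \<kappa> (word_chain G (p \<otimes>\<^bsub>G\<^esub> x) xs) \<in> A"
    using AG.eval_chain_closed[where f = \<kappa>, OF \<kappa>_closed] by (simp add: AG_simps)
  have fG: "foldr (\<otimes>\<^bsub>G\<^esub>) xs \<one>\<^bsub>G\<^esub> \<in> carrier G" using px by (intro G.foldr_mult_closed)
  have fQ: "foldr (\<otimes>) (map \<sigma> xs) \<one> \<in> carrier Q" using px \<sigma> by (intro Q.foldr_mult_closed) auto
  have "finite {w. word_chain G (p \<otimes>\<^bsub>G\<^esub> x) xs w \<noteq> 0}"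
    using px by (intro chains2_finite[where G = G] G.chains2_word_chain) auto
  then have "eval_chain AG \<kappa> (word_chain G p (x # xs)) = \<kappa> (p, x) \<otimes> eval_chain AG \<kappa> (word_chain G (p \<otimes>\<^bsub>G\<^esub> x) xs)"
    by (simp add: AG.eval_chain_add[where f = \<kappa>, OF \<kappa>_closed] AG.eval_chain_ind[where f = \<kappa>, OF \<kappa>_closed] AG_simps)
  then have "eval_chain AG \<kappa> (word_chain G p (x # xs)) \<otimes> \<sigma> (p \<otimes>\<^bsub>G\<^esub> foldr (\<otimes>\<^bsub>G\<^esub>) (x # xs) \<one>\<^bsub>G\<^esub>)
      = \<kappa> (p, x) \<otimes> (eval_chain AG \<kappa> (word_chain G (p \<otimes>\<^bsub>G\<^esub> x) xs) \<otimes> \<sigma> (p \<otimes>\<^bsub>G\<^esub> x \<otimes>\<^bsub>G\<^esub> foldr (\<otimes>\<^bsub>G\<^esub>) xs \<one>\<^bsub>G\<^esub>))"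
    using px ev fG \<kappa>_A \<sigma> by (simp add: Q.m_assoc G.m_assoc)
  also have "\<dots> = \<kappa> (p, x) \<otimes> (\<sigma> (p \<otimes>\<^bsub>G\<^esub> x) \<otimes> foldr (\<otimes>) (map \<sigma> xs) \<one>)"
    using Cons.IH[OF px(4,3)] by simp
  also have "\<dots> = (\<sigma> p \<otimes> \<sigma> x) \<otimes> foldr (\<otimes>) (map \<sigma> xs) \<one>"
    using px fQ \<kappa>_A \<sigma> by (simp add: \<sigma>_mult Q.m_assoc)
  finally show ?case using px fQ \<sigma> by (simp add: Q.m_assoc)
qed

lemma \<sigma>_inv:
  assumes "x \<in> carrier G" shows "\<sigma> (inv\<^bsub>G\<^esub> x) = inv (\<sigma> x) \<otimes> \<kappa> (x, inv\<^bsub>G\<^esub> x)"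
  using \<sigma>_mult[of x "inv\<^bsub>G\<^esub> x"] assms \<sigma> \<kappa>_A
  by (simp add: \<sigma>_one) (metis A_carrier G.inv_closed Q.inv_mult_cancel(1))

text \<open>Replacing \<open>\<sigma> (inv x)\<close> by \<open>inv (\<sigma> x)\<close> costs a
  factor \<open>\<kappa> (x, inv x)\<close> for each generator. These factors are central and
  collect to the value on the edge chain.\<close>

lemma map_\<sigma>_surface_word:
  assumes "\<And>i. i < h \<Longrightarrow> a i \<in> carrier G \<and> b i \<in> carrier G"
  shows "foldr (\<otimes>) (map \<sigma> (surface_word G h a b)) \<one> =
    surface_prod Q h (\<lambda>i. \<sigma> (a i)) (\<lambda>i. \<sigma> (b i)) \<otimes> eval_chain AG \<kappa> (edge_chain G h a b)"
  using assms
proof (induction h)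
  case 0
  then show ?case by (simp add: surface_word_def Q.surface_prod_0 edge_chain_def AG.eval_chain_0[where f = \<kappa>, OF \<kappa>_closed] AG_simps(3))
next
  case (Suc h)
  have ab: "\<And>i. i < h \<Longrightarrow> a i \<in> carrier G \<and> b i \<in> carrier G" "a h \<in> carrier G" "b h \<in> carrier G"
    using Suc.prems by auto
  let ?k = "\<kappa> (a h, inv\<^bsub>G\<^esub> (a h))" and ?l = "\<kappa> (b h, inv\<^bsub>G\<^esub> (b h))"
  let ?E = "eval_chain AG \<kappa> (edge_chain G h a b)" and ?P = "surface_prod Q h (\<lambda>i. \<sigma> (a i)) (\<lambda>i. \<sigma> (b i))"
  let ?x = "\<sigma> (a h)" and ?y = "\<sigma> (b h)"
  have E: "?E \<in> A" using AG.eval_chain_closed[where f = \<kappa>, OF \<kappa>_closed] by (simp add: AG_simps)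
  have P: "?P \<in> carrier Q" using ab \<sigma> by (intro Q.surface_prod_closed) auto
  note [simp] = \<sigma>[OF ab(2)] \<sigma>[OF ab(3)] P \<kappa>_A A_carrier[OF E] A_carrier[OF \<kappa>_A]
  have fin: "finite {w. edge_chain G h a b w \<noteq> 0}"
    by (rule chains2_finite[OF G.chains2_edge_chain]) (rule ab(1))
  have fin2: "finite {w. ind w u + ind w v \<noteq> 0}" for u v :: "'a \<times> 'a"
    by (rule finite_subset[of _ "{u, v}"]) (auto simp: ind_def split: if_splits)
  have edge: "eval_chain AG \<kappa> (edge_chain G (Suc h) a b) = ?E \<otimes> (?k \<otimes> ?l)"
    using fin AG.eval_chain_add[where f = \<kappa>, OF \<kappa>_closed fin fin2]
    by (simp add: edge_chain_def AG.eval_chain_add[where f = \<kappa>, OF \<kappa>_closed] AG.eval_chain_ind[where f = \<kappa>, OF \<kappa>_closed] AG_simps)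
  have word: "map \<sigma> (surface_word G (Suc h) a b) = map \<sigma> (surface_word G h a b) @ [?x, ?y, \<sigma> (inv\<^bsub>G\<^esub> (a h)), \<sigma> (inv\<^bsub>G\<^esub> (b h))]"
    by (simp add: surface_word_def)
  have "set (map \<sigma> (surface_word G h a b)) \<subseteq> carrier Q"
    using G.set_surface_word[of h a b] ab(1) \<sigma> by auto
  then have "foldr (\<otimes>) (map \<sigma> (surface_word G (Suc h) a b)) \<one> =
      foldr (\<otimes>) (map \<sigma> (surface_word G h a b)) \<one> \<otimes>
      foldr (\<otimes>) [?x, ?y, \<sigma> (inv\<^bsub>G\<^esub> (a h)), \<sigma> (inv\<^bsub>G\<^esub> (b h))] \<one>"
    unfolding word by (rule Q.foldr_mult_append) (use ab \<sigma> in auto)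
  also have "foldr (\<otimes>) [?x, ?y, \<sigma> (inv\<^bsub>G\<^esub> (a h)), \<sigma> (inv\<^bsub>G\<^esub> (b h))] \<one> =
      ?x \<otimes> (?y \<otimes> (\<sigma> (inv\<^bsub>G\<^esub> (a h)) \<otimes> \<sigma> (inv\<^bsub>G\<^esub> (b h))))"
    using ab \<sigma> by simp
  also have "foldr (\<otimes>) (map \<sigma> (surface_word G h a b)) \<one> = ?P \<otimes> ?E"
    by (rule Suc.IH[OF ab(1)])
  also have "?P \<otimes> ?E \<otimes> (?x \<otimes> (?y \<otimes> (\<sigma> (inv\<^bsub>G\<^esub> (a h)) \<otimes> \<sigma> (inv\<^bsub>G\<^esub> (b h)))))
      = ?P \<otimes> (?E \<otimes> (?x \<otimes> (?y \<otimes> (inv ?x \<otimes> (?k \<otimes> (inv ?y \<otimes> ?l))))))"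
    by (simp add: \<sigma>_inv[OF ab(2)] \<sigma>_inv[OF ab(3)] Q.m_assoc)
  also have "?k \<otimes> (inv ?y \<otimes> ?l) = inv ?y \<otimes> (?k \<otimes> ?l)"
    using A_central[OF \<kappa>_A[of "(a h, inv\<^bsub>G\<^esub> (a h))"], of "inv ?y"] by (simp flip: Q.m_assoc)
  also have "?E \<otimes> (?x \<otimes> (?y \<otimes> (inv ?x \<otimes> (inv ?y \<otimes> (?k \<otimes> ?l)))))
      = (?E \<otimes> (?x \<otimes> ?y \<otimes> inv ?x \<otimes> inv ?y)) \<otimes> (?k \<otimes> ?l)"
    by (simp add: Q.m_assoc)
  also have "?E \<otimes> (?x \<otimes> ?y \<otimes> inv ?x \<otimes> inv ?y) = (?x \<otimes> ?y \<otimes> inv ?x \<otimes> inv ?y) \<otimes> ?E"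
    by (rule A_central[OF E]) simp
  finally show ?case
    using Suc.prems \<sigma> by (subst Q.surface_prod_Suc) (auto simp: edge Q.m_assoc)
qed

text \<open>Since \<kappa> is trivial on boundaries and on push-forwards of cycles, it is trivial on
  the fundamental cycle, so the fan and the edge chain have the same value. The value of the fan is
  the product of \<sigma> over the letters, which is the relator of the \<sigma>-values times the
  value of the edge chain; cancelling leaves the relator.\<close>

theorem surface_prod_section:
  assumes ab: "(a, b) \<in> surface_homs G h" and im: "in_image_H2 G' G q (fund_cycle G h a b)"
  shows "surface_prod Q h (\<lambda>i. \<sigma> (a i)) (\<lambda>i. \<sigma> (b i)) = \<one>"
proof -
  have ab': "\<And>i. i < h \<Longrightarrow> a i \<in> carrier G \<and> b i \<in> carrier G" and
    rel: "foldr (\<otimes>\<^bsub>G\<^esub>) (surface_word G h a b) \<one>\<^bsub>G\<^esub> = \<one>\<^bsub>G\<^esub>"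
    using ab by (auto simp: surface_homs_def surface_rel_def)
  let ?W = "word_chain G \<one>\<^bsub>G\<^esub> (surface_word G h a b)" and ?F = "fund_cycle G h a b"
  let ?E = "edge_chain G h a b"
  have c: "?E \<in> chains2 G" "?W \<in> chains2 G" "?F \<in> chains2 G" "(\<lambda>w. ind w (\<one>\<^bsub>G\<^esub>, \<one>\<^bsub>G\<^esub>)) \<in> chains2 G"
    using ab' by (intro G.chains2_edge_chain G.chains2_surface_word G.chains2_fund_cycle chains2_ind; simp)+
  note evA = AG.eval_chain_closed[where f = \<kappa>, OF \<kappa>_closed, unfolded AG_simps]
  obtain z where z: "z \<in> cycles2 G'" "(\<lambda>p. push2 q z p - ?F p) \<in> boundaries2 G"
    using im by (auto simp: in_image_H2_def)
  have zfin: "finite {p. z p \<noteq> 0}" using z(1) by (simp add: cycles2_def chains2_def)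
  have pfin: "finite {w. push2 q z w \<noteq> 0}"
  proof (rule finite_subset)
    show "{w. push2 q z w \<noteq> 0} \<subseteq> (\<lambda>p. (q (fst p), q (snd p))) ` {p. z p \<noteq> 0}"
      by (auto simp: push2_def elim!: sum.not_neutral_contains_not_neutral)
  qed (use zfin in simp)
  have "\<one>\<^bsub>AG\<^esub> = eval_chain AG \<kappa> (push2 q z) \<otimes>\<^bsub>AG\<^esub> inv\<^bsub>AG\<^esub> (eval_chain AG \<kappa> ?F)"
    using eval_boundary[OF z(2)] AG.eval_chain_diff[where f = \<kappa>, OF \<kappa>_closed pfin chains2_finite[OF c(3)]] by (simp add: AG_simps(3))
  then have "inv\<^bsub>AG\<^esub> (eval_chain AG \<kappa> ?F) = \<one>\<^bsub>AG\<^esub>"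
    using eval_push_cycle[OF z(1)] AG.eval_chain_closed[where f = \<kappa>, OF \<kappa>_closed] by (simp flip: AG_simps(3))
  then have F1: "eval_chain AG \<kappa> ?F = \<one>\<^bsub>AG\<^esub>"
    using AG.eval_chain_closed[where f = \<kappa>, OF \<kappa>_closed] by (metis AG.inv_inv AG.inv_one)
  \<comment> \<open>The degenerate triangles contribute nothing because the section is normalised at
    the unit.\<close>
  have "\<kappa> (\<one>\<^bsub>G\<^esub>, \<one>\<^bsub>G\<^esub>) = \<one>\<^bsub>AG\<^esub>" by (simp add: \<kappa>_def \<sigma>_one AG_simps)
  then have d1: "eval_chain AG \<kappa> (\<lambda>w. 2 * int h * ind w (\<one>\<^bsub>G\<^esub>, \<one>\<^bsub>G\<^esub>)) = \<one>\<^bsub>AG\<^esub>"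
    by (subst AG.eval_chain_scale[where f = \<kappa>, OF \<kappa>_closed]) (simp_all add: AG.eval_chain_ind[where f = \<kappa>, OF \<kappa>_closed])
  have "eval_chain AG \<kappa> ?F = eval_chain AG \<kappa> ?W \<otimes>\<^bsub>AG\<^esub> inv\<^bsub>AG\<^esub> (eval_chain AG \<kappa> ?E)"
    unfolding fund_cycle_eq
    using chains2_finite[OF c(1)] chains2_finite[OF c(2)] chains2_finite[OF chains2_diff[OF c(2,1)]]
      chains2_finite[OF chains2_scale[OF c(4), of "2 * int h"]] AG.eval_chain_closed[where f = \<kappa>, OF \<kappa>_closed]
    by (simp add: AG.eval_chain_diff[where f = \<kappa>, OF \<kappa>_closed] d1)
  with F1 have WE: "eval_chain AG \<kappa> ?W = eval_chain AG \<kappa> ?E"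
    using AG.eval_chain_closed[where f = \<kappa>, OF \<kappa>_closed] by (metis AG.inv_equality AG.inv_inv AG.inv_closed)
  have "eval_chain AG \<kappa> ?W = foldr (\<otimes>) (map \<sigma> (surface_word G h a b)) \<one>"
  proof -
    have "set (surface_word G h a b) \<subseteq> carrier G" using ab' by (intro G.set_surface_word)
    moreover from this have "foldr (\<otimes>) (map \<sigma> (surface_word G h a b)) \<one> \<in> carrier Q"
      using \<sigma> by (intro Q.foldr_mult_closed) auto
    ultimately show ?thesis
      using eval_word_chain[of "\<one>\<^bsub>G\<^esub>" "surface_word G h a b"] rel A_carrier[OF evA] by (simp add: \<sigma>_one)
  qed
  also have "\<dots> = surface_prod Q h (\<lambda>i. \<sigma> (a i)) (\<lambda>i. \<sigma> (b i)) \<otimes> eval_chain AG \<kappa> ?E"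
    by (rule map_\<sigma>_surface_word) (rule ab')
  finally have "surface_prod Q h (\<lambda>i. \<sigma> (a i)) (\<lambda>i. \<sigma> (b i)) \<otimes> eval_chain AG \<kappa> ?E = \<one> \<otimes> eval_chain AG \<kappa> ?E"
    using A_carrier[OF evA] by (simp add: WE)
  moreover have "surface_prod Q h (\<lambda>i. \<sigma> (a i)) (\<lambda>i. \<sigma> (b i)) \<in> carrier Q"
    using ab' \<sigma> by (intro Q.surface_prod_closed) auto
  ultimately show ?thesis using A_carrier[OF evA] by (simp add: Q.r_cancel)
qed

end

section \<open>Lifting\<close>

lemma surface_prod_hom:
  assumes "group G" "group H" and f: "f \<in> hom G H"
    and ab: "\<And>i. i < h \<Longrightarrow> a i \<in> carrier G \<and> b i \<in> carrier G"
  shows "surface_prod H h (\<lambda>i. f (a i)) (\<lambda>i. f (b i)) = f (surface_prod G h a b)"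
  using ab
proof (induction h)
  interpret G: group G by fact
  interpret H: group H by fact
  interpret f: group_hom G H f by unfold_locales (rule f)
  {
    case 0
    show ?case by (simp add: G.surface_prod_0 H.surface_prod_0)
  next
    case (Suc h)
    then have "a i \<in> carrier G" "b i \<in> carrier G" if "i \<le> h" for i using that by auto
    moreover from this have "surface_prod G h a b \<in> carrier G" by (intro G.surface_prod_closed) auto
    ultimately show ?case using Suc
      by (subst G.surface_prod_Suc, simp, subst H.surface_prod_Suc) auto
  }
qed

lemma (in group) mixed_commutator_normal:
  assumes "N \<lhd> G" shows "mixed_commutator G N (carrier G) \<lhd> G"
  unfolding mixed_commutator_def
proof (rule normal_generateI)
  interpret N: normal N G by fact
  note [simp] = N.mem_carrier
  show "{x \<otimes> y \<otimes> inv x \<otimes> inv y |x y. x \<in> N \<and> y \<in> carrier G} \<subseteq> carrier G" by auto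
  fix z g assume "z \<in> {x \<otimes> y \<otimes> inv x \<otimes> inv y |x y. x \<in> N \<and> y \<in> carrier G}" and g: "g \<in> carrier G"
  then obtain x y where xy: "z = x \<otimes> y \<otimes> inv x \<otimes> inv y" "x \<in> N" "y \<in> carrier G" by blast
  define x' where "x' = g \<otimes> x \<otimes> inv g"
  define y' where "y' = g \<otimes> y \<otimes> inv g"
  have "x' \<in> N" unfolding x'_def using xy g by (intro N.inv_op_closed2)
  moreover have "y' \<in> carrier G" using xy g by (simp add: y'_def)
  moreover have "g \<otimes> z \<otimes> inv g = x' \<otimes> y' \<otimes> inv x' \<otimes> inv y'"
    using xy g by (simp add: x'_def y'_def m_assoc inv_mult_group)
  ultimately show "g \<otimes> z \<otimes> inv g \<in> {x \<otimes> y \<otimes> inv x \<otimes> inv y |x y. x \<in> N \<and> y \<in> carrier G}" by blast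
qed

text \<open>In the quotient of \<open>G'\<close> by \<open>C\<close> the image of the kernel is
  central, because its commutators with \<open>G'\<close> have been divided out. There the relator
  of the section values is trivial, which means that it lies in \<open>C\<close>.\<close>

lemma surface_prod_section_mem_commutator:
  assumes "group G" "group G'" and q: "q \<in> hom G' G"
    and s: "\<And>x. x \<in> carrier G \<Longrightarrow> s x \<in> carrier G' \<and> q (s x) = x" "s \<one>\<^bsub>G\<^esub> = \<one>\<^bsub>G'\<^esub>"
    and ab: "(a, b) \<in> surface_homs G h" and im: "in_image_H2 G' G q (fund_cycle G h a b)"
  shows "surface_prod G' h (\<lambda>i. s (a i)) (\<lambda>i. s (b i)) \<in> mixed_commutator G' (kernel G' G q) (carrier G')"
proof -
  interpret G: group G by fact
  interpret G': group G' by fact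
  interpret q: group_hom G' G q by unfold_locales (rule q)
  let ?N = "kernel G' G q"
  define C where "C = mixed_commutator G' ?N (carrier G')"
  interpret N: normal ?N G' by (rule q.normal_kernel)
  interpret C: normal C G' unfolding C_def by (rule G'.mixed_commutator_normal) (rule q.normal_kernel)
  define Q where "Q = G' Mod C"
  define \<pi> where "\<pi> x = C #>\<^bsub>G'\<^esub> x" for x
  interpret Q: group Q unfolding Q_def by (rule C.factorgroup_is_group)
  have "\<pi> \<in> hom G' Q" unfolding Q_def \<pi>_def by (rule C.r_coset_hom_Mod)
  then interpret \<pi>: group_hom G' Q \<pi> by unfold_locales
  have \<pi>_C: "\<pi> x = \<one>\<^bsub>Q\<^esub> \<longleftrightarrow> x \<in> C" if "x \<in> carrier G'" for x
    using that G'.coset_join1[OF _ that C.subgroup_axioms] subgroup.rcos_const[OF C.subgroup_axioms G'.is_group, of x]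
    by (auto simp: \<pi>_def Q_def FactGroup_def)
  have Q_surj: "\<exists>g\<in>carrier G'. u = \<pi> g" if "u \<in> carrier Q" for u
    using that by (auto simp: Q_def \<pi>_def carrier_FactGroup)
  interpret central_section G G' Q q \<pi> "\<lambda>x. \<pi> (s x)" "\<pi> ` ?N"
  proof (intro central_section.intro central_section_axioms.intro)
    show "group G" "group G'" "group Q" "q \<in> hom G' G" "\<pi> \<in> hom G' Q"
      by (rule G.is_group G'.is_group Q.is_group q \<pi>.homh)+
    show "\<pi> (s x) \<in> carrier Q" if "x \<in> carrier G" for x using s that by simp
    show "\<pi> (s \<one>\<^bsub>G\<^esub>) = \<one>\<^bsub>Q\<^esub>" using s by simp
    show "subgroup (\<pi> ` ?N) Q" by (rule \<pi>.subgroup_img_is_subgroup) (rule N.subgroup_axioms)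
    show "z \<otimes>\<^bsub>Q\<^esub> u = u \<otimes>\<^bsub>Q\<^esub> z" if zu: "z \<in> \<pi> ` ?N" "u \<in> carrier Q" for z u
    proof -
      obtain x y where xy: "z = \<pi> x" "x \<in> ?N" "u = \<pi> y" "y \<in> carrier G'" using zu Q_surj by blast
      have x: "x \<in> carrier G'" by (rule N.mem_carrier[OF xy(2)])
      have "\<pi> (x \<otimes>\<^bsub>G'\<^esub> y \<otimes>\<^bsub>G'\<^esub> inv\<^bsub>G'\<^esub> x \<otimes>\<^bsub>G'\<^esub> inv\<^bsub>G'\<^esub> y) = \<one>\<^bsub>Q\<^esub>"
        using G'.mixed_commutator_conj(3)[OF q.normal_kernel xy(2,4)] x xy(4) by (subst \<pi>_C) (auto simp: C_def)
      then have "\<pi> (x \<otimes>\<^bsub>G'\<^esub> y \<otimes>\<^bsub>G'\<^esub> inv\<^bsub>G'\<^esub> x \<otimes>\<^bsub>G'\<^esub> inv\<^bsub>G'\<^esub> y) \<otimes>\<^bsub>Q\<^esub> \<pi> (y \<otimes>\<^bsub>G'\<^esub> x) = \<pi> (y \<otimes>\<^bsub>G'\<^esub> x)"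
        using x xy(4) by simp
      also have "\<pi> (x \<otimes>\<^bsub>G'\<^esub> y \<otimes>\<^bsub>G'\<^esub> inv\<^bsub>G'\<^esub> x \<otimes>\<^bsub>G'\<^esub> inv\<^bsub>G'\<^esub> y) \<otimes>\<^bsub>Q\<^esub> \<pi> (y \<otimes>\<^bsub>G'\<^esub> x) = \<pi> (x \<otimes>\<^bsub>G'\<^esub> y)"
        using x xy(4) by (simp flip: \<pi>.hom_mult add: G'.m_assoc)
      finally show ?thesis using x xy by simp
    qed
    have ker: "\<pi> x \<otimes>\<^bsub>Q\<^esub> inv\<^bsub>Q\<^esub> \<pi> y \<in> \<pi> ` ?N" if "x \<in> carrier G'" "y \<in> carrier G'" "q x = q y" for x y
    proof (rule image_eqI)
      show "\<pi> x \<otimes>\<^bsub>Q\<^esub> inv\<^bsub>Q\<^esub> \<pi> y = \<pi> (x \<otimes>\<^bsub>G'\<^esub> inv\<^bsub>G'\<^esub> y)" using that by simp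
      have "q (x \<otimes>\<^bsub>G'\<^esub> inv\<^bsub>G'\<^esub> y) = q y \<otimes>\<^bsub>G\<^esub> inv\<^bsub>G\<^esub> (q y)"
        using that(1,2) by (simp flip: that(3))
      then show "x \<otimes>\<^bsub>G'\<^esub> inv\<^bsub>G'\<^esub> y \<in> ?N" using that(1,2) unfolding kernel_def by simp
    qed
    show "\<pi> (s x) \<otimes>\<^bsub>Q\<^esub> \<pi> (s y) \<otimes>\<^bsub>Q\<^esub> inv\<^bsub>Q\<^esub> \<pi> (s (x \<otimes>\<^bsub>G\<^esub> y)) \<in> \<pi> ` ?N"
      if "x \<in> carrier G" "y \<in> carrier G" for x y
      using ker[of "s x \<otimes>\<^bsub>G'\<^esub> s y" "s (x \<otimes>\<^bsub>G\<^esub> y)"] s that by simp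
    show "\<pi> v \<otimes>\<^bsub>Q\<^esub> inv\<^bsub>Q\<^esub> \<pi> (s (q v)) \<in> \<pi> ` ?N" if "v \<in> carrier G'" for v
      using ker[of v "s (q v)"] s that by simp
  qed
  have ab': "s (a i) \<in> carrier G' \<and> s (b i) \<in> carrier G'" if "i < h" for i
    using ab s that by (auto simp: surface_homs_def)
  have "\<pi> (surface_prod G' h (\<lambda>i. s (a i)) (\<lambda>i. s (b i))) = surface_prod Q h (\<lambda>i. \<pi> (s (a i))) (\<lambda>i. \<pi> (s (b i)))"
    using ab' by (intro surface_prod_hom[symmetric] G'.is_group Q.is_group \<pi>.homh)
  also have "\<dots> = \<one>\<^bsub>Q\<^esub>" by (rule surface_prod_section[OF ab im])
  finally show ?thesis using ab' by (subst (asm) \<pi>_C) (auto simp: C_def intro!: G'.surface_prod_closed)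
qed

text \<open>The image of \<open>T\<close> is all of \<open>G\<close>, so each \<open>y\<close>
  differs from some element of \<open>T\<close> by an element of the kernel.\<close>

lemma generated_by_kernel_and_lifts:
  assumes "group G" "group G'" and q: "q \<in> hom G' G"
    and gen: "generate G B = carrier G" and T: "subgroup T G'" "kernel G' G q \<subseteq> T" "B \<subseteq> q ` T"
  shows "carrier G' \<subseteq> T"
proof
  interpret G: group G by fact
  interpret G': group G' by fact
  interpret q: group_hom G' G q by unfold_locales (rule q)
  fix y assume y: "y \<in> carrier G'"
  have "subgroup (q ` T) G" by (rule q.subgroup_img_is_subgroup[OF T(1)])
  then have "carrier G \<subseteq> q ` T" using G.generate_subgroup_incl[OF T(3)] gen by simp
  then obtain t where t: "t \<in> T" "q y = q t" using y q.hom_closed by blast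
  have tc: "t \<in> carrier G'" by (rule subgroup.mem_carrier[OF T(1) t(1)])
  have "y \<otimes>\<^bsub>G'\<^esub> inv\<^bsub>G'\<^esub> t \<in> T" using T(2) y tc t(2) by (auto simp: kernel_def)
  then have "y \<otimes>\<^bsub>G'\<^esub> inv\<^bsub>G'\<^esub> t \<otimes>\<^bsub>G'\<^esub> t \<in> T" using t(1) by (rule subgroup.m_closed[OF T(1)])
  then show "y \<in> T" using y tc by (simp add: G'.m_assoc)
qed

theorem theorem3p2:
  fixes G :: "('a,'m) monoid_scheme" and G' :: "('b,'n) monoid_scheme"
    and q :: "'b \<Rightarrow> 'a" and h :: nat and a b :: "nat \<Rightarrow> 'a"
  defines "\<Gamma> \<equiv> kernel G' G q"
  defines "C \<equiv> mixed_commutator G' \<Gamma> (carrier G')"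
  defines "bb \<equiv> 2 * h"
  assumes "group G" and "group G'"
    and "q \<in> hom G' G" and "q ` carrier G' = carrier G"
    and "finite \<Gamma>"
    and "h \<ge> 1"
    and "card C = 1 \<or> real bb > log 2 (real (card C) - 1)"
    and "(a, b) \<in> surface_epis G h"
  shows "(lifts G' q h a b \<noteq> {} \<longleftrightarrow> in_image_H2 G' G q (fund_cycle G h a b))
    \<and> (lifts G' q h a b \<noteq> {} \<longrightarrow>
        real (card (lifts G' q h a b)) \<ge>
          real (card \<Gamma>) ^ bb / real (card C) * (1 - (real (card C) - 1) / 2 ^ bb))"
proof -
  interpret G: group G by fact
  interpret G': group G' by fact
  interpret q: group_hom G' G q by unfold_locales fact
  have ab: "(a, b) \<in> surface_homs G h" and gen: "generate G (a ` {..<h} \<union> b ` {..<h}) = carrier G"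
    using assms by (auto simp: surface_epis_def)
  have ab': "a i \<in> carrier G" "b i \<in> carrier G" if "i < h" for i
    using ab that by (auto simp: surface_homs_def)
  \<comment> \<open>A set-theoretic section of \<open>q\<close>, normalised at the unit as the
    factor set requires.\<close>
  define s where "s x = (if x = \<one>\<^bsub>G\<^esub> then \<one>\<^bsub>G'\<^esub> else inv_into (carrier G') q x)" for x
  have s: "s x \<in> carrier G' \<and> q (s x) = x" if "x \<in> carrier G" for x
  proof -
    have "x \<in> q ` carrier G'" using that assms by simp
    then show ?thesis by (simp add: s_def inv_into_into f_inv_into_f)
  qed
  have N: "\<Gamma> \<lhd> G'" unfolding \<Gamma>_def by (rule q.normal_kernel)
  \<comment> \<open>Lifts are the solutions congruent modulo \<Gamma> to the section values, which
    is the form counted above.\<close>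
  have lifts_eq: "lifts G' q h a b = {(a', b'). (a', b') \<in> surface_homs G' h \<and>
      (\<forall>k<h. a' k \<otimes>\<^bsub>G'\<^esub> inv\<^bsub>G'\<^esub> (s (a k)) \<in> \<Gamma> \<and> b' k \<otimes>\<^bsub>G'\<^esub> inv\<^bsub>G'\<^esub> (s (b k)) \<in> \<Gamma>)}"
  proof -
    have "x \<otimes>\<^bsub>G'\<^esub> inv\<^bsub>G'\<^esub> (s y) \<in> \<Gamma> \<longleftrightarrow> q x = y" if "x \<in> carrier G'" "y \<in> carrier G" for x y
    proof -
      have "x \<otimes>\<^bsub>G'\<^esub> inv\<^bsub>G'\<^esub> (s y) \<in> \<Gamma> \<longleftrightarrow> q x \<otimes>\<^bsub>G\<^esub> inv\<^bsub>G\<^esub> y = \<one>\<^bsub>G\<^esub>"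
        using that s by (simp add: \<Gamma>_def kernel_def)
      also have "\<dots> \<longleftrightarrow> q x = y" using that by (metis G.inv_equality G.inv_inv G.r_inv G.inv_closed q.hom_closed)
      finally show ?thesis .
    qed
    then show ?thesis using ab' by (auto simp: lifts_def surface_homs_def PiE_iff)
  qed
  have bound: "real (card (lifts G' q h a b)) \<ge> real (card \<Gamma>) ^ bb / real (card C) * (1 - (real (card C) - 1) / 2 ^ bb)"
    if im: "in_image_H2 G' G q (fund_cycle G h a b)"
    unfolding lifts_eq C_def bb_def
  proof (rule G'.card_surface_homs_congruent[OF N assms(8)])
    show "s (a k) \<in> carrier G' \<and> s (b k) \<in> carrier G'" if "k < h" for k
      using s ab' that by simp
    show "carrier G' \<subseteq> T" if "subgroup T G'" "\<Gamma> \<subseteq> T" and T: "\<And>k. k < h \<Longrightarrow> s (a k) \<in> T \<and> s (b k) \<in> T" for T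
    proof (rule generated_by_kernel_and_lifts[OF assms(4,5,6) gen])
      have "a k = q (s (a k))" "b k = q (s (b k))" if "k < h" for k using s ab' that by simp_all
      then show "a ` {..<h} \<union> b ` {..<h} \<subseteq> q ` T" using T by blast
    qed (use that in \<open>auto simp: \<Gamma>_def\<close>)
    show "surface_prod G' h (\<lambda>k. s (a k)) (\<lambda>k. s (b k)) \<in> mixed_commutator G' \<Gamma> (carrier G')"
      unfolding \<Gamma>_def using assms(4,5,6) s ab im
      by (intro surface_prod_section_mem_commutator) (auto simp: s_def)
  qed
  \<comment> \<open>The condition on the first Betti number makes the lower bound positive, so that
    the count also proves existence.\<close>
  have pos: "real (card \<Gamma>) ^ bb / real (card C) * (1 - (real (card C) - 1) / 2 ^ bb) > 0"
  proof -
    have C: "C \<subseteq> \<Gamma>" "subgroup C G'" unfolding C_def using G'.mixed_commutator_conj[OF N] by auto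
    have "finite C" using C(1) assms(8) by (rule finite_subset)
    then have cC: "card C > 0" using subgroup.one_closed[OF C(2)] by (auto simp: card_gt_0_iff)
    have "card \<Gamma> \<ge> card C" using C(1) assms(8) by (intro card_mono)
    moreover have "real (card C) - 1 < 2 ^ bb"
    proof (cases "card C = 1")
      \<comment> \<open>Now \<open>card C\<close> is at least 2, so the argument of the logarithm is
        positive and the inequality can be exponentiated.\<close>
      case False
      then have "real (card C) - 1 > 0" using cC by simp
      moreover have "log 2 (real (card C) - 1) < real bb" using assms(10) False by simp
      ultimately have "real (card C) - 1 < 2 powr real bb" by (simp add: log_less_iff)
      then show ?thesis by (simp add: powr_realpow)
    qed simp
    ultimately show ?thesis using cC by (intro mult_pos_pos divide_pos_pos zero_less_power) auto
  qed
  have "lifts G' q h a b \<noteq> {}" if "in_image_H2 G' G q (fund_cycle G h a b)"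
    using bound[OF that] pos by (auto simp: less_le_not_le)
  moreover have "in_image_H2 G' G q (fund_cycle G h a b)" if ne: "lifts G' q h a b \<noteq> {}"
  proof -
    obtain p where "p \<in> lifts G' q h a b" using ne by blast
    then have "(fst p, snd p) \<in> lifts G' q h a b" by simp
    then show ?thesis by (rule in_image_H2_of_lift[OF assms(4,5,6)])
  qed
  ultimately show ?thesis using bound by blast
qed

end
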